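(* Let $m\in\mathbb N$ and $\pmb\mu=(\mu_1,\ldots,\mu_m)$ be an $m$-tuple of finite non-negative Borel measures on $\mathbb T$. Suppose $\mathcal H_{\pmb\mu}$ is an algebra under pointwise product (i.e. $\mathcal H_{\pmb\mu}=\mathrm{Mult}(\mathcal H_{\pmb\mu})$). Then for every non-zero closed subspace $\mathcal M$ of $\mathcal H_{\pmb\mu}$ invariant under multiplication by $z$, $\dim(\mathcal M\ominus z\mathcal M)=1$. In particular, if $m\ge3$ and $\mu_m\neq0$, then $\dim(\mathcal M\ominus z\mathcal M)=1$ for every non-zero closed $z$-invariant subspace $\mathcal M$ of $\mathcal H_{\pmb\mu}$.
   Context: $\mathbb D$ open unit disc, $\mathbb T$ unit circle, $dA$ normalized area measure, $H^2$ Hardy space. For a measure $\mu$, $P_\mu(z)=\int_{\mathbb T}\frac{1-|z|^2}{|z-\zeta|^2}d\mu(\zeta)$ and $D_{\mu,j}(f)=\frac{1}{j!(j-1)!}\int_{\mathbb D}|f^{(j)}|^2P_\mu(1-|z|^2)^{j-1}dA$ ($j\ge1$); $\mathcal H_{\mu,j}=\{f\in\mathcal O(\mathbb D):D_{\mu,j}(f)<\infty\}$ if $\mu\ne0$ and $\mathcal H_{\mu,j}=H^2$ if $\mu=0$. $\mathcal H_{\pmb\mu}=\bigcap_{j=1}^m\mathcal H_{\mu_j,j}$, a Hilbert space with norm $\|f\|_{\pmb\mu}^2=\|f\|_{H^2}^2+\sum_{j=1}^mD_{\mu_j,j}(f)$. $\mathcal M\ominus z\mathcal M$ denotes the orthogonal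 complement of $z\mathcal M$ in $\mathcal M$. $\mathrm{Mult}(\mathcal H)=\{\varphi\in\mathcal O(\mathbb D):\varphi f\in\mathcal H\ \forall f\in\mathcal H\}$. *)

theory Defs
  imports "HOL-Analysis.Analysis"
begin

definition circle_measure :: "complex measure \<Rightarrow> bool" where
  "circle_measure \<mu> \<longleftrightarrow> sets \<mu> = sets borel \<and> finite_measure \<mu>
      \<and> emeasure \<mu> (- sphere 0 1) = 0"

definition Poisson :: "complex measure \<Rightarrow> complex \<Rightarrow> real" where
  "Poisson \<mu> z = set_lebesgue_integral \<mu> (sphere 0 1)
      (\<lambda>\<zeta>. (1 - (cmod z)\<^sup>2) / (cmod (z - \<zeta>))\<^sup>2)"

text \<open>Normalized area measure dA on the disc = Lebesgue measure / pi.\<close>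

definition Dmu :: "complex measure \<Rightarrow> nat \<Rightarrow> (complex \<Rightarrow> complex) \<Rightarrow> ennreal" where
  "Dmu \<mu> j f = ennreal (1 / (fact j * fact (j - 1) * pi)) *
      set_nn_integral lborel (ball 0 1)
        (\<lambda>z. ennreal ((cmod ((deriv ^^ j) f z))\<^sup>2 * Poisson \<mu> z * (1 - (cmod z)\<^sup>2) ^ (j - 1)))"

definition tcoeff :: "(complex \<Rightarrow> complex) \<Rightarrow> nat \<Rightarrow> complex" where
  "tcoeff f n = (deriv ^^ n) f 0 / of_nat (fact n)"

definition H2 :: "(complex \<Rightarrow> complex) set" where
  "H2 = {f. f holomorphic_on ball 0 1 \<and> summable (\<lambda>n. (cmod (tcoeff f n))\<^sup>2)}"

definition Hmuj :: "complex measure \<Rightarrow> nat \<Rightarrow> (complex \<Rightarrow> complex) set" where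
  "Hmuj \<mu> j = (if \<mu> = null_measure borel then H2
      else {f. f holomorphic_on ball 0 1 \<and> Dmu \<mu> j f < \<infinity>})"

definition Hmu :: "nat \<Rightarrow> (nat \<Rightarrow> complex measure) \<Rightarrow> (complex \<Rightarrow> complex) set" where
  "Hmu m \<mu>s = H2 \<inter> (\<Inter>j\<in>{1..m}. Hmuj (\<mu>s j) j)"

definition inner_H2 :: "(complex \<Rightarrow> complex) \<Rightarrow> (complex \<Rightarrow> complex) \<Rightarrow> complex" where
  "inner_H2 f g = (\<Sum>n. tcoeff f n * cnj (tcoeff g n))"

definition inner_D :: "complex measure \<Rightarrow> nat \<Rightarrow> (complex \<Rightarrow> complex) \<Rightarrow> (complex \<Rightarrow> complex) \<Rightarrow> complex" where
  "inner_D \<mu> j f g = of_real (1 / (fact j * fact (j - 1) * pi)) *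
      set_lebesgue_integral lborel (ball 0 1)
        (\<lambda>z. (deriv ^^ j) f z * cnj ((deriv ^^ j) g z) *
              of_real (Poisson \<mu> z * (1 - (cmod z)\<^sup>2) ^ (j - 1)))"

definition inner_mu :: "nat \<Rightarrow> (nat \<Rightarrow> complex measure) \<Rightarrow> (complex \<Rightarrow> complex) \<Rightarrow> (complex \<Rightarrow> complex) \<Rightarrow> complex" where
  "inner_mu m \<mu>s f g = inner_H2 f g + (\<Sum>j=1..m. inner_D (\<mu>s j) j f g)"

definition norm_mu :: "nat \<Rightarrow> (nat \<Rightarrow> complex measure) \<Rightarrow> (complex \<Rightarrow> complex) \<Rightarrow> real" where
  "norm_mu m \<mu>s f = sqrt (Re (inner_mu m \<mu>s f f))"

definition closed_z_invariant :: "nat \<Rightarrow> (nat \<Rightarrow> complex measure) \<Rightarrow> (complex \<Rightarrow> complex) set \<Rightarrow> bool" where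
  "closed_z_invariant m \<mu>s M \<longleftrightarrow>
     M \<subseteq> Hmu m \<mu>s \<and> (\<lambda>z. 0) \<in> M \<and>
     (\<forall>f\<in>M. \<forall>g\<in>M. (\<lambda>z. f z + g z) \<in> M) \<and>
     (\<forall>c. \<forall>f\<in>M. (\<lambda>z. c * f z) \<in> M) \<and>
     (\<forall>F f. (\<forall>n. F n \<in> M) \<longrightarrow> f \<in> Hmu m \<mu>s \<longrightarrow>
         (\<lambda>n. norm_mu m \<mu>s (\<lambda>z. F n z - f z)) \<longlonglongrightarrow> 0 \<longrightarrow> f \<in> M) \<and>
     (\<forall>f\<in>M. (\<lambda>z. z * f z) \<in> M)"

definition wandering :: "nat \<Rightarrow> (nat \<Rightarrow> complex measure) \<Rightarrow> (complex \<Rightarrow> complex) set \<Rightarrow> (complex \<Rightarrow> complex) set" where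
  "wandering m \<mu>s M = {f\<in>M. \<forall>g\<in>M. inner_mu m \<mu>s f (\<lambda>z. z * g z) = 0}"

text \<open>Functions are identified when they agree on the disc. A set N has dimension 1
 if it contains a non-zero element spanning it.\<close>
definition dim_one :: "(complex \<Rightarrow> complex) set \<Rightarrow> bool" where
  "dim_one N \<longleftrightarrow> (\<exists>e\<in>N. (\<exists>z\<in>ball 0 1. e z \<noteq> 0) \<and>
      (\<forall>f\<in>N. \<exists>c. \<forall>z\<in>ball 0 1. f z = c * e z))"

definition nonzero_space :: "(complex \<Rightarrow> complex) set \<Rightarrow> bool" where
  "nonzero_space M \<longleftrightarrow> (\<exists>f\<in>M. \<exists>z\<in>ball 0 1. f z \<noteq> 0)"

end

theory Submission
  imports Defs "HOL-Complex_Analysis.Complex_Analysis"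
begin

text \<open>
  Write \<open>\<H>\<close> for the space of the tuple \<open>\<mu>\<close>. If it is an algebra, multiplication by each of its elements is
  bounded by uniform boundedness, and a closed \<open>z\<close>-invariant subspace \<open>M\<close> is
  an ideal: the dilations \<open>\<phi>(rz)\<close> are bounded in \<open>\<H>\<close>, they multiply \<open>M\<close> into itself because their Taylor
  polynomials do, and \<open>M\<close> is weakly closed. If \<open>g = z\<^sup>N(1 + zG)\<close> has minimal order in \<open>M\<close> and
  \<open>d = z\<^bsup>N+1\<^esup>h\<close> lies in \<open>M\<close>, then \<open>d/z = hg - Gd\<close> lies in \<open>M\<close>, so an element of \<open>M \<ominus> zM\<close> is determined by its
  \<open>N\<close>-th coefficient; the element of smallest norm in \<open>g + zM\<close> shows that it is not zero.

  If \<open>m \<ge> 3\<close> and \<open>\<mu>\<^sub>m \<noteq> 0\<close>, then \<open>\<bar>f\<^bsup>(k)\<^esup>\<bar>\<^sup>2 \<le> C(1 - \<bar>z\<bar>)\<^bsup>1-2k\<^esup>\<close> for \<open>f \<in> \<H>\<close> and \<open>1 \<le> k \<le> m\<close>, and \<open>f\<close> is bounded. The mixed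
  terms \<open>f\<^bsup>(k)\<^esup>g\<^bsup>(l)\<^esup>\<close> of the Leibniz formula are reduced to these bounds by a radial Hardy inequality, so that
  \<open>\<H>\<close> is an algebra.
\<close>

section \<open>Rotation invariance and area means\<close>

text \<open>The obstacle is the Poisson weight. It may be singular at point masses, so its values at
  \<open>z\<close> and \<open>r z\<close> are not uniformly comparable; the bound for dilations
  therefore smooths the function by area means and integrates the kernel over the small region that
  remains, where its singularity is that of an inverse distance. Along radii the kernel becomes
  almost decreasing after multiplication by one factor \<open>1 - |z|^2\<close>, which is why
  Hardy's inequality needs a weight exponent of at least 1. Order \<open>j = 1\<close> has exponent
  0: there the identity \<open>(z f)' - z f' = f\<close> supplies the lower derivative, and the
  Leibniz formula has no mixed term. The condition \<open>m \<ge> 3\<close> is the inequality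
  \<open>m + 2 \<le> 2 m - 1\<close>: the left side is the growth exponent that area means give for
  the square of the \<open>m\<close>-th derivative, the right side the one wanted. Square norms are
  first treated as quadratic functionals with values in \<open>ennreal\<close>; the parallelogram
  law and lower semicontinuity under coefficientwise convergence then yield the vector space
  operations and completeness before any inner product is used.\<close>

lemma lborel_complex_eq:
  "(lborel :: complex measure) = distr (lborel \<Otimes>\<^sub>M lborel) borel (\<lambda>(x, y). Complex x y)"
proof (rule lborel_eqI)
  have meas: "(\<lambda>(x, y). Complex x y) \<in> borel_measurable ((lborel :: real measure) \<Otimes>\<^sub>M (lborel :: real measure))"
  proof -
    have "(\<lambda>p::real \<times> real. complex_of_real (fst p) + \<i> * complex_of_real (snd p)) \<in> borel_measurable (lborel \<Otimes>\<^sub>M lborel)"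
      by measurable
    moreover have "(\<lambda>p::real \<times> real. complex_of_real (fst p) + \<i> * complex_of_real (snd p)) = (\<lambda>(x, y). Complex x y)"
      by (auto simp: fun_eq_iff complex_eq_iff)
    ultimately show ?thesis by simp
  qed
  fix l u :: complex
  assume le: "\<And>b. b \<in> Basis \<Longrightarrow> l \<bullet> b \<le> u \<bullet> b"
  have le': "Re l \<le> Re u" "Im l \<le> Im u"
    using le[of 1] le[of \<i>] by (auto simp: Basis_complex_def)
  have "(\<lambda>(x, y). Complex x y) -` box l u \<inter> space (lborel \<Otimes>\<^sub>M lborel) = {Re l<..<Re u} \<times> {Im l<..<Im u}"
    by (auto simp: box_def Basis_complex_def space_pair_measure)
  then have "emeasure (distr (lborel \<Otimes>\<^sub>M lborel) borel (\<lambda>(x, y). Complex x y)) (box l u)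
      = emeasure (lborel \<Otimes>\<^sub>M lborel) ({Re l<..<Re u} \<times> {Im l<..<Im u})"
    using meas by (subst emeasure_distr) auto
  also have "\<dots> = ennreal (Re u - Re l) * ennreal (Im u - Im l)"
    using le' by (subst lborel.emeasure_pair_measure_Times) auto
  also have "\<dots> = (\<Prod>b\<in>Basis. (u - l) \<bullet> b)"
    using le' by (simp add: Basis_complex_def ennreal_mult)
  finally show "emeasure (distr (lborel \<Otimes>\<^sub>M lborel) borel (\<lambda>(x, y). Complex x y)) (box l u)
     = ennreal (\<Prod>b\<in>Basis. (u - l) \<bullet> b)" .
qed simp

lemma measurable_Complex_pair [measurable]:
  "(\<lambda>(x, y). Complex x y) \<in> borel_measurable (borel \<Otimes>\<^sub>M borel)"
proof -
  have "(\<lambda>p::real \<times> real. complex_of_real (fst p) + \<i> * complex_of_real (snd p)) \<in> borel_measurable (borel \<Otimes>\<^sub>M borel)"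
    by measurable
  moreover have "(\<lambda>p::real \<times> real. complex_of_real (fst p) + \<i> * complex_of_real (snd p)) = (\<lambda>(x, y). Complex x y)"
      by (auto simp: fun_eq_iff complex_eq_iff)
    ultimately show ?thesis by simp
qed

lemma measurable_Complex [measurable (raw)]:
  assumes [measurable]: "f \<in> borel_measurable M" "g \<in> borel_measurable M"
  shows "(\<lambda>x. Complex (f x) (g x)) \<in> borel_measurable M"
  by (simp add: complex_eq)

lemma nn_integral_complex_xy:
  assumes [measurable]: "f \<in> borel_measurable borel"
  shows "(\<integral>\<^sup>+z. f z \<partial>lborel) = (\<integral>\<^sup>+x. \<integral>\<^sup>+y. f (Complex x y) \<partial>lborel \<partial>lborel)"
proof -
  have "(\<integral>\<^sup>+z. f z \<partial>lborel) = (\<integral>\<^sup>+p. f (Complex (fst p) (snd p)) \<partial>((lborel::real measure) \<Otimes>\<^sub>M (lborel::real measure)))"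
    by (subst lborel_complex_eq, subst nn_integral_distr) (auto simp: case_prod_beta)
  also have "\<dots> = (\<integral>\<^sup>+x. \<integral>\<^sup>+y. f (Complex x y) \<partial>lborel \<partial>lborel)"
    by (subst lborel.nn_integral_fst[symmetric]) auto
  finally show ?thesis .
qed

lemma nn_integral_complex_yx:
  assumes [measurable]: "f \<in> borel_measurable borel"
  shows "(\<integral>\<^sup>+z. f z \<partial>lborel) = (\<integral>\<^sup>+y. \<integral>\<^sup>+x. f (Complex x y) \<partial>lborel \<partial>lborel)"
  unfolding nn_integral_complex_xy[OF assms] by (rule lborel_pair.Fubini') simp

lemma nn_integral_translate_real:
  fixes f :: "real \<Rightarrow> ennreal"
  assumes [measurable]: "f \<in> borel_measurable borel"
  shows "(\<integral>\<^sup>+x. f (x + a) \<partial>lborel) = (\<integral>\<^sup>+x. f x \<partial>lborel)"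
  using nn_integral_real_affine[OF assms, of 1 a] by (simp add: add.commute)

lemma nn_integral_shear_x:
  assumes [measurable]: "f \<in> borel_measurable borel"
  shows "(\<integral>\<^sup>+z. f (Complex (Re z + a * Im z) (Im z)) \<partial>lborel) = (\<integral>\<^sup>+z. f z \<partial>lborel)"
  by (simp add: nn_integral_complex_yx nn_integral_translate_real[where f="\<lambda>x. f (Complex x y)" for y])

lemma nn_integral_shear_y:
  assumes [measurable]: "f \<in> borel_measurable borel"
  shows "(\<integral>\<^sup>+z. f (Complex (Re z) (Im z + a * Re z)) \<partial>lborel) = (\<integral>\<^sup>+z. f z \<partial>lborel)"
  by (simp add: nn_integral_complex_xy nn_integral_translate_real[where f="\<lambda>y. f (Complex x y)" for x])

text \<open>A rotation other than \<open>-1\<close> is a product of three shears; \<open>-1\<close> is the square of \<open>\<i>\<close>.\<close>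

lemma nn_integral_rotate:
  fixes u :: complex
  assumes [measurable]: "f \<in> borel_measurable borel" and u: "cmod u = 1"
  shows "(\<integral>\<^sup>+z. f (u * z) \<partial>lborel) = (\<integral>\<^sup>+z. f z \<partial>lborel)"
proof -
  have *: "(\<integral>\<^sup>+z. f (u * z) \<partial>lborel) = (\<integral>\<^sup>+z. f z \<partial>lborel)"
    if f[measurable]: "f \<in> borel_measurable borel" and u: "cmod u = 1" "u \<noteq> -1" for f :: "complex \<Rightarrow> ennreal" and u
  proof -
    define a b where "a = Re u" and "b = Im u"
    have ab: "a\<^sup>2 + b\<^sup>2 = 1"
      using u(1) by (simp add: a_def b_def cmod_def)
    have a1: "1 + a \<noteq> 0"
    proof
      assume "1 + a = 0"
      then have "a = -1" by simp
      with ab have "b = 0" by simp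
      with \<open>a = -1\<close> u(2) show False by (simp add: a_def b_def complex_eq_iff)
    qed
    \<comment> \<open>With \<open>u = cos t + \<i> sin t\<close> this is
      \<open>- tan (t / 2)\<close>: the horizontal shear by \<open>p\<close>, the vertical shear by
      \<open>b\<close> and the horizontal shear by \<open>p\<close> again compose to the
      rotation.\<close>
    define p where "p = - b / (1 + a)"
    have bp: "1 + p * b = a"
      using a1 ab by (simp add: p_def field_simps power2_eq_square)
    have pap: "p + a * p = - b"
    proof -
      have "p + a * p = p * (1 + a)" by (simp add: algebra_simps)
      then show ?thesis using a1 by (simp add: p_def)
    qed
    have e: "Complex (X + p * (y + b * X)) (y + b * X) = u * Complex x y" if "X = x + p * y" for X x y
    proof -
      have "X + p * (y + b * X) = (1 + p * b) * x + ((1 + p * b) * p + p) * y"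
        using that by (simp add: algebra_simps)
      also have "\<dots> = a * x - b * y" using bp pap by (simp add: algebra_simps)
      finally have 1: "X + p * (y + b * X) = a * x - b * y" .
      have "y + b * X = b * x + (1 + p * b) * y" using that by (simp add: algebra_simps)
      then have 2: "y + b * X = b * x + a * y" using bp by simp
      show ?thesis unfolding 1 unfolding 2 by (simp add: complex_eq_iff a_def b_def)
    qed
    have "(\<integral>\<^sup>+z. f z \<partial>lborel) = (\<integral>\<^sup>+z. f (Complex (Re z + p * Im z) (Im z)) \<partial>lborel)"
      by (rule nn_integral_shear_x[symmetric]) simp
    also have "\<dots> = (\<integral>\<^sup>+z. f (Complex (Re z + p * (Im z + b * Re z)) (Im z + b * Re z)) \<partial>lborel)"
      by (subst nn_integral_shear_y[symmetric, where a=b]) simp_all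
    also have "\<dots> = (\<integral>\<^sup>+z. f (u * z) \<partial>lborel)"
      by (subst nn_integral_shear_x[symmetric, where a=p]) (simp_all add: e)
    finally show ?thesis by simp
  qed
  show ?thesis
  proof (cases "u = -1")
    case True
    have "(\<integral>\<^sup>+z. f (\<i> * (\<i> * z)) \<partial>lborel) = (\<integral>\<^sup>+z. f (\<i> * z) \<partial>lborel)"
      by (rule *) (auto simp: complex_eq_iff)
    also have "\<dots> = (\<integral>\<^sup>+z. f z \<partial>lborel)"
      by (rule *) (auto simp: complex_eq_iff)
    finally show ?thesis using True by (simp add: mult.assoc[symmetric])
  qed (use * assms in auto)
qed

lemma nn_integral_translate:
  fixes f :: "complex \<Rightarrow> ennreal"
  assumes [measurable]: "f \<in> borel_measurable borel"
  shows "(\<integral>\<^sup>+z. f (a + z) \<partial>lborel) = (\<integral>\<^sup>+z. f z \<partial>lborel)"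
proof -
  have "(\<integral>\<^sup>+z. f z \<partial>lborel) = (\<integral>\<^sup>+z. f z \<partial>(distr lborel borel ((+) a)))"
    by (simp add: lborel_distr_plus)
  also have "\<dots> = (\<integral>\<^sup>+z. f (a + z) \<partial>lborel)"
    by (rule nn_integral_distr) simp_all
  finally show ?thesis by simp
qed

lemma nn_integral_dilate:
  fixes f :: "complex \<Rightarrow> ennreal" and r :: real
  assumes [measurable]: "f \<in> borel_measurable borel" and r: "r > 0"
  shows "(\<integral>\<^sup>+z. f z \<partial>lborel) = ennreal (r\<^sup>2) * (\<integral>\<^sup>+z. f (of_real r * z) \<partial>lborel)"
proof -
  have "(\<integral>\<^sup>+z. f z \<partial>lborel) = (\<integral>\<^sup>+z. f z \<partial>(density (distr lborel borel (\<lambda>x. 0 + r *\<^sub>R x)) (\<lambda>_. ennreal (\<bar>r\<bar> ^ DIM(complex)))))"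
    using lborel_affine[of r "0::complex"] r by simp
  also have "\<dots> = (\<integral>\<^sup>+z. ennreal (r\<^sup>2) * f (of_real r * z) \<partial>lborel)"
    using r by (subst nn_integral_density, simp, simp, subst nn_integral_distr) (simp_all add: scaleR_conv_of_real)
  also have "\<dots> = ennreal (r\<^sup>2) * (\<integral>\<^sup>+z. f (of_real r * z) \<partial>lborel)"
    by (rule nn_integral_cmult) simp
  finally show ?thesis .
qed

section \<open>Mean value inequalities over circles and discs\<close>

lemma nn_integral_continuous_Icc:
  fixes g :: "real \<Rightarrow> real"
  assumes "continuous_on {a..b} g" "\<And>t. t \<in> {a..b} \<Longrightarrow> 0 \<le> g t"
  shows "(\<integral>\<^sup>+t. ennreal (g t) * indicator {a..b} t \<partial>lborel) = ennreal (integral {a..b} g)"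
proof -
  have "(\<integral>\<^sup>+t. ennreal (g t) * indicator {a..b} t \<partial>lborel) = (\<integral>\<^sup>+t. ennreal (indicator {a..b} t * g t) \<partial>lborel)"
    by (intro nn_integral_cong) (auto simp: indicator_def)
  also have "\<dots> = ennreal (integral {a..b} g)"
    by (rule nn_integral_has_integral_lebesgue)
       (use assms in \<open>auto intro!: integrable_integral integrable_continuous_real\<close>)
  finally show ?thesis .
qed

text \<open>Cauchy's formula at the centre of the unit circle; holomorphy on a larger disc avoids a
  boundary limit.\<close>

lemma holomorphic_circle_mean_le:
  assumes "K holomorphic_on ball 0 R" "R > 1"
  shows "ennreal (cmod (K 0)) \<le> (\<integral>\<^sup>+t. ennreal (cmod (K (exp (2 * of_real pi * \<i> * of_real t)))) * indicator {0..1} t \<partial>lborel)"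
proof -
  have sub: "cball 0 1 \<subseteq> ball (0::complex) R" using assms by auto
  have "((\<lambda>u. K u / (u - 0)) has_contour_integral (2 * of_real pi * \<i> * K 0)) (circlepath 0 1)"
    by (rule Cauchy_integral_circlepath_simple)
       (use assms sub in \<open>auto intro: holomorphic_on_subset\<close>)
  then have 1: "((\<lambda>t. K (exp (2 * of_real pi * \<i> * of_real t)) * (2 * of_real pi * \<i>)) has_integral (2 * of_real pi * \<i> * K 0)) {0..1}"
    unfolding has_contour_integral_def
  proof (rule has_integral_eq[rotated], goal_cases)
    case (1 t)
    then show ?case
      by (subst vector_derivative_circlepath01) (auto simp: circlepath mult_ac)
  qed
  have 2: "((\<lambda>t. K (exp (2 * of_real pi * \<i> * of_real t))) has_integral K 0) {0..1}"
    using has_integral_mult_left[OF 1, of "1 / (2 * of_real pi * \<i>)"] by simp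
  have c: "continuous_on {0..1} (\<lambda>t. K (exp (2 * of_real pi * \<i> * of_real t)))"
  proof (rule continuous_on_compose2[OF holomorphic_on_imp_continuous_on[OF assms(1)]])
    show "(\<lambda>t. exp (2 * of_real pi * \<i> * of_real t)) ` {0..1} \<subseteq> ball 0 R"
      using assms(2) by auto
  qed (intro continuous_intros)
  have "cmod (K 0) = cmod (integral {0..1} (\<lambda>t. K (exp (2 * of_real pi * \<i> * of_real t))))"
    using 2 by (simp add: integral_unique)
  also have "\<dots> \<le> integral {0..1} (\<lambda>t. cmod (K (exp (2 * of_real pi * \<i> * of_real t))))"
    by (rule integral_norm_bound_integral) (auto intro!: integrable_continuous_real c continuous_on_norm)
  finally show ?thesis
    by (subst nn_integral_continuous_Icc) (auto intro!: c continuous_on_norm ennreal_leI)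
qed

text \<open>Applied to \<open>F\<^sup>2\<close>, the mean value inequality for \<open>\<bar>F\<^sup>2\<bar>\<close> over circles, averaged over the disc by
  rotation invariance, gives the one for \<open>\<bar>F\<bar>\<^sup>2\<close> over discs.\<close>

lemma holomorphic_area_mean_le:
  assumes F: "F holomorphic_on ball y \<rho>" and \<rho>: "\<rho> > 0"
  shows "ennreal (pi * \<rho>\<^sup>2) * ennreal ((cmod (F y))\<^sup>2) \<le> (\<integral>\<^sup>+z\<in>ball y \<rho>. ennreal ((cmod (F z))\<^sup>2) \<partial>lborel)"
proof -
  have F2: "(\<lambda>z. (F z)\<^sup>2) holomorphic_on ball y \<rho>" using F by (intro holomorphic_intros)
  define g where "g z = ennreal ((cmod (F z))\<^sup>2) * indicator (ball y \<rho>) z" for z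
  have gm[measurable]: "g \<in> borel_measurable borel"
  proof -
    have "(\<lambda>z. indicator (ball y \<rho>) z *\<^sub>R (cmod (F z))\<^sup>2) \<in> borel_measurable borel"
      by (intro borel_measurable_continuous_on_indicator continuous_intros)
         (use F holomorphic_on_imp_continuous_on in auto)
    then have "(\<lambda>z. ennreal (indicator (ball y \<rho>) z *\<^sub>R (cmod (F z))\<^sup>2)) \<in> borel_measurable borel"
      by measurable
    also have "(\<lambda>z. ennreal (indicator (ball y \<rho>) z *\<^sub>R (cmod (F z))\<^sup>2)) = g"
      by (auto simp: g_def indicator_def fun_eq_iff)
    finally show ?thesis .
  qed
  define e where "e t = exp (2 * of_real pi * \<i> * of_real t)" for t :: real
  have ne: "cmod (e t) = 1" for t by (simp add: e_def)
  have em[measurable]: "e \<in> borel_measurable borel" unfolding e_def by measurable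
  have pw: "ennreal ((cmod (F y))\<^sup>2) * indicator (ball 0 \<rho>) x
      \<le> (\<integral>\<^sup>+t. g (y + e t * x) * indicator {0..1} t \<partial>lborel)" for x
  proof (cases "x \<in> ball 0 \<rho>")
    case True
    \<comment> \<open>As a function of \<open>w\<close>, \<open>F (y + x * w)\<close> is defined for
      \<open>|w| < \<rho> / |x|\<close>, a radius beyond 1; at \<open>x = 0\<close> it is constant
      and 2 is an arbitrary radius above 1.\<close>
    define R where "R = (if x = 0 then 2 else \<rho> / cmod x)"
    have R: "R > 1" using True by (auto simp: R_def)
    have wR: "y + x * w \<in> ball y \<rho>" if "w \<in> ball 0 R" for w
    proof (cases "x = 0")
      case False
      then have "cmod w < \<rho> / cmod x" using that by (auto simp: R_def)
      then show ?thesis using False by (simp add: dist_norm norm_mult field_simps)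
    qed (use \<rho> in auto)
    have h: "(\<lambda>w. (F (y + x * w))\<^sup>2) holomorphic_on ball 0 R"
      using wR by (intro holomorphic_on_compose_gen[OF _ F2, unfolded o_def] holomorphic_intros) auto
    have "ennreal ((cmod (F y))\<^sup>2) \<le> (\<integral>\<^sup>+t. ennreal (cmod ((F (y + x * e t))\<^sup>2)) * indicator {0..1} t \<partial>lborel)"
      using holomorphic_circle_mean_le[OF h R] by (simp add: e_def norm_power)
    also have "\<dots> = (\<integral>\<^sup>+t. g (y + e t * x) * indicator {0..1} t \<partial>lborel)"
      using True by (intro nn_integral_cong) (auto simp: g_def norm_power norm_mult ne mult.commute dist_norm)
    finally show ?thesis using True by simp
  qed simp
  have "ennreal (pi * \<rho>\<^sup>2) * ennreal ((cmod (F y))\<^sup>2) = (\<integral>\<^sup>+x. ennreal ((cmod (F y))\<^sup>2) * indicator (ball 0 \<rho>) x \<partial>(lborel :: complex measure))"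
    using \<rho> by (subst nn_integral_cmult_indicator) (auto simp: emeasure_ball unit_ball_vol_2 mult.commute)
  also have "\<dots> \<le> (\<integral>\<^sup>+x. \<integral>\<^sup>+t. g (y + e t * x) * indicator {0..1} t \<partial>lborel \<partial>lborel)"
    by (intro nn_integral_mono pw)
  also have "\<dots> = (\<integral>\<^sup>+t. \<integral>\<^sup>+x. g (y + e t * x) * indicator {0..1} t \<partial>lborel \<partial>lborel)"
    by (rule lborel_pair.Fubini'[symmetric]) measurable
  also have "\<dots> = (\<integral>\<^sup>+t. (\<integral>\<^sup>+x. g x \<partial>lborel) * indicator {0..1} (t::real) \<partial>lborel)"
  proof (intro nn_integral_cong)
    fix t :: real
    have "(\<integral>\<^sup>+x. g (y + e t * x) * indicator {0..1} t \<partial>lborel) = (\<integral>\<^sup>+x. g (y + e t * x) \<partial>lborel) * indicator {0..1} t"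
      by (rule nn_integral_multc) measurable
    also have "(\<integral>\<^sup>+x. g (y + e t * x) \<partial>lborel) = (\<integral>\<^sup>+x. g (y + x) \<partial>lborel)"
      by (rule nn_integral_rotate[where f = "\<lambda>x. g (y + x)"]) (simp_all add: ne)
    also have "\<dots> = (\<integral>\<^sup>+x. g x \<partial>lborel)" by (rule nn_integral_translate) simp
    finally show "(\<integral>\<^sup>+x. g (y + e t * x) * indicator {0..1} t \<partial>lborel) = (\<integral>\<^sup>+x. g x \<partial>lborel) * indicator {0..1} t" .
  qed
  also have "\<dots> = (\<integral>\<^sup>+x. g x \<partial>lborel)"
    by (subst nn_integral_cmult_indicator) auto
  finally show ?thesis by (simp add: g_def)
qed

section \<open>The Poisson kernel\<close>

lemma ball_sphere_borel [measurable]: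
  fixes c :: "'a::euclidean_space"
  shows "ball c r \<in> sets borel" "sphere c r \<in> sets borel"
  by (auto intro: borel_closed)

text \<open>Dyadic discs replace polar coordinates: between the radii \<open>R / 2^(k+1)\<close> and
  \<open>R / 2^k\<close> the integrand is at most \<open>2^(k+1) / R\<close>, so the disc of index
  \<open>k\<close> contributes \<open>2 * pi * R / 2^k\<close>. The geometric sum is twice the exact
  value \<open>2 * pi * R\<close>.\<close>

lemma nn_integral_inverse_dist_ball:
  fixes c :: complex
  assumes R: "R > 0"
  shows "(\<integral>\<^sup>+v\<in>ball c R. ennreal (1 / cmod (v - c)) \<partial>lborel) \<le> ennreal (4 * pi * R)"
proof -
  have pw: "ennreal (1 / cmod (v - c)) * indicator (ball c R) v
      \<le> (\<Sum>k. ennreal (2 ^ Suc k / R) * indicator (ball c (R / 2 ^ k)) v)" for v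
  proof (cases "v \<in> ball c R \<and> v \<noteq> c")
    case True
    define d where "d = cmod (v - c)"
    have d: "0 < d" "d < R" using True by (auto simp: d_def dist_norm norm_minus_commute)
    obtain n where n: "R / d < 2 ^ n" using real_arch_pow[of 2 "R / d"] by auto
    \<comment> \<open>The predecessor of \<open>N\<close> is the index of the dyadic shell
      containing \<open>v\<close>; it exists because \<open>d < R\<close> excludes
      \<open>N = 0\<close>.\<close>
    define N where "N = (LEAST n. R / 2 ^ n \<le> d)"
    have ex: "R / 2 ^ n \<le> d" using n d R by (simp add: field_simps less_imp_le)
    have N: "R / 2 ^ N \<le> d" unfolding N_def by (rule LeastI[of "\<lambda>n. R / 2 ^ n \<le> d", OF ex])
    have "N \<noteq> 0" using N d by (metis div_by_1 linorder_not_less power_0)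
    then obtain k where k: "N = Suc k" using not0_implies_Suc by blast
    have "\<not> R / 2 ^ k \<le> d" using not_less_Least[of k "\<lambda>n. R / 2 ^ n \<le> d"] k N_def by auto
    then have kd: "v \<in> ball c (R / 2 ^ k)" by (simp add: d_def dist_norm norm_minus_commute)
    have "1 / d \<le> 2 ^ Suc k / R" using N d R unfolding k by (simp add: field_simps)
    then have "ennreal (1 / d) \<le> ennreal (2 ^ Suc k / R) * indicator (ball c (R / 2 ^ k)) v"
      using kd by (simp add: ennreal_leI)
    also have "\<dots> \<le> (\<Sum>k. ennreal (2 ^ Suc k / R) * indicator (ball c (R / 2 ^ k)) v)"
      using sum_le_suminf[of "\<lambda>k. ennreal (2 ^ Suc k / R) * indicator (ball c (R / 2 ^ k)) v" "{k}"]
      by (simp del: sum_mult_indicator)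
    finally show ?thesis using True by (simp add: d_def)
  qed auto
  have "(\<integral>\<^sup>+v\<in>ball c R. ennreal (1 / cmod (v - c)) \<partial>lborel)
      \<le> (\<integral>\<^sup>+v. (\<Sum>k. ennreal (2 ^ Suc k / R) * indicator (ball c (R / 2 ^ k)) v) \<partial>lborel)"
    by (intro nn_integral_mono pw)
  also have "\<dots> = (\<Sum>k. \<integral>\<^sup>+v. ennreal (2 ^ Suc k / R) * indicator (ball c (R / 2 ^ k)) v \<partial>lborel)"
    by (rule nn_integral_suminf) measurable
  also have "\<dots> = (\<Sum>k. ennreal (2 * pi * R * (1 / 2) ^ k))"
  proof (rule suminf_cong)
    fix k
    have "(\<integral>\<^sup>+v. ennreal (2 ^ Suc k / R) * indicator (ball c (R / 2 ^ k)) v \<partial>lborel)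
       = ennreal (2 ^ Suc k / R) * ennreal (pi * (R / 2 ^ k)\<^sup>2)"
      using R by (subst nn_integral_cmult_indicator) (auto simp: emeasure_ball unit_ball_vol_2)
    also have "\<dots> = ennreal (2 * pi * R * (1 / 2) ^ k)"
      using R by (subst ennreal_mult[symmetric]) (auto simp: field_simps power2_eq_square)
    finally show "(\<integral>\<^sup>+v. ennreal (2 ^ Suc k / R) * indicator (ball c (R / 2 ^ k)) v \<partial>lborel) = ennreal (2 * pi * R * (1 / 2) ^ k)" .
  qed
  also have "\<dots> = ennreal (4 * pi * R)"
  proof (rule suminf_ennreal_eq)
    have "(\<lambda>k. (1 / 2 :: real) ^ k) sums (1 / (1 - 1 / 2))" by (rule geometric_sums) simp
    from sums_mult[OF this, of "2 * pi * R"] show "(\<lambda>k. 2 * pi * R * (1 / 2) ^ k) sums (4 * pi * R)" by (simp add: mult.assoc)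
  qed (use R in auto)
  finally show ?thesis .
qed

definition pkern :: "complex \<Rightarrow> complex \<Rightarrow> real" where
  "pkern \<zeta> z = (1 - (cmod z)\<^sup>2) / (cmod (z - \<zeta>))\<^sup>2"

lemma one_minus_norm_sq_bounds:
  assumes "cmod z \<le> 1"
  shows "1 - cmod z \<le> 1 - (cmod z)\<^sup>2" "1 - (cmod z)\<^sup>2 \<le> 2 * (1 - cmod z)"
proof -
  have "1 - (cmod z)\<^sup>2 = (1 - cmod z) * (1 + cmod z)" by (simp add: algebra_simps power2_eq_square)
  moreover have "(1 - cmod z) * 1 \<le> (1 - cmod z) * (1 + cmod z)" "(1 - cmod z) * (1 + cmod z) \<le> (1 - cmod z) * 2"
    using assms by (intro mult_left_mono; simp)+
  ultimately show "1 - cmod z \<le> 1 - (cmod z)\<^sup>2" "1 - (cmod z)\<^sup>2 \<le> 2 * (1 - cmod z)" by simp_all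
qed

lemma pkern_nonneg: "cmod z \<le> 1 \<Longrightarrow> 0 \<le> pkern \<zeta> z"
  by (simp add: pkern_def power_le_one)

lemma dist_circle_ge:
  assumes "cmod \<zeta> = 1"
  shows "1 - cmod z \<le> cmod (z - \<zeta>)"
  using assms norm_triangle_ineq2[of \<zeta> z] by (simp add: norm_minus_commute)

text \<open>From \<open>1 - |v|^2 \<le> 2 (1 - |v|) \<le> 2 |v - \<zeta>|\<close>. The resulting
  singularity is locally integrable in the plane.\<close>

lemma pkern_le_inverse_dist:
  assumes "cmod \<zeta> = 1" "cmod v < 1"
  shows "pkern \<zeta> v \<le> 2 * (1 / cmod (v - \<zeta>))"
proof -
  have d: "1 - cmod v \<le> cmod (v - \<zeta>)" "0 < cmod (v - \<zeta>)"
    using dist_circle_ge[OF assms(1), of v] assms(2) by auto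
  have "1 - (cmod v)\<^sup>2 \<le> 2 * cmod (v - \<zeta>)"
    by (rule order_trans[OF one_minus_norm_sq_bounds(2)]) (use assms(2) d(1) in auto)
  then have "pkern \<zeta> v \<le> 2 * cmod (v - \<zeta>) / (cmod (v - \<zeta>))\<^sup>2"
    unfolding pkern_def by (intro divide_right_mono) auto
  then show ?thesis using d by (simp add: power2_eq_square)
qed

text \<open>The kernel at \<open>v\<close> may exceed the kernel at \<open>x\<close> by any factor
  when \<open>v\<close> approaches \<open>\<zeta>\<close>, so the comparison is made after
  integration. If \<open>x\<close> lies within \<open>6 \<tau>\<close> of \<open>\<zeta>\<close>,
  the kernel at \<open>x\<close> has size \<open>1 / \<tau>\<close> and the inverse-distance bound
  suffices; otherwise every point of \<open>A\<close> keeps at least half the distance of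
  \<open>x\<close> from \<open>\<zeta>\<close>, and the comparison is pointwise.\<close>

lemma nn_integral_pkern_local:
  assumes \<zeta>: "cmod \<zeta> = 1" and x: "cmod x < 1" and \<tau>: "\<tau> = 1 - cmod x"
    and A: "A \<in> sets borel" "\<And>v. v \<in> A \<Longrightarrow> cmod v < 1 \<and> cmod (v - x) \<le> 3 * \<tau> \<and> 1 - cmod v \<le> 2 * \<tau>"
  shows "(\<integral>\<^sup>+v\<in>A. ennreal (pkern \<zeta> v) \<partial>lborel) \<le> ennreal (2880 * pi * \<tau>\<^sup>2) * ennreal (pkern \<zeta> x)"
proof -
  have \<tau>0: "\<tau> > 0" using x \<tau> by simp
  define d where "d = cmod (x - \<zeta>)"
  have d\<tau>: "\<tau> \<le> d" using dist_circle_ge[OF \<zeta>, of x] by (simp add: d_def \<tau>)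
  have px: "\<tau> / d\<^sup>2 \<le> pkern \<zeta> x"
    unfolding pkern_def d_def[symmetric] using one_minus_norm_sq_bounds(1)[of x] x
    by (intro divide_right_mono) (auto simp: \<tau>)
  show ?thesis
  proof (cases "d \<le> 6 * \<tau>")
    case True
    \<comment> \<open>Points of \<open>A\<close> are within \<open>3 \<tau>\<close> of
      \<open>x\<close>, hence within \<open>9 \<tau>\<close> of \<open>\<zeta>\<close>; the open
      disc of radius \<open>10 \<tau>\<close> contains them.\<close>
    have "(\<integral>\<^sup>+v\<in>A. ennreal (pkern \<zeta> v) \<partial>lborel) \<le> (\<integral>\<^sup>+v. 2 * (ennreal (1 / cmod (v - \<zeta>)) * indicator (ball \<zeta> (10 * \<tau>)) v) \<partial>lborel)"
    proof (intro nn_integral_mono)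
      fix v
      show "ennreal (pkern \<zeta> v) * indicator A v \<le> 2 * (ennreal (1 / cmod (v - \<zeta>)) * indicator (ball \<zeta> (10 * \<tau>)) v)"
      proof (cases "v \<in> A")
        case True': True
        have "cmod (v - \<zeta>) \<le> cmod (v - x) + d"
          unfolding d_def by (rule order_trans[OF _ norm_triangle_ineq]) simp
        then have "v \<in> ball \<zeta> (10 * \<tau>)" using A(2)[OF True'] True \<tau>0 by (simp add: dist_norm norm_minus_commute)
        moreover have "ennreal (pkern \<zeta> v) \<le> ennreal (2 * (1 / cmod (v - \<zeta>)))"
          using A(2)[OF True'] by (intro ennreal_leI pkern_le_inverse_dist \<zeta>) auto
        moreover have "ennreal (2 * (1 / cmod (v - \<zeta>))) = 2 * ennreal (1 / cmod (v - \<zeta>))"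
          by (subst ennreal_mult) auto
        ultimately show ?thesis using True' by (metis indicator_simps(1) mult.right_neutral)
      qed simp
    qed
    also have "\<dots> = 2 * (\<integral>\<^sup>+v\<in>ball \<zeta> (10 * \<tau>). ennreal (1 / cmod (v - \<zeta>)) \<partial>lborel)"
      by (rule nn_integral_cmult) measurable
    also have "\<dots> \<le> 2 * ennreal (4 * pi * (10 * \<tau>))"
      using \<tau>0 by (intro mult_left_mono nn_integral_inverse_dist_ball) auto
    also have "\<dots> = ennreal (80 * pi * \<tau>)"
      using \<tau>0 by (subst ennreal_numeral[symmetric], subst ennreal_mult[symmetric]) auto
    \<comment> \<open>\<open>2880 = 80 * 36\<close>, where 36 comes from
      \<open>d^2 \<le> 36 \<tau>^2\<close>.\<close>
    also have "\<dots> \<le> ennreal (2880 * pi * \<tau>\<^sup>2 * pkern \<zeta> x)"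
    proof (rule ennreal_leI)
      have "d\<^sup>2 \<le> (6 * \<tau>)\<^sup>2" using True d\<tau> \<tau>0 by (intro power_mono) auto
      then have "\<tau> / (36 * \<tau>\<^sup>2) \<le> \<tau> / d\<^sup>2"
        using \<tau>0 d\<tau> by (intro divide_left_mono) (auto simp: power_mult_distrib)
      then have "1 / (36 * \<tau>) \<le> pkern \<zeta> x" using px \<tau>0 by (simp add: power2_eq_square)
      then have "2880 * pi * \<tau>\<^sup>2 * (1 / (36 * \<tau>)) \<le> 2880 * pi * \<tau>\<^sup>2 * pkern \<zeta> x"
        using \<tau>0 by (intro mult_left_mono) auto
      then show "80 * pi * \<tau> \<le> 2880 * pi * \<tau>\<^sup>2 * pkern \<zeta> x"
        using \<tau>0 by (simp add: power2_eq_square)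
    qed
    finally show ?thesis using \<tau>0 x by (simp add: ennreal_mult pkern_nonneg)
  next
    case False
    have "(\<integral>\<^sup>+v\<in>A. ennreal (pkern \<zeta> v) \<partial>lborel) \<le> (\<integral>\<^sup>+v. ennreal (16 * pkern \<zeta> x) * indicator (ball x (4 * \<tau>)) v \<partial>lborel)"
    proof (intro nn_integral_mono)
      fix v
      show "ennreal (pkern \<zeta> v) * indicator A v \<le> ennreal (16 * pkern \<zeta> x) * indicator (ball x (4 * \<tau>)) v"
      proof (cases "v \<in> A")
        case True
        note v = A(2)[OF True]
        have "d \<le> cmod (v - x) + cmod (v - \<zeta>)"
          unfolding d_def by (metis norm_minus_commute norm_diff_triangle_ineq norm_triangle_sub norm_diff_triangle_le order_refl)
        then have vd: "d / 2 \<le> cmod (v - \<zeta>)" using v False by simp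
        have "pkern \<zeta> v \<le> (4 * \<tau>) / (d / 2)\<^sup>2"
          unfolding pkern_def
        proof (rule frac_le)
          show "1 - (cmod v)\<^sup>2 \<le> 4 * \<tau>" using one_minus_norm_sq_bounds(2)[of v] v by simp
          show "(d / 2)\<^sup>2 \<le> (cmod (v - \<zeta>))\<^sup>2" using vd d\<tau> \<tau>0 by (intro power_mono) auto
        qed (use \<tau>0 d\<tau> in auto)
        also have "\<dots> = 16 * (\<tau> / d\<^sup>2)" by (simp add: power_divide)
        also have "\<dots> \<le> 16 * pkern \<zeta> x" using px by simp
        finally have "ennreal (pkern \<zeta> v) \<le> ennreal (16 * pkern \<zeta> x)" by (rule ennreal_leI)
        moreover have "v \<in> ball x (4 * \<tau>)" using v \<tau>0 by (simp add: dist_norm norm_minus_commute)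
        ultimately show ?thesis using True by simp
      qed simp
    qed
    also have "\<dots> = ennreal (16 * pkern \<zeta> x) * ennreal (pi * (4 * \<tau>)\<^sup>2)"
      using \<tau>0 by (subst nn_integral_cmult_indicator) (auto simp: emeasure_ball unit_ball_vol_2)
    also have "\<dots> = ennreal (256 * pi * \<tau>\<^sup>2 * pkern \<zeta> x)"
      using x \<tau>0 by (subst ennreal_mult[symmetric]) (auto simp: pkern_nonneg power_mult_distrib mult_ac)
    also have "\<dots> \<le> ennreal (2880 * pi * \<tau>\<^sup>2 * pkern \<zeta> x)"
      using pkern_nonneg[of x \<zeta>] x by (intro ennreal_leI mult_right_mono) auto
    finally show ?thesis using \<tau>0 x by (simp add: ennreal_mult pkern_nonneg)
  qed
qed

text \<open>Each side contains the square of a quotient \<open>(1 - |x|^2) / |x - \<zeta>|\<close>.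
  Moving along the radius changes the denominator by at most \<open>1 - |y|^2\<close>, and the
  numerator at \<open>x\<close> is at most \<open>2 |x - \<zeta>|\<close>, so the quotient at
  \<open>x\<close> is at most three times that at \<open>y\<close>. The kernel alone admits no such
  bound: at \<open>t \<zeta>\<close> it tends to infinity as \<open>t\<close> increases to
  1.\<close>

lemma pkern_radial:
  assumes \<zeta>: "cmod \<zeta> = 1" and x: "cmod x < 1" and s: "0 \<le> s" "s \<le> 1"
  defines "y \<equiv> of_real s * x"
  shows "pkern \<zeta> x * (1 - (cmod x)\<^sup>2) \<le> 9 * (pkern \<zeta> y * (1 - (cmod y)\<^sup>2))"
proof -
  define a b tx ty where "a = cmod (x - \<zeta>)" and "b = cmod (y - \<zeta>)" and "tx = 1 - (cmod x)\<^sup>2" and "ty = 1 - (cmod y)\<^sup>2"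
  have cy: "cmod y = s * cmod x" using s by (simp add: y_def norm_mult)
  have yx: "cmod y \<le> cmod x" unfolding cy using s by (simp add: mult_left_le_one_le)
  have pos: "0 < a" "0 < b" "0 < tx" "0 < ty"
    using dist_circle_ge[OF \<zeta>, of x] dist_circle_ge[OF \<zeta>, of y] x yx
      one_minus_norm_sq_bounds(1)[of x] one_minus_norm_sq_bounds(1)[of y] unfolding a_def b_def tx_def ty_def by auto
  have txy: "tx \<le> ty" unfolding tx_def ty_def using yx by (simp add: power_mono)
  have "x - y = of_real (1 - s) * x" by (simp add: y_def algebra_simps)
  then have "cmod (x - y) = (1 - s) * cmod x" using s by (simp only: norm_mult norm_of_real abs_of_nonneg diff_ge_0_iff_ge)
  then have "cmod (x - y) = cmod x - cmod y" by (simp add: cy algebra_simps)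
  then have xy: "cmod (x - y) \<le> ty"
    using one_minus_norm_sq_bounds(1)[of y] x yx by (simp add: ty_def)
  have b: "b \<le> a + ty"
    using norm_triangle_ineq[of "x - \<zeta>" "y - x"] xy by (simp add: a_def b_def norm_minus_commute)
  have ta: "tx \<le> 2 * a"
    using one_minus_norm_sq_bounds(2)[of x] x dist_circle_ge[OF \<zeta>, of x] by (simp add: tx_def a_def)
  have "tx * b \<le> tx * a + tx * ty" using mult_left_mono[OF b, of tx] pos by (simp add: algebra_simps)
  also have "\<dots> \<le> ty * a + (2 * a) * ty" using txy ta pos by (intro add_mono mult_right_mono) auto
  finally have "tx / a \<le> 3 * (ty / b)" using pos by (simp add: field_simps)
  then have "(tx / a)\<^sup>2 \<le> (3 * (ty / b))\<^sup>2" using pos by (intro power_mono) auto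
  then have "tx\<^sup>2 / a\<^sup>2 \<le> 9 * (ty\<^sup>2 / b\<^sup>2)"
    by (simp add: power_divide power_mult_distrib)
  then show ?thesis
    unfolding pkern_def a_def[symmetric] b_def[symmetric] tx_def[symmetric] ty_def[symmetric]
    by (simp add: power2_eq_square)
qed

section \<open>Poisson integrals of measures on the circle\<close>

locale circle_meas =
  fixes \<mu> :: "complex measure"
  assumes circle: "circle_measure \<mu>"
begin

lemma sets_mu [measurable_cong]: "sets \<mu> = sets borel"
  using circle by (simp add: circle_measure_def)

sublocale finite_measure \<mu>
  using circle by (simp add: circle_measure_def)

lemma pkern_measurable [measurable]:
  "(\<lambda>p. pkern (snd p) (fst p)) \<in> borel_measurable (borel \<Otimes>\<^sub>M \<mu>)"
  "(\<lambda>p. pkern (fst p) (snd p)) \<in> borel_measurable (\<mu> \<Otimes>\<^sub>M borel)"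
  unfolding pkern_def by measurable

lemma pkern_measurable' [measurable]: "(\<lambda>\<zeta>. pkern \<zeta> z) \<in> borel_measurable \<mu>" "pkern \<zeta> \<in> borel_measurable borel"
  unfolding pkern_def by measurable

lemma Poisson_eq_pkern: "Poisson \<mu> z = (LINT \<zeta>|\<mu>. indicator (sphere 0 1) \<zeta> * pkern \<zeta> z)"
  by (simp add: Poisson_def set_lebesgue_integral_def pkern_def)

lemma Poisson_measurable [measurable]: "Poisson \<mu> \<in> borel_measurable borel"
proof -
  have "(\<lambda>(z, \<zeta>). indicator (sphere 0 1) \<zeta> * pkern \<zeta> z) \<in> borel_measurable (borel \<Otimes>\<^sub>M \<mu>)"
    unfolding pkern_def by (subst measurable_cong_sets[OF sets_pair_measure_cong[OF refl sets_mu] refl]) measurable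
  then have "(\<lambda>z. LINT \<zeta>|\<mu>. indicator (sphere 0 1) \<zeta> * pkern \<zeta> z) \<in> borel_measurable borel"
    by (rule borel_measurable_lebesgue_integral)
  then show ?thesis by (simp add: Poisson_eq_pkern[abs_def])
qed

lemma pkern_sphere_nonneg: "cmod z < 1 \<Longrightarrow> 0 \<le> indicator (sphere 0 1) \<zeta> * pkern \<zeta> z"
  by (auto simp: indicator_def pkern_nonneg)

lemma pkern_integrable:
  assumes z: "cmod z < 1"
  shows "integrable \<mu> (\<lambda>\<zeta>. indicator (sphere 0 1) \<zeta> * pkern \<zeta> z)"
proof (rule integrable_const_bound[where B = "2 / (1 - cmod z)"])
  have "indicator (sphere 0 1) \<zeta> * pkern \<zeta> z \<le> 2 / (1 - cmod z)" for \<zeta>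
  proof (cases "cmod \<zeta> = 1")
    case True
    have "pkern \<zeta> z \<le> 2 * (1 / cmod (z - \<zeta>))" by (rule pkern_le_inverse_dist[OF True z])
    also have "\<dots> \<le> 2 / (1 - cmod z)"
      using dist_circle_ge[OF True, of z] z by (auto intro!: divide_left_mono mult_pos_pos)
    finally show ?thesis using True by simp
  qed (use z in auto)
  then show "AE \<zeta> in \<mu>. norm (indicator (sphere 0 1) \<zeta> * pkern \<zeta> z) \<le> 2 / (1 - cmod z)"
    using pkern_sphere_nonneg[OF z] by (auto simp del: norm_mult)
qed measurable

lemma Poisson_nonneg: "cmod z < 1 \<Longrightarrow> 0 \<le> Poisson \<mu> z"
  unfolding Poisson_eq_pkern by (rule Bochner_Integration.integral_nonneg) (use pkern_sphere_nonneg in auto)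

lemma ennreal_Poisson:
  assumes z: "cmod z < 1"
  shows "ennreal (Poisson \<mu> z) = (\<integral>\<^sup>+\<zeta>. indicator (sphere 0 1) \<zeta> * ennreal (pkern \<zeta> z) \<partial>\<mu>)"
proof -
  have "(\<integral>\<^sup>+\<zeta>. indicator (sphere 0 1) \<zeta> * ennreal (pkern \<zeta> z) \<partial>\<mu>) = (\<integral>\<^sup>+\<zeta>. ennreal (indicator (sphere 0 1) \<zeta> * pkern \<zeta> z) \<partial>\<mu>)"
    by (intro nn_integral_cong) (auto simp: indicator_def)
  also have "\<dots> = ennreal (Poisson \<mu> z)"
    unfolding Poisson_eq_pkern using pkern_sphere_nonneg[OF z] pkern_integrable[OF z]
    by (intro nn_integral_eq_integral) auto
  finally show ?thesis by simp
qed

lemma Poisson_radial: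
  assumes x: "cmod x < 1" and s: "0 \<le> s" "s \<le> 1"
  shows "Poisson \<mu> x * (1 - (cmod x)\<^sup>2) \<le> 9 * (Poisson \<mu> (of_real s * x) * (1 - (cmod (of_real s * x))\<^sup>2))"
proof -
  let ?y = "of_real s * x"
  have y: "cmod ?y < 1" using x s by (simp add: norm_mult) (metis mult_le_one mult_left_le_one_le norm_ge_zero order_le_less_trans)
  have "Poisson \<mu> x * (1 - (cmod x)\<^sup>2) = (LINT \<zeta>|\<mu>. indicator (sphere 0 1) \<zeta> * pkern \<zeta> x * (1 - (cmod x)\<^sup>2))"
    by (simp add: Poisson_eq_pkern)
  also have "\<dots> \<le> (LINT \<zeta>|\<mu>. indicator (sphere 0 1) \<zeta> * pkern \<zeta> ?y * (9 * (1 - (cmod ?y)\<^sup>2)))"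
  proof (rule integral_mono)
    show "integrable \<mu> (\<lambda>\<zeta>. indicator (sphere 0 1) \<zeta> * pkern \<zeta> x * (1 - (cmod x)\<^sup>2))"
      by (intro integrable_mult_left pkern_integrable x)
    show "integrable \<mu> (\<lambda>\<zeta>. indicator (sphere 0 1) \<zeta> * pkern \<zeta> ?y * (9 * (1 - (cmod ?y)\<^sup>2)))"
      by (intro integrable_mult_left pkern_integrable y)
    fix \<zeta>
    show "indicator (sphere 0 1) \<zeta> * pkern \<zeta> x * (1 - (cmod x)\<^sup>2) \<le> indicator (sphere 0 1) \<zeta> * pkern \<zeta> ?y * (9 * (1 - (cmod ?y)\<^sup>2))"
      using pkern_radial[OF _ x s, of \<zeta>] by (auto simp: indicator_def algebra_simps)
  qed
  also have "\<dots> = 9 * (Poisson \<mu> ?y * (1 - (cmod ?y)\<^sup>2))"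
    by (simp add: Poisson_eq_pkern)
  finally show ?thesis .
qed

lemma measure_sphere: "measure \<mu> (sphere 0 1) = measure \<mu> (space \<mu>)"
proof -
  have sp: "space \<mu> = UNIV" using sets_eq_imp_space_eq[OF sets_mu] by simp
  have "emeasure \<mu> (space \<mu>) = emeasure \<mu> (sphere 0 1 \<union> (- sphere 0 1))" by (simp add: sp)
  also have "\<dots> = emeasure \<mu> (sphere 0 1)"
    using circle by (intro emeasure_Un_null_set) (auto simp: circle_measure_def null_sets_def)
  finally show ?thesis by (simp add: measure_def)
qed

text \<open>All points of the circle are within distance 2 of \<open>z\<close>. This bounds the
  weight from below through the total mass of \<open>\<mu>\<close> alone.\<close>

lemma Poisson_lower:
  assumes z: "cmod z < 1"
  shows "measure \<mu> (space \<mu>) / 4 * (1 - (cmod z)\<^sup>2) \<le> Poisson \<mu> z"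
proof -
  have "measure \<mu> (space \<mu>) / 4 * (1 - (cmod z)\<^sup>2) = (LINT \<zeta>|\<mu>. indicator (sphere 0 1) \<zeta> * ((1 - (cmod z)\<^sup>2) / 4))"
    by (simp add: measure_sphere)
  also have "\<dots> \<le> Poisson \<mu> z"
    unfolding Poisson_eq_pkern
  proof (rule integral_mono[OF _ pkern_integrable[OF z]])
    show "integrable \<mu> (\<lambda>\<zeta>. indicator (sphere 0 1) \<zeta> * ((1 - (cmod z)\<^sup>2) / 4))"
      by (intro integrable_mult_left integrable_real_indicator) (auto simp: emeasure_eq_measure)
    fix \<zeta>
    show "indicator (sphere 0 1) \<zeta> * ((1 - (cmod z)\<^sup>2) / 4) \<le> indicator (sphere 0 1) \<zeta> * pkern \<zeta> z"
    proof (cases "cmod \<zeta> = 1")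
      case True
      have "cmod (z - \<zeta>) \<le> 2" using norm_triangle_ineq4[of z \<zeta>] True z by simp
      then have "(cmod (z - \<zeta>))\<^sup>2 \<le> 2\<^sup>2" by (intro power_mono) auto
      moreover have "0 < cmod (z - \<zeta>)" using dist_circle_ge[OF True, of z] z by linarith
      ultimately have "(1 - (cmod z)\<^sup>2) / 4 \<le> (1 - (cmod z)\<^sup>2) / (cmod (z - \<zeta>))\<^sup>2"
        using z by (intro divide_left_mono) (auto simp: power_le_one)
      then show ?thesis using True by (simp add: pkern_def)
    qed auto
  qed
  finally show ?thesis .
qed

lemma nn_integral_Poisson_local:
  assumes x: "cmod x < 1" and \<tau>: "\<tau> = 1 - cmod x"
    and A: "A \<in> sets borel" "\<And>v. v \<in> A \<Longrightarrow> cmod v < 1 \<and> cmod (v - x) \<le> 3 * \<tau> \<and> 1 - cmod v \<le> 2 * \<tau>"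
  shows "(\<integral>\<^sup>+v\<in>A. ennreal (Poisson \<mu> v) \<partial>lborel) \<le> ennreal (2880 * pi * \<tau>\<^sup>2) * ennreal (Poisson \<mu> x)"
proof -
  interpret pair_sigma_finite lborel \<mu> ..
  note A(1)[measurable]
  have "(\<integral>\<^sup>+v\<in>A. ennreal (Poisson \<mu> v) \<partial>lborel)
      = (\<integral>\<^sup>+v. \<integral>\<^sup>+\<zeta>. indicator (sphere 0 1) \<zeta> * ennreal (pkern \<zeta> v) * indicator A v \<partial>\<mu> \<partial>lborel)"
  proof (intro nn_integral_cong)
    fix v
    show "ennreal (Poisson \<mu> v) * indicator A v = (\<integral>\<^sup>+\<zeta>. indicator (sphere 0 1) \<zeta> * ennreal (pkern \<zeta> v) * indicator A v \<partial>\<mu>)"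
      using A(2)[of v] by (cases "v \<in> A") (simp_all add: ennreal_Poisson)
  qed
  also have "\<dots> = (\<integral>\<^sup>+\<zeta>. \<integral>\<^sup>+v. indicator (sphere 0 1) \<zeta> * ennreal (pkern \<zeta> v) * indicator A v \<partial>lborel \<partial>\<mu>)"
    by (rule Fubini'[symmetric]) (unfold pkern_def, measurable)
  also have "\<dots> = (\<integral>\<^sup>+\<zeta>. indicator (sphere 0 1) \<zeta> * (\<integral>\<^sup>+v\<in>A. ennreal (pkern \<zeta> v) \<partial>lborel) \<partial>\<mu>)"
    by (intro nn_integral_cong, subst nn_integral_cmult[symmetric]) (auto simp: mult_ac)
  also have "\<dots> \<le> (\<integral>\<^sup>+\<zeta>. ennreal (2880 * pi * \<tau>\<^sup>2) * (indicator (sphere 0 1) \<zeta> * ennreal (pkern \<zeta> x)) \<partial>\<mu>)"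
  proof (intro nn_integral_mono)
    fix \<zeta>
    show "indicator (sphere 0 1) \<zeta> * (\<integral>\<^sup>+v\<in>A. ennreal (pkern \<zeta> v) \<partial>lborel)
        \<le> ennreal (2880 * pi * \<tau>\<^sup>2) * (indicator (sphere 0 1) \<zeta> * ennreal (pkern \<zeta> x))"
      using nn_integral_pkern_local[OF _ x \<tau> A, of \<zeta>] by (auto simp: indicator_def)
  qed
  also have "\<dots> = ennreal (2880 * pi * \<tau>\<^sup>2) * ennreal (Poisson \<mu> x)"
    by (subst nn_integral_cmult) (auto simp: ennreal_Poisson x)
  finally show ?thesis .
qed

text \<open>The local estimate with \<open>x = 0\<close> and \<open>\<tau> = 1\<close>, for which
  the whole disc is an admissible region.\<close>

lemma nn_integral_Poisson_finite: "(\<integral>\<^sup>+v\<in>ball 0 1. ennreal (Poisson \<mu> v) \<partial>lborel) < \<infinity>"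
proof -
  have "(\<integral>\<^sup>+v\<in>ball 0 1. ennreal (Poisson \<mu> v) \<partial>lborel) \<le> ennreal (2880 * pi * 1\<^sup>2) * ennreal (Poisson \<mu> 0)"
  proof (rule nn_integral_Poisson_local)
    fix v :: complex assume "v \<in> ball 0 1"
    moreover have "0 \<le> cmod v" by simp
    ultimately show "cmod v < 1 \<and> cmod (v - 0) \<le> 3 * 1 \<and> 1 - cmod v \<le> 2 * 1"
      unfolding mem_ball_0 diff_zero by linarith
  qed auto
  also have "\<dots> < \<infinity>" by (simp add: ennreal_mult_less_top)
  finally show ?thesis .
qed

end

section \<open>Weighted area integrals\<close>

text \<open>With \<open>a = j - 1\<close> and the \<open>j\<close>-th derivative for
  \<open>F\<close> this is the Dirichlet-type integral without its constant. The exponent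
  \<open>a\<close> is kept apart from the order of differentiation because Hardy's inequality trades
  one derivative for two powers of \<open>1 - |z|^2\<close>.\<close>

definition L2w :: "complex measure \<Rightarrow> nat \<Rightarrow> (complex \<Rightarrow> complex) \<Rightarrow> ennreal" where
  "L2w \<mu> a F = (\<integral>\<^sup>+z\<in>ball 0 1. ennreal ((cmod (F z))\<^sup>2 * Poisson \<mu> z * (1 - (cmod z)\<^sup>2) ^ a) \<partial>lborel)"

lemma L2w_cong: "(\<And>z. cmod z < 1 \<Longrightarrow> F z = G z) \<Longrightarrow> L2w \<mu> a F = L2w \<mu> a G"
  unfolding L2w_def by (intro nn_integral_cong) (auto simp: indicator_def)

lemma measurable_indicator_continuous:
  fixes F :: "complex \<Rightarrow> 'b::{second_countable_topology, real_normed_vector}"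
  assumes "continuous_on (ball 0 1) F"
  shows "(\<lambda>z. indicator (ball 0 1) z *\<^sub>R F z) \<in> borel_measurable borel"
  by (rule borel_measurable_continuous_on_indicator) (use assms in auto)

lemma bounded_on_smaller_disc:
  fixes F :: "complex \<Rightarrow> complex"
  assumes "continuous_on (ball 0 1) F" "r < 1"
  obtains B where "\<And>z. z \<in> cball 0 r \<Longrightarrow> cmod (F z) \<le> B"
proof -
  have "compact (F ` cball 0 r)"
    by (intro compact_continuous_image continuous_on_subset[OF assms(1)]) (use assms(2) in auto)
  then obtain B where "\<forall>w\<in>F ` cball 0 r. cmod w \<le> B"
    using compact_imp_bounded bounded_iff by blast
  then show ?thesis by (intro that[of B]) blast
qed

text \<open>Finiteness makes the subtraction legitimate: for \<open>X = \<infinity>\<close> the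
  first assumption holds with every \<open>A\<close>.\<close>

lemma ennreal_le_half_absorb:
  fixes X A :: ennreal
  assumes "X \<le> A + X / 2" "X < \<infinity>"
  shows "X \<le> 2 * A"
proof (cases "A = \<infinity>")
  case True
  then show ?thesis by (simp add: ennreal_mult_eq_top_iff)
next
  case False
  obtain x where x: "X = ennreal x" "0 \<le> x" using assms(2) by (cases X) auto
  obtain y where y: "A = ennreal y" "0 \<le> y" using False by (cases A) auto
  have "ennreal x \<le> ennreal (y + x / 2)"
    using assms(1) x y by (simp add: ennreal_divide_numeral)
  then have "x \<le> y + x / 2" using x y by (subst (asm) ennreal_le_iff) auto
  then have "ennreal x \<le> ennreal (2 * y)" by (intro ennreal_leI) simp
  then show ?thesis using x y by (simp add: ennreal_mult)
qed

text \<open>The fundamental theorem of calculus for \<open>h^2\<close> on the segment from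
  \<open>z / 2\<close> to \<open>z\<close>. Starting at \<open>z / 2\<close> keeps the first term in
  the disc of radius 1/2, where \<open>h\<close> is bounded, and keeps \<open>s\<close> away from 0
  for the later substitution \<open>y = s z\<close>.\<close>

lemma norm_square_radial_le:
  assumes h: "h holomorphic_on ball 0 1" and z: "cmod z < 1"
  shows "ennreal ((cmod (h z))\<^sup>2) \<le> ennreal ((cmod (h (z / 2)))\<^sup>2) +
    (\<integral>\<^sup>+s\<in>{1/2..1}. ennreal (2 * cmod (h (of_real s * z)) * cmod (deriv h (of_real s * z))) \<partial>lborel)"
proof -
  have sz: "of_real s * z \<in> ball 0 1" if "s \<in> {1/2..1}" for s :: real
  proof -
    have "cmod (of_real s * z) \<le> 1 * cmod z" using that by (simp only: norm_mult norm_of_real) (intro mult_right_mono, auto)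
    then show ?thesis using z by simp
  qed
  have dh: "deriv h holomorphic_on ball 0 1" using h by (intro holomorphic_deriv) auto
  have ch: "continuous_on {1/2..1} (\<lambda>s::real. h (of_real s * z))" 
    by (intro continuous_on_compose2[OF holomorphic_on_imp_continuous_on[OF h]] continuous_intros) (use sz in auto)
  have cd: "continuous_on {1/2..1} (\<lambda>s::real. deriv h (of_real s * z))"
    by (intro continuous_on_compose2[OF holomorphic_on_imp_continuous_on[OF dh]] continuous_intros) (use sz in auto)
  define D where "D s = 2 * h (of_real s * z) * deriv h (of_real s * z) * z" for s :: real
  have "((\<lambda>s::real. (h (of_real s * z))\<^sup>2) has_vector_derivative D s) (at s within {1/2..1})" if s: "s \<in> {1/2..1}" for s
  proof -
    have "(h has_field_derivative deriv h (of_real s * z)) (at (of_real s * z))"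
      using holomorphic_derivI[OF h _ sz[OF s]] by simp
    then have "((\<lambda>u. h (u * z)) has_field_derivative deriv h (of_real s * z) * z) (at (of_real s))"
      by (rule DERIV_chain2[where f = h and g = "\<lambda>u. u * z"]) (auto intro!: derivative_eq_intros)
    then have "((\<lambda>u. (h (u * z))\<^sup>2) has_field_derivative D s) (at (of_real s))"
      unfolding D_def by (auto intro!: derivative_eq_intros)
    from has_vector_derivative_real_field[OF this] show ?thesis by (simp add: o_def)
  qed
  then have "(D has_integral ((h (of_real 1 * z))\<^sup>2 - (h (of_real (1/2) * z))\<^sup>2)) {1/2..1}"
    by (intro fundamental_theorem_of_calculus) auto
  then have I: "(h z)\<^sup>2 - (h (z / 2))\<^sup>2 = integral {1/2..1} D"
    by (simp add: integral_unique)
  have cc: "continuous_on {1/2..1} (\<lambda>s::real. 2 * cmod (h (of_real s * z)) * cmod (deriv h (of_real s * z)))"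
    by (intro continuous_intros ch cd)
  have cD: "continuous_on {1/2..1} D" unfolding D_def by (intro continuous_intros ch cd)
  have "cmod ((h z)\<^sup>2 - (h (z / 2))\<^sup>2) \<le> integral {1/2..1} (\<lambda>s. 2 * cmod (h (of_real s * z)) * cmod (deriv h (of_real s * z)))"
    unfolding I
  proof (rule integral_norm_bound_integral)
    fix s :: real assume "s \<in> {1/2..1}"
    have "cmod (D s) = (2 * cmod (h (of_real s * z)) * cmod (deriv h (of_real s * z))) * cmod z"
      by (simp add: D_def norm_mult)
    also have "\<dots> \<le> 2 * cmod (h (of_real s * z)) * cmod (deriv h (of_real s * z))"
      using z by (intro mult_left_le) auto
    finally show "cmod (D s) \<le> 2 * cmod (h (of_real s * z)) * cmod (deriv h (of_real s * z))" .
  qed (auto intro!: integrable_continuous_real cc cD)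
  moreover have "(cmod (h z))\<^sup>2 \<le> (cmod (h (z / 2)))\<^sup>2 + cmod ((h z)\<^sup>2 - (h (z / 2))\<^sup>2)"
    using norm_triangle_ineq2[of "(h z)\<^sup>2" "(h (z / 2))\<^sup>2"] by (simp add: norm_power)
  ultimately have "ennreal ((cmod (h z))\<^sup>2) \<le> ennreal ((cmod (h (z / 2)))\<^sup>2 + integral {1/2..1} (\<lambda>s. 2 * cmod (h (of_real s * z)) * cmod (deriv h (of_real s * z))))"
    by (intro ennreal_leI) simp
  also have "\<dots> = ennreal ((cmod (h (z / 2)))\<^sup>2) + ennreal (integral {1/2..1} (\<lambda>s. 2 * cmod (h (of_real s * z)) * cmod (deriv h (of_real s * z))))"
    by (intro ennreal_plus integral_nonneg integrable_continuous_real cc) auto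
  also have "ennreal (integral {1/2..1} (\<lambda>s. 2 * cmod (h (of_real s * z)) * cmod (deriv h (of_real s * z))))
      = (\<integral>\<^sup>+s\<in>{1/2..1}. ennreal (2 * cmod (h (of_real s * z)) * cmod (deriv h (of_real s * z))) \<partial>lborel)"
    by (rule nn_integral_continuous_Icc[symmetric, OF cc]) auto
  finally show ?thesis .
qed

context circle_meas
begin

definition wt :: "nat \<Rightarrow> complex \<Rightarrow> real" where
  "wt a z = Poisson \<mu> z * (1 - (cmod z)\<^sup>2) ^ a"

lemma wt_measurable [measurable]: "wt a \<in> borel_measurable borel"
  unfolding wt_def by measurable

lemma wt_nonneg: "cmod z < 1 \<Longrightarrow> 0 \<le> wt a z"
  by (simp add: wt_def Poisson_nonneg power_le_one)

lemma wt_le_Poisson: "cmod z < 1 \<Longrightarrow> wt a z \<le> Poisson \<mu> z"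
  unfolding wt_def by (rule mult_left_le) (auto simp: Poisson_nonneg power_le_one)

lemma wt_Suc: "wt (a + b) z = wt a z * (1 - (cmod z)\<^sup>2) ^ b"
  by (simp add: wt_def power_add)

lemma L2w_wt: "L2w \<mu> a F = (\<integral>\<^sup>+z\<in>ball 0 1. ennreal ((cmod (F z))\<^sup>2 * wt a z) \<partial>lborel)"
  by (simp add: L2w_def wt_def mult.assoc)

lemma L2w_measurable:
  assumes "continuous_on (ball 0 1) F"
  shows "(\<lambda>z. ennreal ((cmod (F z))\<^sup>2 * wt a z) * indicator (ball 0 1) z) \<in> borel_measurable borel"
proof -
  note measurable_indicator_continuous[OF assms, measurable]
  have "(\<lambda>z. ennreal ((cmod (indicator (ball 0 1) z *\<^sub>R F z))\<^sup>2 * wt a z) * indicator (ball 0 1) z) \<in> borel_measurable borel"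
    by measurable
  also have "(\<lambda>z. ennreal ((cmod (indicator (ball 0 1) z *\<^sub>R F z))\<^sup>2 * wt a z) * indicator (ball 0 1) z)
    = (\<lambda>z. ennreal ((cmod (F z))\<^sup>2 * wt a z) * indicator (ball 0 1) z)"
    by (auto simp: fun_eq_iff indicator_def)
  finally show ?thesis .
qed

lemma L2w_antimono:
  assumes "a \<le> b" shows "L2w \<mu> b F \<le> L2w \<mu> a F"
  unfolding L2w_wt
proof (intro nn_integral_mono)
  fix z
  show "ennreal ((cmod (F z))\<^sup>2 * wt b z) * indicator (ball 0 1) z \<le> ennreal ((cmod (F z))\<^sup>2 * wt a z) * indicator (ball 0 1) z"
  proof (cases "cmod z < 1")
    case True
    have "wt b z \<le> wt a z"
      unfolding wt_def using True assms
      by (intro mult_left_mono power_decreasing) (auto simp: Poisson_nonneg power_le_one)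
    then show ?thesis by (intro mult_right_mono ennreal_leI mult_left_mono) auto
  qed auto
qed

lemma L2w_bounded:
  assumes "\<And>z. cmod z < 1 \<Longrightarrow> cmod (F z) \<le> B"
  shows "L2w \<mu> a F \<le> ennreal (B\<^sup>2) * (\<integral>\<^sup>+z\<in>ball 0 1. ennreal (Poisson \<mu> z) \<partial>lborel)"
proof -
  have "L2w \<mu> a F \<le> (\<integral>\<^sup>+z. ennreal (B\<^sup>2) * (ennreal (Poisson \<mu> z) * indicator (ball 0 1) z) \<partial>lborel)"
    unfolding L2w_wt
  proof (intro nn_integral_mono)
    fix z
    show "ennreal ((cmod (F z))\<^sup>2 * wt a z) * indicator (ball 0 1) z \<le> ennreal (B\<^sup>2) * (ennreal (Poisson \<mu> z) * indicator (ball 0 1) z)"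
    proof (cases "cmod z < 1")
      case True
      have "(cmod (F z))\<^sup>2 * wt a z \<le> B\<^sup>2 * Poisson \<mu> z"
        using True by (intro mult_mono power_mono assms wt_le_Poisson wt_nonneg) auto
      then show ?thesis using True by (simp add: ennreal_mult[symmetric] Poisson_nonneg ennreal_leI)
    qed auto
  qed
  also have "\<dots> = ennreal (B\<^sup>2) * (\<integral>\<^sup>+z\<in>ball 0 1. ennreal (Poisson \<mu> z) \<partial>lborel)"
    by (rule nn_integral_cmult) measurable
  finally show ?thesis .
qed

lemma L2w_bounded_finite:
  assumes "\<And>z. cmod z < 1 \<Longrightarrow> cmod (F z) \<le> B"
  shows "L2w \<mu> a F < \<infinity>"
  using L2w_bounded[of F B a, OF assms] nn_integral_Poisson_finite
  by (simp add: ennreal_mult_less_top order_le_less_trans)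

text \<open>For \<open>a = 0\<close> the weight at \<open>z\<close> is not controlled by the weight
  at \<open>r z\<close>, for instance when \<open>\<mu>\<close> is a point mass. Instead
  \<open>|F (r z)|^2\<close> is bounded by an area mean over a disc about \<open>r z\<close>, and
  Tonelli's theorem collects, for each \<open>x\<close>, the points \<open>z\<close> whose disc
  contains \<open>x\<close>; the local Poisson estimate turns their total weight into the weight at
  \<open>x\<close>. The constant does not depend on \<open>r\<close>.\<close>

lemma L2w_dilate:
  assumes F: "F holomorphic_on ball 0 1" and r: "0 \<le> r" "r \<le> 1"
  shows "L2w \<mu> a (\<lambda>z. F (of_real r * z)) \<le> ennreal (25920 * 4 ^ a) * L2w \<mu> a F"
proof -
  \<comment> \<open>Half the distance from \<open>r z\<close> to the unit circle, so the disc about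
    \<open>r z\<close> stays well inside.\<close>
  define \<rho> where "\<rho> z = (1 - r * cmod z) / 2" for z
  have \<rho>m[measurable]: "\<rho> \<in> borel_measurable borel" unfolding \<rho>_def by measurable
  have rz: "r * cmod z \<le> cmod z" "r * cmod z < 1" if "cmod z < 1" for z
    using that r by (auto simp: mult_left_le_one_le intro: order_le_less_trans[OF mult_left_le_one_le])
  define g where "g x = ennreal ((cmod (F x))\<^sup>2) * indicator (ball 0 1) x" for x
  have gm[measurable]: "g \<in> borel_measurable borel"
  proof -
    note measurable_indicator_continuous[OF holomorphic_on_imp_continuous_on[OF F], measurable]
    have "(\<lambda>z. ennreal ((cmod (indicator (ball 0 1) z *\<^sub>R F z))\<^sup>2) * indicator (ball 0 1) z) \<in> borel_measurable borel"
      by measurable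
    also have "(\<lambda>z. ennreal ((cmod (indicator (ball 0 1) z *\<^sub>R F z))\<^sup>2) * indicator (ball 0 1) z) = g"
      by (auto simp: fun_eq_iff indicator_def g_def)
    finally show ?thesis .
  qed
  define S where "S = {p :: complex \<times> complex. cmod (snd p) < 1 \<and> cmod (fst p - of_real r * snd p) < \<rho> (snd p)}"
  have Sm[measurable]: "S \<in> sets (borel \<Otimes>\<^sub>M borel)"
  proof -
    have "Measurable.pred (borel \<Otimes>\<^sub>M borel) (\<lambda>p :: complex \<times> complex. cmod (snd p) < 1 \<and> cmod (fst p - of_real r * snd p) < \<rho> (snd p))"
      by measurable
    then show ?thesis unfolding S_def pred_def by (simp add: space_pair_measure)
  qed
  define k where "k z = wt a z / (pi * (\<rho> z)\<^sup>2)" for z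
  have km[measurable]: "k \<in> borel_measurable borel" unfolding k_def by measurable
  have "L2w \<mu> a (\<lambda>z. F (of_real r * z)) \<le> (\<integral>\<^sup>+z. \<integral>\<^sup>+x. g x * (ennreal (k z) * indicator S (x, z)) \<partial>lborel \<partial>lborel)"
    unfolding L2w_wt
  proof (intro nn_integral_mono)
    fix z
    show "ennreal ((cmod (F (of_real r * z)))\<^sup>2 * wt a z) * indicator (ball 0 1) z \<le> (\<integral>\<^sup>+x. g x * (ennreal (k z) * indicator S (x, z)) \<partial>lborel)"
    proof (cases "cmod z < 1")
      case z: True
      have \<rho>0: "\<rho> z > 0" using rz[OF z] by (simp add: \<rho>_def)
      have sub: "ball (of_real r * z) (\<rho> z) \<subseteq> ball 0 1"
      proof
        fix x assume "x \<in> ball (of_real r * z) (\<rho> z)"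
        then have "cmod (x - of_real r * z) < \<rho> z" by (simp add: dist_norm norm_minus_commute)
        moreover have "cmod x \<le> cmod (of_real r * z) + cmod (x - of_real r * z)" by (rule norm_triangle_sub)
        ultimately have "cmod x < 1" using r rz(2)[OF z] by (simp add: \<rho>_def norm_mult field_simps)
        then show "x \<in> ball 0 1" by simp
      qed
      have c: "ennreal (k z) * ennreal (pi * (\<rho> z)\<^sup>2) = ennreal (wt a z)"
        using \<rho>0 wt_nonneg[OF z, of a] by (subst ennreal_mult[symmetric]) (auto simp: k_def)
      have "ennreal ((cmod (F (of_real r * z)))\<^sup>2 * wt a z) = ennreal (k z) * (ennreal (pi * (\<rho> z)\<^sup>2) * ennreal ((cmod (F (of_real r * z)))\<^sup>2))"
        unfolding mult.assoc[symmetric] c using wt_nonneg[OF z, of a] by (simp add: ennreal_mult mult.commute)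
      also have "\<dots> \<le> ennreal (k z) * (\<integral>\<^sup>+x\<in>ball (of_real r * z) (\<rho> z). ennreal ((cmod (F x))\<^sup>2) \<partial>lborel)"
        by (intro mult_left_mono holomorphic_area_mean_le \<rho>0 holomorphic_on_subset[OF F sub]) simp
      also have "\<dots> = ennreal (k z) * (\<integral>\<^sup>+x. g x * indicator S (x, z) \<partial>lborel)"
      proof (rule arg_cong[where f="\<lambda>I. ennreal (k z) * I"], rule nn_integral_cong)
        fix x
        show "ennreal ((cmod (F x))\<^sup>2) * indicator (ball (of_real r * z) (\<rho> z)) x = g x * indicator S (x, z)"
        proof (cases "x \<in> ball (of_real r * z) (\<rho> z)")
          case True
          moreover from this sub have "x \<in> ball 0 1" by blast
          ultimately show ?thesis using z by (simp add: g_def S_def dist_norm norm_minus_commute)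
        qed (use z in \<open>simp add: S_def dist_norm norm_minus_commute\<close>)
      qed
      also have "\<dots> = (\<integral>\<^sup>+x. ennreal (k z) * (g x * indicator S (x, z)) \<partial>lborel)"
        by (rule nn_integral_cmult[symmetric]) measurable
      finally show ?thesis using z by (simp add: mult_ac)
    qed simp
  qed
  also have "\<dots> = (\<integral>\<^sup>+x. \<integral>\<^sup>+z. g x * (ennreal (k z) * indicator S (x, z)) \<partial>lborel \<partial>lborel)"
    by (rule lborel_pair.Fubini') measurable
  also have "\<dots> \<le> (\<integral>\<^sup>+x. ennreal (25920 * 4 ^ a) * (ennreal ((cmod (F x))\<^sup>2 * wt a x) * indicator (ball 0 1) x) \<partial>lborel)"
  proof (intro nn_integral_mono)
    fix x
    show "(\<integral>\<^sup>+z. g x * (ennreal (k z) * indicator S (x, z)) \<partial>lborel) \<le> ennreal (25920 * 4 ^ a) * (ennreal ((cmod (F x))\<^sup>2 * wt a x) * indicator (ball 0 1) x)"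
    proof (cases "cmod x < 1")
      case x: True
      define \<tau> where "\<tau> = 1 - cmod x"
      have \<tau>0: "\<tau> > 0" using x by (simp add: \<tau>_def)
      define A where "A = {z. (x, z) \<in> S}"
      have Am[measurable]: "A \<in> sets borel" unfolding A_def by measurable
      \<comment> \<open>Since \<open>x\<close> lies in the disc about \<open>r v\<close> of radius
        half its distance to the circle, \<open>\<tau> / 3 \<le> \<rho> v \<le> \<tau>\<close>. The
        distance from \<open>v\<close> to \<open>x\<close> is at most \<open>(1 - r) |v|\<close>
        plus this radius, that is, \<open>2 \<tau> + \<tau>\<close>.\<close>
      have A: "cmod v < 1 \<and> cmod (v - x) \<le> 3 * \<tau> \<and> 1 - cmod v \<le> 2 * \<tau> \<and> \<tau> / 3 \<le> \<rho> v" if "v \<in> A" for v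
      proof -
        have v: "cmod v < 1" "cmod (x - of_real r * v) < \<rho> v" using that by (auto simp: A_def S_def)
        have cr: "cmod (of_real r * v) = r * cmod v" using r by (simp add: norm_mult)
        have "cmod x \<le> r * cmod v + cmod (x - of_real r * v)"
          using norm_triangle_sub[of x "of_real r * v"] cr by simp
        then have 1: "1 - r * cmod v \<le> 2 * \<tau>" using v by (simp add: \<tau>_def \<rho>_def)
        have "r * cmod v \<le> cmod x + cmod (x - of_real r * v)"
          using norm_triangle_sub[of "of_real r * v" x] cr by (simp add: norm_minus_commute)
        then have 2: "\<tau> / 3 \<le> \<rho> v" using v by (simp add: \<tau>_def \<rho>_def)
        have "v - of_real r * v = of_real (1 - r) * v" by (simp add: algebra_simps)
        then have "cmod (v - of_real r * v) = (1 - r) * cmod v" using r by (simp only: norm_mult norm_of_real abs_of_nonneg diff_ge_0_iff_ge)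
        also have "\<dots> \<le> 1 - r * cmod v" using v by (simp add: algebra_simps)
        finally have 3: "cmod (v - of_real r * v) \<le> 2 * \<tau>" using 1 by simp
        have "cmod (v - x) \<le> cmod (v - of_real r * v) + cmod (of_real r * v - x)"
          by (rule order_trans[OF _ norm_triangle_ineq]) simp
        then have "cmod (v - x) \<le> 3 * \<tau>" using 1 3 v(2) by (simp add: \<rho>_def norm_minus_commute)
        then show ?thesis using v 1 2 rz(1)[OF v(1)] by simp
      qed
      \<comment> \<open>The 9 comes from \<open>\<rho> z \<ge> \<tau> / 3\<close> and the
        \<open>4 ^ a\<close> from \<open>1 - |z|^2 \<le> 4 (1 - |x|^2)\<close>;
        \<open>9 * 2880 = 25920\<close>.\<close>
      define K where "K = 9 * 4 ^ a * (1 - (cmod x)\<^sup>2) ^ a / (pi * \<tau>\<^sup>2)"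
      have K0: "0 \<le> K" using x by (simp add: K_def power_le_one)
      have kz: "ennreal (k z) * indicator S (x, z) \<le> ennreal K * (ennreal (Poisson \<mu> z) * indicator A z)" for z
      proof (cases "z \<in> A")
        case True
        note z = A[OF True]
        have "1 - (cmod z)\<^sup>2 \<le> 4 * (1 - (cmod x)\<^sup>2)"
          using one_minus_norm_sq_bounds(2)[of z] one_minus_norm_sq_bounds(1)[of x] z x by (simp add: \<tau>_def)
        then have "(1 - (cmod z)\<^sup>2) ^ a \<le> (4 * (1 - (cmod x)\<^sup>2)) ^ a"
          using z by (intro power_mono) (auto simp: power_le_one)
        then have "(1 - (cmod z)\<^sup>2) ^ a \<le> 4 ^ a * (1 - (cmod x)\<^sup>2) ^ a"
          unfolding power_mult_distrib .
        then have "wt a z \<le> Poisson \<mu> z * (4 ^ a * (1 - (cmod x)\<^sup>2) ^ a)"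
          unfolding wt_def using z by (intro mult_left_mono) (auto simp: Poisson_nonneg)
        moreover have "pi * (\<tau>\<^sup>2 / 9) \<le> pi * (\<rho> z)\<^sup>2"
          using power_mono[of "\<tau> / 3" "\<rho> z" 2] z \<tau>0 by (auto simp: power_divide)
        ultimately have "k z \<le> Poisson \<mu> z * (4 ^ a * (1 - (cmod x)\<^sup>2) ^ a) / (pi * (\<tau>\<^sup>2 / 9))"
          unfolding k_def using z \<tau>0 x by (intro frac_le) (auto simp: Poisson_nonneg power_le_one)
        also have "\<dots> = K * Poisson \<mu> z" by (simp add: K_def)
        finally have "ennreal (k z) \<le> ennreal K * ennreal (Poisson \<mu> z)"
          using K0 z by (simp add: ennreal_mult[symmetric] Poisson_nonneg ennreal_leI)
        then show ?thesis using True by (auto simp: A_def)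
      qed (auto simp: A_def)
      have "(\<integral>\<^sup>+z. ennreal (k z) * indicator S (x, z) \<partial>lborel) \<le> (\<integral>\<^sup>+z. ennreal K * (ennreal (Poisson \<mu> z) * indicator A z) \<partial>lborel)"
        by (intro nn_integral_mono kz)
      also have "\<dots> = ennreal K * (\<integral>\<^sup>+z\<in>A. ennreal (Poisson \<mu> z) \<partial>lborel)"
        by (rule nn_integral_cmult) measurable
      also have "\<dots> \<le> ennreal K * (ennreal (2880 * pi * \<tau>\<^sup>2) * ennreal (Poisson \<mu> x))"
        by (intro mult_left_mono nn_integral_Poisson_local x \<tau>_def Am) (use A in auto)
      also have "\<dots> = ennreal (25920 * 4 ^ a * wt a x)"
        using K0 \<tau>0 x by (simp add: ennreal_mult[symmetric] Poisson_nonneg K_def wt_def mult_ac)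
      finally have I: "(\<integral>\<^sup>+z. ennreal (k z) * indicator S (x, z) \<partial>lborel) \<le> ennreal (25920 * 4 ^ a * wt a x)" .
      have "(\<integral>\<^sup>+z. g x * (ennreal (k z) * indicator S (x, z)) \<partial>lborel) = g x * (\<integral>\<^sup>+z. ennreal (k z) * indicator S (x, z) \<partial>lborel)"
        by (rule nn_integral_cmult) measurable
      also have "\<dots> \<le> g x * ennreal (25920 * 4 ^ a * wt a x)"
        by (intro mult_left_mono I) simp
      also have "\<dots> = ennreal (25920 * 4 ^ a) * (ennreal ((cmod (F x))\<^sup>2 * wt a x) * indicator (ball 0 1) x)"
        using x by (simp add: g_def ennreal_mult[symmetric] wt_nonneg mult_ac)
      finally show ?thesis .
    qed (simp add: g_def)
  qed
  also have "\<dots> = ennreal (25920 * 4 ^ a) * L2w \<mu> a F"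
    unfolding L2w_wt using L2w_measurable[OF holomorphic_on_imp_continuous_on[OF F]] by (intro nn_integral_cmult) simp
  finally show ?thesis .
qed

text \<open>One factor \<open>1 - |x|^2\<close> is spent on the radial bound for the Poisson
  integral; the remaining \<open>a - 1\<close> factors decrease along radii by themselves.\<close>

lemma wt_radial:
  assumes x: "cmod x < 1" and s: "0 \<le> s" "s \<le> 1" and a: "1 \<le> a"
  shows "wt a x \<le> 9 * wt a (of_real s * x)"
proof -
  let ?y = "of_real s * x"
  have yx: "cmod ?y \<le> cmod x" using s by (simp add: norm_mult mult_left_le_one_le)
  obtain b where b: "a = Suc b" using a by (cases a) auto
  have "wt a x = (Poisson \<mu> x * (1 - (cmod x)\<^sup>2)) * (1 - (cmod x)\<^sup>2) ^ b"
    by (simp add: wt_def b)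
  also have "\<dots> \<le> (9 * (Poisson \<mu> ?y * (1 - (cmod ?y)\<^sup>2))) * (1 - (cmod ?y)\<^sup>2) ^ b"
  proof (rule mult_mono)
    have "1 - (cmod x)\<^sup>2 \<le> 1 - (cmod ?y)\<^sup>2" using power_mono[OF yx, of 2] by simp
    then show "(1 - (cmod x)\<^sup>2) ^ b \<le> (1 - (cmod ?y)\<^sup>2) ^ b"
      using x by (intro power_mono) (auto simp: power_le_one)
    show "0 \<le> 9 * (Poisson \<mu> ?y * (1 - (cmod ?y)\<^sup>2))" "0 \<le> (1 - (cmod x)\<^sup>2) ^ b"
      using x yx by (auto intro!: mult_nonneg_nonneg Poisson_nonneg simp: power_le_one)
  qed (rule Poisson_radial[OF x s])
  also have "\<dots> = 9 * wt a ?y" by (simp add: wt_def b)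
  finally show ?thesis .
qed

text \<open>A Hardy inequality: for exponents \<open>a \<ge> 1\<close> the weight essentially decreases along radii, uniformly in
  the point masses of \<open>\<mu>\<close>.\<close>

lemma L2w_hardy:
  assumes h: "h holomorphic_on ball 0 1" and a: "1 \<le> a" and fin: "L2w \<mu> (a + 2) (deriv h) < \<infinity>"
  shows "L2w \<mu> a h < \<infinity>"
proof -
  have dh: "deriv h holomorphic_on ball 0 1" using h by (intro holomorphic_deriv) auto
  note hc = holomorphic_on_imp_continuous_on[OF h]
  note dhc = holomorphic_on_imp_continuous_on[OF dh]
  define f where "f z = ennreal ((cmod (h z))\<^sup>2 * wt a z) * indicator (ball 0 1) z" for z
  have fm[measurable]: "f \<in> borel_measurable borel" using L2w_measurable[OF hc, of a] unfolding f_def .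
  define K where "K = (\<integral>\<^sup>+z. ennreal ((cmod (h (z / 2)))\<^sup>2 * wt a z) * indicator (ball 0 1) z \<partial>lborel)"
  have hhalf: "continuous_on (ball 0 1) (\<lambda>z. h (z / 2))"
    by (rule continuous_on_compose2[OF hc]) (auto intro!: continuous_intros)
  obtain B where B: "\<And>z. z \<in> cball 0 (1/2) \<Longrightarrow> cmod (h z) \<le> B"
    using bounded_on_smaller_disc[OF hc, of "1/2"] by force
  have K: "K < \<infinity>"
    using L2w_bounded_finite[of "\<lambda>z. h (z / 2)" B a] B by (auto simp: K_def L2w_wt)
  define B2 where "B2 = 2 * (K + 2592 * L2w \<mu> (a + 2) (deriv h))"
  have B2: "B2 < \<infinity>" using K fin by (simp add: B2_def ennreal_mult_less_top)
  \<comment> \<open>In the 18, the 2 comes from the derivative of \<open>h^2\<close> and the 9 from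
    moving the weight from \<open>z\<close> to \<open>s z\<close>.\<close>
  define G where "G y = ennreal (18 * cmod (h y) * cmod (deriv h y) * wt a y) * indicator (ball 0 1) y" for y
  have Gm[measurable]: "G \<in> borel_measurable borel"
  proof -
    note measurable_indicator_continuous[OF hc, measurable] measurable_indicator_continuous[OF dhc, measurable]
    have "(\<lambda>y. ennreal (18 * cmod (indicator (ball 0 1) y *\<^sub>R h y) * cmod (indicator (ball 0 1) y *\<^sub>R deriv h y) * wt a y) * indicator (ball 0 1) y) \<in> borel_measurable borel"
      by measurable
    also have "(\<lambda>y. ennreal (18 * cmod (indicator (ball 0 1) y *\<^sub>R h y) * cmod (indicator (ball 0 1) y *\<^sub>R deriv h y) * wt a y) * indicator (ball 0 1) y) = G"
      by (auto simp: fun_eq_iff G_def indicator_def)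
    finally show ?thesis .
  qed
  \<comment> \<open>On a smaller disc the integral is finite, so half of it can be absorbed; the
    bound \<open>B2\<close> does not depend on \<open>R\<close>.\<close>
  have XR: "(\<integral>\<^sup>+z. f z * indicator (ball 0 R) z \<partial>lborel) \<le> B2" if R: "0 < R" "R < 1" for R
  proof -
    define X where "X = (\<integral>\<^sup>+z. f z * indicator (ball 0 R) z \<partial>lborel)"
    have "X < \<infinity>"
    proof -
      obtain C where C: "\<And>z. z \<in> cball 0 R \<Longrightarrow> cmod (h z) \<le> C"
        using bounded_on_smaller_disc[OF hc R(2)] by blast
      have "X \<le> L2w \<mu> a (\<lambda>z. indicator (ball 0 R) z * h z)"
        unfolding X_def L2w_wt f_def by (intro nn_integral_mono) (auto simp: indicator_def)
      also have "\<dots> < \<infinity>"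
        using C order_trans[OF norm_ge_zero C[of 0]] R by (intro L2w_bounded_finite[where B = C]) (auto simp: indicator_def)
      finally show ?thesis .
    qed
    have pw: "f z * indicator (ball 0 R) z \<le> ennreal ((cmod (h (z / 2)))\<^sup>2 * wt a z) * indicator (ball 0 1) z
        + (\<integral>\<^sup>+s. G (of_real s * z) * indicator (ball 0 R) z * indicator {1/2..1} s \<partial>lborel)" for z
    proof (cases "cmod z < R")
      case True
      then have z: "cmod z < 1" using R by simp
      have sz: "of_real s * z \<in> ball 0 1" if "s \<in> {1/2..1}" for s :: real
      proof -
        have "cmod (of_real s * z) \<le> 1 * cmod z" using that by (simp only: norm_mult norm_of_real) (intro mult_right_mono, auto)
        then show ?thesis using z by simp
      qed
      have cc: "continuous_on {1/2..1} (\<lambda>s::real. 2 * cmod (h (of_real s * z)) * cmod (deriv h (of_real s * z)))"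
        by (intro continuous_intros continuous_on_compose2[OF hc] continuous_on_compose2[OF dhc]) (use sz in auto)
      have mm: "(\<lambda>s::real. ennreal (2 * cmod (h (of_real s * z)) * cmod (deriv h (of_real s * z))) * indicator {1/2..1} s) \<in> borel_measurable borel"
      proof -
        have "(\<lambda>s. ennreal (indicator {1/2..1} s *\<^sub>R (2 * cmod (h (of_real s * z)) * cmod (deriv h (of_real s * z))))) \<in> borel_measurable borel"
          by (intro measurable_compose[OF borel_measurable_continuous_on_indicator measurable_ennreal] cc) simp
        also have "(\<lambda>s. ennreal (indicator {1/2..1} s *\<^sub>R (2 * cmod (h (of_real s * z)) * cmod (deriv h (of_real s * z)))))
            = (\<lambda>s::real. ennreal (2 * cmod (h (of_real s * z)) * cmod (deriv h (of_real s * z))) * indicator {1/2..1} s)"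
          by (auto simp: fun_eq_iff indicator_def)
        finally show ?thesis .
      qed
      have "ennreal (wt a z) * ennreal ((cmod (h z))\<^sup>2) \<le> ennreal (wt a z) * (ennreal ((cmod (h (z / 2)))\<^sup>2) +
         (\<integral>\<^sup>+s\<in>{1/2..1}. ennreal (2 * cmod (h (of_real s * z)) * cmod (deriv h (of_real s * z))) \<partial>lborel))"
        by (intro mult_left_mono norm_square_radial_le h z) simp
      also have "\<dots> = ennreal (wt a z) * ennreal ((cmod (h (z / 2)))\<^sup>2) +
         (\<integral>\<^sup>+s. ennreal (wt a z) * (ennreal (2 * cmod (h (of_real s * z)) * cmod (deriv h (of_real s * z))) * indicator {1/2..1} s) \<partial>lborel)"
        unfolding distrib_left by (subst nn_integral_cmult) (use mm in auto)
      also have "\<dots> \<le> ennreal (wt a z) * ennreal ((cmod (h (z / 2)))\<^sup>2) +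
         (\<integral>\<^sup>+s. G (of_real s * z) * indicator {1/2..1} s \<partial>lborel)"
      proof (intro add_left_mono nn_integral_mono)
        fix s :: real
        show "ennreal (wt a z) * (ennreal (2 * cmod (h (of_real s * z)) * cmod (deriv h (of_real s * z))) * indicator {1/2..1} s)
          \<le> G (of_real s * z) * indicator {1/2..1} s"
        proof (cases "s \<in> {1/2..1}")
          case True
          have "wt a z * (2 * cmod (h (of_real s * z)) * cmod (deriv h (of_real s * z)))
            \<le> (9 * wt a (of_real s * z)) * (2 * cmod (h (of_real s * z)) * cmod (deriv h (of_real s * z)))"
            using True by (intro mult_right_mono wt_radial z a) auto
          then show ?thesis using True sz[OF True] wt_nonneg[OF z, of a]
            by (simp add: G_def ennreal_mult[symmetric] ennreal_leI mult_ac)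
        qed simp
      qed
      finally show ?thesis using True z wt_nonneg[OF z, of a] by (simp add: f_def ennreal_mult mult.commute)
    qed simp
    have "X \<le> (\<integral>\<^sup>+z. ennreal ((cmod (h (z / 2)))\<^sup>2 * wt a z) * indicator (ball 0 1) z
        + (\<integral>\<^sup>+s. G (of_real s * z) * indicator (ball 0 R) z * indicator {1/2..1} s \<partial>lborel) \<partial>lborel)"
      unfolding X_def by (intro nn_integral_mono pw)
    also have "\<dots> = K + (\<integral>\<^sup>+z. \<integral>\<^sup>+s. G (of_real s * z) * indicator (ball 0 R) z * indicator {1/2..1} s \<partial>lborel \<partial>lborel)"
      unfolding K_def
    proof (rule nn_integral_add)
      show "(\<lambda>z. ennreal ((cmod (h (z / 2)))\<^sup>2 * wt a z) * indicator (ball 0 1) z) \<in> borel_measurable lborel"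
        using L2w_measurable[OF hhalf, of a] by simp
    qed measurable
    finally have XK: "X \<le> K + (\<integral>\<^sup>+z. \<integral>\<^sup>+s. G (of_real s * z) * indicator (ball 0 R) z * indicator {1/2..1} s \<partial>lborel \<partial>lborel)" .
    have "(\<integral>\<^sup>+z. \<integral>\<^sup>+s. G (of_real s * z) * indicator (ball 0 R) z * indicator {1/2..1} s \<partial>lborel \<partial>lborel)
       = (\<integral>\<^sup>+s. \<integral>\<^sup>+z. G (of_real s * z) * indicator (ball 0 R) z * indicator {1/2..1} s \<partial>lborel \<partial>lborel)"
      by (rule lborel_pair.Fubini') measurable
    \<comment> \<open>Substitution \<open>y = s z\<close>: the Jacobian \<open>1 / s^2\<close> is at
      most 4 as \<open>s \<ge> 1/2\<close>, and \<open>|z| < 1\<close> forces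
      \<open>|y| \<le> s\<close>. For fixed \<open>y\<close> the parameter \<open>s\<close> then
      ranges over a length of at most \<open>1 - |y|\<close>, the gain on which the inequality
      rests.\<close>
    also have "\<dots> \<le> (\<integral>\<^sup>+s. \<integral>\<^sup>+y. 4 * (G y * indicator (ball 0 R) y) * (indicator {1/2..1} s * indicator {cmod y..} s) \<partial>lborel \<partial>lborel)"
    proof (rule nn_integral_mono)
      fix s :: real
      show "(\<integral>\<^sup>+z. G (of_real s * z) * indicator (ball 0 R) z * indicator {1/2..1} s \<partial>lborel)
         \<le> (\<integral>\<^sup>+y. 4 * (G y * indicator (ball 0 R) y) * (indicator {1/2..1} s * indicator {cmod y..} s) \<partial>lborel)"
      proof (cases "s \<in> {1/2..1}")
        case s: True
        define H where "H y = G y * indicator (ball 0 R) y * indicator {cmod y..} s" for y :: complex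
        have Hm[measurable]: "H \<in> borel_measurable borel"
        proof -
          have "(\<lambda>y. G y * indicator (ball 0 R) y * indicator {y. cmod y \<le> s} y) \<in> borel_measurable borel"
            by measurable
          also have "(\<lambda>y. G y * indicator (ball 0 R) y * indicator {y. cmod y \<le> s} y) = H"
            by (auto simp: fun_eq_iff H_def indicator_def)
          finally show ?thesis .
        qed
        have "(\<integral>\<^sup>+z. G (of_real s * z) * indicator (ball 0 R) z * indicator {1/2..1} s \<partial>lborel) \<le> (\<integral>\<^sup>+z. H (of_real s * z) \<partial>lborel)"
        proof (intro nn_integral_mono)
          fix z
          show "G (of_real s * z) * indicator (ball 0 R) z * indicator {1/2..1} s \<le> H (of_real s * z)"
          proof (cases "cmod z < R")
            case True
            have "s * cmod z \<le> s * 1" "s * cmod z \<le> 1 * cmod z"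
              by (rule mult_left_mono, use s True R in simp, use s in simp)
                 (rule mult_right_mono, use s in auto)
            then show ?thesis using s True by (simp add: H_def norm_mult)
          qed simp
        qed
        also have "\<dots> \<le> 4 * (ennreal (s\<^sup>2) * (\<integral>\<^sup>+z. H (of_real s * z) \<partial>lborel))"
        proof -
          have "(1/2)\<^sup>2 \<le> s\<^sup>2" using s by (intro power_mono) auto
          then have "ennreal 1 \<le> ennreal (4 * s\<^sup>2)" by (intro ennreal_leI) (simp add: power_divide)
          then have "1 * (\<integral>\<^sup>+z. H (of_real s * z) \<partial>lborel) \<le> (4 * ennreal (s\<^sup>2)) * (\<integral>\<^sup>+z. H (of_real s * z) \<partial>lborel)"
            by (intro mult_right_mono) (simp_all add: ennreal_mult)
          then show ?thesis by (simp add: mult.assoc)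
        qed
        also have "\<dots> = 4 * (\<integral>\<^sup>+y. H y \<partial>lborel)"
          using s by (subst nn_integral_dilate[of H s]) auto
        also have "\<dots> = (\<integral>\<^sup>+y. 4 * H y \<partial>lborel)" by (rule nn_integral_cmult[symmetric]) measurable
        also have "\<dots> = (\<integral>\<^sup>+y. 4 * (G y * indicator (ball 0 R) y) * (indicator {1/2..1} s * indicator {cmod y..} s) \<partial>lborel)"
          using s by (intro nn_integral_cong) (simp add: H_def mult_ac)
        finally show ?thesis .
      qed simp
    qed
    also have "\<dots> = (\<integral>\<^sup>+y. \<integral>\<^sup>+s. 4 * (G y * indicator (ball 0 R) y) * (indicator {1/2..1} s * indicator {cmod y..} s) \<partial>lborel \<partial>lborel)"
    proof (rule lborel_pair.Fubini')
      have "(\<lambda>p :: complex \<times> real. 4 * (G (fst p) * indicator (ball 0 R) (fst p)) * (indicator {1/2..1} (snd p) * indicator {p. cmod (fst p) \<le> snd p} p))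
        \<in> borel_measurable (lborel \<Otimes>\<^sub>M lborel)" by measurable
      then show "(\<lambda>(y, s). 4 * (G y * indicator (ball 0 R) y) * (indicator {1/2..1} s * indicator {cmod y..} s)) \<in> borel_measurable (lborel \<Otimes>\<^sub>M lborel)"
        by (simp add: case_prod_beta indicator_def)
    qed
    also have "\<dots> \<le> (\<integral>\<^sup>+y. (f y * indicator (ball 0 R) y) / 2 + 2592 * (ennreal ((cmod (deriv h y))\<^sup>2 * wt (a + 2) y) * indicator (ball 0 1) y) \<partial>lborel)"
    proof (rule nn_integral_mono)
      fix y
      show "(\<integral>\<^sup>+s. 4 * (G y * indicator (ball 0 R) y) * (indicator {1/2..1} s * indicator {cmod y..} s) \<partial>lborel)
        \<le> (f y * indicator (ball 0 R) y) / 2 + 2592 * (ennreal ((cmod (deriv h y))\<^sup>2 * wt (a + 2) y) * indicator (ball 0 1) y)"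
      proof (cases "cmod y < R")
        case True
        then have y: "cmod y < 1" using R by simp
        define A C t where "A = cmod (h y)" and "C = cmod (deriv h y)" and "t = 1 - (cmod y)\<^sup>2"
        have t: "0 \<le> t" using y by (simp add: t_def power_le_one)
        have w: "0 \<le> wt a y" using y by (rule wt_nonneg)
        have "(\<integral>\<^sup>+s. 4 * (G y * indicator (ball 0 R) y) * (indicator {1/2..1} s * indicator {cmod y..} s) \<partial>lborel)
          \<le> (\<integral>\<^sup>+s. 4 * G y * indicator {cmod y..1} s \<partial>lborel)"
          using True by (intro nn_integral_mono) (auto simp: indicator_def)
        also have "\<dots> = 4 * G y * ennreal (1 - cmod y)"
          using y by (subst nn_integral_cmult_indicator) auto
        also have "\<dots> \<le> 4 * G y * ennreal t"
          using one_minus_norm_sq_bounds(1)[of y] y by (intro mult_left_mono ennreal_leI) (auto simp: t_def)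
        also have "\<dots> = ennreal (72 * A * (C * t) * wt a y)"
        proof -
          have "4 * G y = ennreal (4 * (18 * A * C * wt a y))"
            using y w by (subst ennreal_mult) (auto simp: G_def A_def C_def)
          then show ?thesis using t w by (simp add: ennreal_mult[symmetric] A_def C_def mult_ac)
        qed
        \<comment> \<open>\<open>72 = 4 * 18\<close> and \<open>2592 = 72^2 / 2\<close>: the product
          is split so that the \<open>h\<close>-term receives the coefficient 1/2 needed for
          absorption.\<close>
        also have "\<dots> \<le> ennreal ((A\<^sup>2 / 2 + 2592 * (C * t)\<^sup>2) * wt a y)"
        proof (intro ennreal_leI mult_right_mono w)
          have "0 \<le> (A - 72 * (C * t))\<^sup>2" by simp
          then show "72 * A * (C * t) \<le> A\<^sup>2 / 2 + 2592 * (C * t)\<^sup>2"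
            by (simp add: power2_diff)
        qed
        also have "\<dots> = ennreal (A\<^sup>2 * wt a y / 2 + 2592 * (C\<^sup>2 * wt (a + 2) y))"
          unfolding wt_Suc t_def[symmetric] by (simp add: algebra_simps power_mult_distrib)
        also have "\<dots> = ennreal (A\<^sup>2 * wt a y) / 2 + 2592 * ennreal (C\<^sup>2 * wt (a + 2) y)"
        proof -
          have w2: "0 \<le> wt (a + 2) y" using y by (rule wt_nonneg)
          have "ennreal (A\<^sup>2 * wt a y) / 2 = ennreal (A\<^sup>2 * wt a y / 2)"
            using divide_ennreal[of "A\<^sup>2 * wt a y" 2] w by simp
          moreover have "2592 * ennreal (C\<^sup>2 * wt (a + 2) y) = ennreal (2592 * (C\<^sup>2 * wt (a + 2) y))"
            using w2 by (subst ennreal_mult) auto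
          ultimately show ?thesis using w w2 by (simp del: add_2_eq_Suc')
        qed
        finally show ?thesis using True y by (simp add: f_def A_def C_def)
      qed simp
    qed
    also have "\<dots> = X / 2 + 2592 * L2w \<mu> (a + 2) (deriv h)"
    proof -
      note L2w_measurable[OF dhc, of "a + 2", measurable]
      show ?thesis unfolding X_def L2w_wt
        by (subst nn_integral_add) (simp_all add: nn_integral_divide nn_integral_cmult del: add_2_eq_Suc')
    qed
    finally have "X \<le> K + (X / 2 + 2592 * L2w \<mu> (a + 2) (deriv h))"
      by (rule order_trans[OF XK add_left_mono])
    then have "X \<le> (K + 2592 * L2w \<mu> (a + 2) (deriv h)) + X / 2" by (simp add: add_ac)
    from ennreal_le_half_absorb[OF this \<open>X < \<infinity>\<close>] show ?thesis by (simp add: X_def B2_def)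
  qed
  \<comment> \<open>Monotone convergence along discs exhausting the unit disc removes the
    truncation.\<close>
  have "L2w \<mu> a h = (\<integral>\<^sup>+z. f z * indicator (\<Union>n. ball 0 (1 - 1 / real (n + 2))) z \<partial>lborel)"
    unfolding L2w_wt
  proof (intro nn_integral_cong)
    fix z
    have "\<exists>n. cmod z < 1 - 1 / real (n + 2)" if "cmod z < 1"
    proof -
      obtain n where n: "1 / (1 - cmod z) < real n" using reals_Archimedean2 by blast
      then have "1 < real n * (1 - cmod z)" using that by (simp add: field_simps)
      also have "\<dots> \<le> real (n + 2) * (1 - cmod z)" using that by (intro mult_right_mono) auto
      finally have "cmod z < 1 - 1 / real (n + 2)" by (simp add: field_simps)
      then show ?thesis ..
    qed
    then show "ennreal ((cmod (h z))\<^sup>2 * wt a z) * indicator (ball 0 1) z = f z * indicator (\<Union>n. ball 0 (1 - 1 / real (n + 2))) z"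
      by (cases "cmod z < 1") (auto simp: f_def)
  qed
  also have "\<dots> = (SUP n. \<integral>\<^sup>+z. f z * indicator (ball 0 (1 - 1 / real (n + 2))) z \<partial>lborel)"
  proof -
    have inc: "incseq (\<lambda>n. ball (0::complex) (1 - 1 / real (n + 2)))"
      by (intro incseq_SucI subset_ball) (simp add: field_simps)
    have "(SUP n. emeasure (density lborel f) (ball 0 (1 - 1 / real (n + 2)))) = emeasure (density lborel f) (\<Union>n. ball 0 (1 - 1 / real (n + 2)))"
      by (rule SUP_emeasure_incseq[OF _ inc]) auto
    then show ?thesis by (subst (asm) (1 2) emeasure_density) auto
  qed
  also have "\<dots> \<le> B2"
    by (intro SUP_least XR) (auto simp: field_simps)
  finally show ?thesis using B2 by simp
qed

end

section \<open>Taylor coefficients and weighted norms\<close>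

abbreviation hol :: "(complex \<Rightarrow> complex) \<Rightarrow> bool" where
  "hol f \<equiv> f holomorphic_on ball 0 1"

lemma hol_higher_deriv: "hol f \<Longrightarrow> hol ((deriv ^^ n) f)"
  by (rule holomorphic_higher_deriv) auto

lemma higher_deriv_hol_add:
  "\<lbrakk>hol f; hol g; cmod z < 1\<rbrakk> \<Longrightarrow> (deriv ^^ n) (\<lambda>w. f w + g w) z = (deriv ^^ n) f z + (deriv ^^ n) g z"
  by (rule higher_deriv_add[of _ "ball 0 1"]) auto

lemma higher_deriv_hol_diff:
  "\<lbrakk>hol f; hol g; cmod z < 1\<rbrakk> \<Longrightarrow> (deriv ^^ n) (\<lambda>w. f w - g w) z = (deriv ^^ n) f z - (deriv ^^ n) g z"
  by (rule higher_deriv_diff[of _ "ball 0 1"]) auto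

lemma higher_deriv_hol_cmult:
  "\<lbrakk>hol f; cmod z < 1\<rbrakk> \<Longrightarrow> (deriv ^^ n) (\<lambda>w. c * f w) z = c * (deriv ^^ n) f z"
  by (rule higher_deriv_cmult[of _ "ball 0 1"]) auto

lemma higher_deriv_hol_cong:
  "\<lbrakk>hol f; \<And>z. cmod z < 1 \<Longrightarrow> f z = g z; cmod z < 1\<rbrakk> \<Longrightarrow> (deriv ^^ n) f z = (deriv ^^ n) g z"
  by (rule higher_deriv_transform_within_open[of _ "ball 0 1"]) (auto elim: holomorphic_transform)

lemma hol_cong: "(\<And>z. cmod z < 1 \<Longrightarrow> f z = g z) \<Longrightarrow> hol f \<longleftrightarrow> hol g"
  by (rule holomorphic_cong) auto

lemma tcoeff_add: "\<lbrakk>hol f; hol g\<rbrakk> \<Longrightarrow> tcoeff (\<lambda>z. f z + g z) n = tcoeff f n + tcoeff g n"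
  by (simp add: tcoeff_def higher_deriv_hol_add add_divide_distrib)

lemma tcoeff_diff: "\<lbrakk>hol f; hol g\<rbrakk> \<Longrightarrow> tcoeff (\<lambda>z. f z - g z) n = tcoeff f n - tcoeff g n"
  by (simp add: tcoeff_def higher_deriv_hol_diff diff_divide_distrib)

lemma tcoeff_cmult: "hol f \<Longrightarrow> tcoeff (\<lambda>z. c * f z) n = c * tcoeff f n"
  by (simp add: tcoeff_def higher_deriv_hol_cmult)

lemma tcoeff_cong: "\<lbrakk>hol f; \<And>z. cmod z < 1 \<Longrightarrow> f z = g z\<rbrakk> \<Longrightarrow> tcoeff f n = tcoeff g n"
  by (simp add: tcoeff_def higher_deriv_hol_cong[where g = g])

lemma tcoeff_sums: "\<lbrakk>hol f; cmod z < 1\<rbrakk> \<Longrightarrow> (\<lambda>n. tcoeff f n * z ^ n) sums f z"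
  using holomorphic_power_series[of f 0 1 z] by (simp add: tcoeff_def)

lemma hol_eqI:
  assumes "hol f" "hol g" "\<And>n. tcoeff f n = tcoeff g n" "cmod z < 1"
  shows "f z = g z"
  using tcoeff_sums[OF assms(1,4)] tcoeff_sums[OF assms(2,4)] assms(3) by (simp add: sums_unique2)

lemma tcoeff_mult:
  assumes "hol f" "hol g"
  shows "tcoeff (\<lambda>z. f z * g z) n = (\<Sum>i=0..n. tcoeff f i * tcoeff g (n - i))"
proof -
  have "(deriv ^^ n) (\<lambda>z. f z * g z) 0 = (\<Sum>i=0..n. of_nat (n choose i) * (deriv ^^ i) f 0 * (deriv ^^ (n - i)) g 0)"
    by (rule higher_deriv_mult[of _ "ball 0 1"]) (use assms in auto)
  then have "tcoeff (\<lambda>z. f z * g z) n = (\<Sum>i=0..n. of_nat (n choose i) * (deriv ^^ i) f 0 * (deriv ^^ (n - i)) g 0 / fact n)"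
    by (simp add: tcoeff_def sum_divide_distrib)
  also have "\<dots> = (\<Sum>i=0..n. tcoeff f i * tcoeff g (n - i))"
    by (intro sum.cong refl) (simp add: tcoeff_def binomial_fact)
  finally show ?thesis .
qed

text \<open>Limits are constructed through this: a norm bound controls all coefficients uniformly,
  and the limiting coefficients define the limit function.\<close>

lemma hol_power_series:
  fixes a :: "nat \<Rightarrow> complex"
  assumes "\<And>n. cmod (a n) \<le> C"
  obtains f where "hol f" "\<And>n. tcoeff f n = a n" "\<And>z. cmod z < 1 \<Longrightarrow> (\<lambda>n. a n * z ^ n) sums f z"
proof -
  define f where "f z = (\<Sum>n. a n * z ^ n)" for z
  have s: "(\<lambda>n. a n * z ^ n) sums f z" if "cmod z < 1" for z
  proof -
    have "summable (\<lambda>n. a n * z ^ n)"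
    proof (rule summable_comparison_test')
      show "summable (\<lambda>n. C * cmod z ^ n)" using that by (intro summable_mult summable_geometric) simp
      show "norm (a n * z ^ n) \<le> C * cmod z ^ n" for n
        using assms[of n] by (simp add: norm_mult norm_power mult_right_mono)
    qed
    then show ?thesis by (simp add: f_def summable_sums)
  qed
  have h: "hol f" by (rule power_series_holomorphic[of _ _ a]) (use s in auto)
  have "tcoeff f n = a n" for n
  proof -
    have "f has_fps_expansion Abs_fps a"
    proof (rule has_fps_expansionI)
      show "\<forall>\<^sub>F u in nhds 0. (\<lambda>n. fps_nth (Abs_fps a) n * u ^ n) sums f u"
        by (rule eventually_mono[OF eventually_nhds_in_open[of "ball 0 1"]]) (use s in auto)
    qed
    from fps_nth_fps_expansion[OF this, of n] show ?thesis by (simp add: tcoeff_def)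
  qed
  with h s show ?thesis using that by blast
qed

section \<open>Limits inferior and coefficientwise convergence\<close>

lemma ennreal_liminf_superadd:
  fixes u v :: "nat \<Rightarrow> ennreal"
  shows "liminf u + liminf v \<le> liminf (\<lambda>n. u n + v n)"
proof -
  have "liminf u + liminf v = (SUP n. (INF k\<in>{n..}. u k) + (INF k\<in>{n..}. v k))"
    unfolding liminf_SUP_INF
    by (rule ennreal_SUP_add[symmetric]) (auto simp: incseq_def intro!: INF_superset_mono)
  also have "\<dots> \<le> (SUP n. INF k\<in>{n..}. u k + v k)"
    by (intro SUP_mono') (auto intro!: INF_greatest add_mono INF_lower)
  finally show ?thesis by (simp add: liminf_SUP_INF)
qed

lemma ennreal_liminf_sum:
  fixes u :: "'a \<Rightarrow> nat \<Rightarrow> ennreal"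
  assumes "finite A"
  shows "(\<Sum>i\<in>A. liminf (u i)) \<le> liminf (\<lambda>n. \<Sum>i\<in>A. u i n)"
  using assms
proof induction
  case (insert x A)
  then show ?case
    by simp (rule order_trans[OF add_left_mono ennreal_liminf_superadd])
qed simp

lemma ennreal_cmult_liminf:
  fixes u :: "nat \<Rightarrow> ennreal"
  assumes "a < \<infinity>"
  shows "a * liminf u \<le> liminf (\<lambda>n. a * u n)"
proof -
  have "a * liminf u = (SUP n. a * (INF k\<in>{n..}. u k))"
    unfolding liminf_SUP_INF by (simp add: SUP_mult_left_ennreal)
  also have "\<dots> \<le> (SUP n. INF k\<in>{n..}. a * u k)"
    by (intro SUP_mono') (auto intro!: INF_greatest mult_left_mono INF_lower)
  finally show ?thesis by (simp add: liminf_SUP_INF)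
qed

text \<open>Uniformly bounded coefficients are dominated by a geometric series on a disc of radius
  \<open>\<rho> < 1\<close>, so Tannery's theorem turns coefficientwise convergence into uniform
  convergence there; the Weierstrass theorem passes to derivatives.\<close>

lemma hol_coeffwise_limit:
  assumes F: "\<And>n. hol (F n)" and f: "hol f"
    and lim: "\<And>i. (\<lambda>n. tcoeff (F n) i) \<longlonglongrightarrow> tcoeff f i"
    and B: "\<And>n i. cmod (tcoeff (F n) i) \<le> B"
    and z: "cmod z < 1"
  shows "(\<lambda>n. (deriv ^^ k) (F n) z) \<longlonglongrightarrow> (deriv ^^ k) f z"
proof -
  obtain \<rho> where \<rho>: "cmod z < \<rho>" "\<rho> < 1" using z dense by blast
  have \<rho>0: "0 < \<rho>" using \<rho>(1) norm_ge_zero[of z] by linarith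
  have Bf: "cmod (tcoeff f i) \<le> B" for i
    by (rule tendsto_upperbound[OF tendsto_norm[OF lim]]) (use B in auto)
  have sB: "summable (\<lambda>i. (2 * B) * \<rho> ^ i)" using \<rho> \<rho>0 by (intro summable_mult summable_geometric) auto
  have bnd: "cmod (tcoeff (F n) i - tcoeff f i) * \<rho> ^ i \<le> (2 * B) * \<rho> ^ i" for n i
    using norm_triangle_ineq4[of "tcoeff (F n) i" "tcoeff f i"] B[of n i] Bf[of i] \<rho>0
    by (intro mult_right_mono) auto
  define e where "e n = (\<Sum>i. cmod (tcoeff (F n) i - tcoeff f i) * \<rho> ^ i)" for n
  have se: "summable (\<lambda>i. cmod (tcoeff (F n) i - tcoeff f i) * \<rho> ^ i)" for n
    by (rule summable_comparison_test'[OF sB]) (use bnd \<rho>0 in auto)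
  have "e \<longlonglongrightarrow> (\<Sum>i::nat. 0)"
    unfolding e_def
  proof (rule conjunct2[OF conjunct2[OF tannerys_theorem[where M = "\<lambda>i. (2 * B) * \<rho> ^ i"]]])
    show "(\<lambda>n. cmod (tcoeff (F n) i - tcoeff f i) * \<rho> ^ i) \<longlonglongrightarrow> 0" for i
      using tendsto_mult[OF tendsto_norm[OF tendsto_diff[OF lim[of i] tendsto_const[of "tcoeff f i"]]] tendsto_const[of "\<rho> ^ i"]] by simp
    show "\<forall>\<^sub>F (i, n) in at_top \<times>\<^sub>F sequentially. norm (cmod (tcoeff (F n) i - tcoeff f i) * \<rho> ^ i) \<le> (2 * B) * \<rho> ^ i"
      by (rule always_eventually) (use bnd \<rho>0 in auto)
  qed (use sB in auto)
  then have e0: "e \<longlonglongrightarrow> 0" by simp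
  have le: "cmod (F n w - f w) \<le> e n" if w: "w \<in> ball 0 \<rho>" for n w
  proof -
    have w1: "cmod w < 1" "cmod w \<le> \<rho>" using w \<rho> by auto
    have "(\<lambda>i. (tcoeff (F n) i - tcoeff f i) * w ^ i) sums (F n w - f w)"
      using sums_diff[OF tcoeff_sums[OF F[of n] w1(1)] tcoeff_sums[OF f w1(1)]] by (simp add: algebra_simps)
    moreover have le': "norm ((tcoeff (F n) i - tcoeff f i) * w ^ i) \<le> cmod (tcoeff (F n) i - tcoeff f i) * \<rho> ^ i" for i
      using w1 by (simp add: norm_mult norm_power mult_left_mono power_mono)
    ultimately show ?thesis unfolding e_def
      using norm_suminf_le[OF le' se[of n]] by (metis sums_unique)
  qed
  have ul: "uniform_limit (ball 0 \<rho>) F f sequentially"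
  proof (rule uniform_limitI)
    fix \<epsilon> :: real assume "\<epsilon> > 0"
    with e0 have "\<forall>\<^sub>F n in sequentially. e n < \<epsilon>" by (rule order_tendstoD)
    then show "\<forall>\<^sub>F n in sequentially. \<forall>x\<in>ball 0 \<rho>. dist (F n x) (f x) < \<epsilon>"
      by eventually_elim (metis dist_norm le order_le_less_trans)
  qed
  show ?thesis
    by (rule higher_deriv_complex_uniform_limit[OF ul])
       (use \<rho> in \<open>auto intro!: always_eventually holomorphic_on_subset[OF F]\<close>)
qed

lemma parallelogram_complex:
  fixes a b :: complex
  shows "(cmod (a + b))\<^sup>2 + (cmod (a - b))\<^sup>2 = 2 * (cmod a)\<^sup>2 + 2 * (cmod b)\<^sup>2"
  by (simp add: cmod_power2 power2_sum power2_diff)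

context circle_meas
begin

text \<open>Both sides may be infinite. In this form the identity shows at once that sums and
  differences of functions with finite integral again have finite integral.\<close>

lemma L2w_parallelogram:
  assumes "hol F" "hol G"
  shows "L2w \<mu> a (\<lambda>z. F z + G z) + L2w \<mu> a (\<lambda>z. F z - G z) = 2 * L2w \<mu> a F + 2 * L2w \<mu> a G"
proof -
  have c: "continuous_on (ball 0 1) F" "continuous_on (ball 0 1) G"
    using assms by (auto intro: holomorphic_on_imp_continuous_on)
  note L2w_measurable[OF c(1), of a, measurable] L2w_measurable[OF c(2), of a, measurable]
     L2w_measurable[OF continuous_on_add[OF c], of a, measurable] L2w_measurable[OF continuous_on_diff[OF c], of a, measurable]
  have "L2w \<mu> a (\<lambda>z. F z + G z) + L2w \<mu> a (\<lambda>z. F z - G z)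
     = (\<integral>\<^sup>+z. ennreal ((cmod (F z + G z))\<^sup>2 * wt a z) * indicator (ball 0 1) z + ennreal ((cmod (F z - G z))\<^sup>2 * wt a z) * indicator (ball 0 1) z \<partial>lborel)"
    unfolding L2w_wt by (subst nn_integral_add) auto
  also have "\<dots> = (\<integral>\<^sup>+z. 2 * (ennreal ((cmod (F z))\<^sup>2 * wt a z) * indicator (ball 0 1) z) + 2 * (ennreal ((cmod (G z))\<^sup>2 * wt a z) * indicator (ball 0 1) z) \<partial>lborel)"
  proof (intro nn_integral_cong)
    fix z
    have "ennreal ((cmod (F z + G z))\<^sup>2 * wt a z) + ennreal ((cmod (F z - G z))\<^sup>2 * wt a z)
       = 2 * ennreal ((cmod (F z))\<^sup>2 * wt a z) + 2 * ennreal ((cmod (G z))\<^sup>2 * wt a z)" if "cmod z < 1"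
    proof -
      have w: "0 \<le> wt a z" using that by (rule wt_nonneg)
      have "ennreal ((cmod (F z + G z))\<^sup>2 * wt a z) + ennreal ((cmod (F z - G z))\<^sup>2 * wt a z)
        = ennreal (((cmod (F z + G z))\<^sup>2 + (cmod (F z - G z))\<^sup>2) * wt a z)"
        using w by (simp add: distrib_right)
      also have "\<dots> = ennreal (2 * ((cmod (F z))\<^sup>2 * wt a z) + 2 * ((cmod (G z))\<^sup>2 * wt a z))"
        unfolding parallelogram_complex by (simp add: algebra_simps)
      also have "\<dots> = ennreal (2 * ((cmod (F z))\<^sup>2 * wt a z)) + ennreal (2 * ((cmod (G z))\<^sup>2 * wt a z))"
        using w by (intro ennreal_plus) auto
      finally show ?thesis using w by (simp add: ennreal_mult)
    qed
    then show "ennreal ((cmod (F z + G z))\<^sup>2 * wt a z) * indicator (ball 0 1) z + ennreal ((cmod (F z - G z))\<^sup>2 * wt a z) * indicator (ball 0 1) z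
      = 2 * (ennreal ((cmod (F z))\<^sup>2 * wt a z) * indicator (ball 0 1) z) + 2 * (ennreal ((cmod (G z))\<^sup>2 * wt a z) * indicator (ball 0 1) z)"
      by (cases "cmod z < 1") auto
  qed
  also have "\<dots> = 2 * L2w \<mu> a F + 2 * L2w \<mu> a G"
    unfolding L2w_wt by (simp add: nn_integral_add nn_integral_cmult)
  finally show ?thesis .
qed

lemma L2w_cmult:
  assumes "hol F"
  shows "L2w \<mu> a (\<lambda>z. c * F z) = ennreal ((cmod c)\<^sup>2) * L2w \<mu> a F"
proof -
  have "L2w \<mu> a (\<lambda>z. c * F z) = (\<integral>\<^sup>+z. ennreal ((cmod c)\<^sup>2) * (ennreal ((cmod (F z))\<^sup>2 * wt a z) * indicator (ball 0 1) z) \<partial>lborel)"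
    unfolding L2w_wt
  proof (intro nn_integral_cong)
    fix z
    show "ennreal ((cmod (c * F z))\<^sup>2 * wt a z) * indicator (ball 0 1) z = ennreal ((cmod c)\<^sup>2) * (ennreal ((cmod (F z))\<^sup>2 * wt a z) * indicator (ball 0 1) z)"
      using wt_nonneg[of z a] by (cases "cmod z < 1") (auto simp: norm_mult power_mult_distrib mult.assoc ennreal_mult)
  qed
  also have "\<dots> = ennreal ((cmod c)\<^sup>2) * L2w \<mu> a F"
    unfolding L2w_wt using L2w_measurable[OF holomorphic_on_imp_continuous_on[OF assms], of a]
    by (intro nn_integral_cmult) simp
  finally show ?thesis .
qed

lemma L2w_add_finite:
  assumes "hol F" "hol G" "L2w \<mu> a F < \<infinity>" "L2w \<mu> a G < \<infinity>"
  shows "L2w \<mu> a (\<lambda>z. F z + G z) < \<infinity>" "L2w \<mu> a (\<lambda>z. F z - G z) < \<infinity>"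
proof -
  have "L2w \<mu> a (\<lambda>z. F z + G z) + L2w \<mu> a (\<lambda>z. F z - G z) < \<infinity>"
    using assms by (subst L2w_parallelogram) (auto simp: ennreal_mult_less_top)
  then show "L2w \<mu> a (\<lambda>z. F z + G z) < \<infinity>" "L2w \<mu> a (\<lambda>z. F z - G z) < \<infinity>" by auto
qed

lemma L2w_fatou:
  assumes F: "\<And>n. hol (F n)" and lim: "\<And>z. cmod z < 1 \<Longrightarrow> (\<lambda>n. F n z) \<longlonglongrightarrow> f z"
  shows "L2w \<mu> a f \<le> liminf (\<lambda>n. L2w \<mu> a (F n))"
proof -
  have "L2w \<mu> a f = (\<integral>\<^sup>+z. liminf (\<lambda>n. ennreal ((cmod (F n z))\<^sup>2 * wt a z) * indicator (ball 0 1) z) \<partial>lborel)"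
    unfolding L2w_wt
  proof (intro nn_integral_cong)
    fix z
    show "ennreal ((cmod (f z))\<^sup>2 * wt a z) * indicator (ball 0 1) z = liminf (\<lambda>n. ennreal ((cmod (F n z))\<^sup>2 * wt a z) * indicator (ball 0 1) z)"
    proof (cases "cmod z < 1")
      case True
      have "(\<lambda>n. ennreal ((cmod (F n z))\<^sup>2 * wt a z)) \<longlonglongrightarrow> ennreal ((cmod (f z))\<^sup>2 * wt a z)"
        by (intro tendsto_ennrealI tendsto_intros lim True)
      from lim_imp_Liminf[OF _ this] True show ?thesis by simp
    qed (simp add: Liminf_const)
  qed
  also have "\<dots> \<le> liminf (\<lambda>n. \<integral>\<^sup>+z. ennreal ((cmod (F n z))\<^sup>2 * wt a z) * indicator (ball 0 1) z \<partial>lborel)"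
    by (rule nn_integral_liminf)
       (simp add: L2w_measurable holomorphic_on_imp_continuous_on F)
  finally show ?thesis by (simp add: L2w_wt)
qed

lemma L2w_integrable:
  assumes "hol F" "L2w \<mu> a F < \<infinity>"
  shows "integrable lborel (\<lambda>z. indicator (ball 0 1) z * ((cmod (F z))\<^sup>2 * wt a z))"
    and "(LINT z|lborel. indicator (ball 0 1) z * ((cmod (F z))\<^sup>2 * wt a z)) = enn2real (L2w \<mu> a F)"
proof -
  have eq: "ennreal (indicator (ball 0 1) z * ((cmod (F z))\<^sup>2 * wt a z)) = ennreal ((cmod (F z))\<^sup>2 * wt a z) * indicator (ball 0 1) z" for z
    by (simp add: indicator_def)
  have nn: "0 \<le> indicator (ball 0 1) z * ((cmod (F z))\<^sup>2 * wt a z)" for z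
    using wt_nonneg[of z a] by (auto simp: indicator_def)
  have m: "(\<lambda>z. indicator (ball 0 1) z * ((cmod (F z))\<^sup>2 * wt a z)) \<in> borel_measurable lborel"
  proof -
    note measurable_indicator_continuous[OF holomorphic_on_imp_continuous_on[OF assms(1)], measurable]
    have "(\<lambda>z. (cmod (indicator (ball 0 1) z *\<^sub>R F z))\<^sup>2 * wt a z) \<in> borel_measurable lborel" by measurable
    also have "(\<lambda>z. (cmod (indicator (ball 0 1) z *\<^sub>R F z))\<^sup>2 * wt a z) = (\<lambda>z. indicator (ball 0 1) z * ((cmod (F z))\<^sup>2 * wt a z))"
      by (auto simp: fun_eq_iff indicator_def)
    finally show ?thesis .
  qed
  show i: "integrable lborel (\<lambda>z. indicator (ball 0 1) z * ((cmod (F z))\<^sup>2 * wt a z))"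
    by (rule integrableI_nonneg[OF m]) (use nn assms(2) in \<open>auto simp: eq L2w_wt\<close>)
  show "(LINT z|lborel. indicator (ball 0 1) z * ((cmod (F z))\<^sup>2 * wt a z)) = enn2real (L2w \<mu> a F)"
    using m nn by (subst integral_eq_nn_integral) (auto simp: eq L2w_wt)
qed

lemma L2w_inner_integrable:
  assumes F: "hol F" "L2w \<mu> a F < \<infinity>" and G: "hol G" "L2w \<mu> a G < \<infinity>"
  shows "set_integrable lborel (ball 0 1) (\<lambda>z. F z * cnj (G z) * of_real (wt a z))"
proof -
  have "integrable lborel (\<lambda>z. indicator (ball 0 1) z * ((cmod (F z))\<^sup>2 * wt a z) + indicator (ball 0 1) z * ((cmod (G z))\<^sup>2 * wt a z))"
    by (intro Bochner_Integration.integrable_add L2w_integrable F G)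
  then show ?thesis
    unfolding set_integrable_def
  proof (rule Bochner_Integration.integrable_bound)
    note measurable_indicator_continuous[OF holomorphic_on_imp_continuous_on[OF F(1)], measurable]
      measurable_indicator_continuous[OF holomorphic_on_imp_continuous_on[OF G(1)], measurable]
    have [measurable]: "cnj \<in> borel_measurable borel"
      by (intro borel_measurable_continuous_onI continuous_intros)
    have "(\<lambda>z. (indicator (ball 0 1) z *\<^sub>R F z) * cnj (indicator (ball 0 1) z *\<^sub>R G z) * of_real (wt a z)) \<in> borel_measurable lborel"
      by measurable
    also have "(\<lambda>z. (indicator (ball 0 1) z *\<^sub>R F z) * cnj (indicator (ball 0 1) z *\<^sub>R G z) * of_real (wt a z))
      = (\<lambda>z. indicator (ball 0 1) z *\<^sub>R (F z * cnj (G z) * of_real (wt a z)))"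
      by (auto simp: fun_eq_iff indicator_def)
    finally show "(\<lambda>z. indicator (ball 0 1) z *\<^sub>R (F z * cnj (G z) * of_real (wt a z))) \<in> borel_measurable lborel" .
    show "AE z in lborel. norm (indicator (ball 0 1) z *\<^sub>R (F z * cnj (G z) * of_real (wt a z)))
       \<le> norm (indicator (ball 0 1) z * ((cmod (F z))\<^sup>2 * wt a z) + indicator (ball 0 1) z * ((cmod (G z))\<^sup>2 * wt a z))"
    proof (rule AE_I2)
      fix z
      show "norm (indicator (ball 0 1) z *\<^sub>R (F z * cnj (G z) * of_real (wt a z)))
       \<le> norm (indicator (ball 0 1) z * ((cmod (F z))\<^sup>2 * wt a z) + indicator (ball 0 1) z * ((cmod (G z))\<^sup>2 * wt a z))"
      proof (cases "cmod z < 1")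
        case True
        note w = wt_nonneg[OF True, of a]
        have "cmod (F z) * cmod (G z) \<le> (cmod (F z))\<^sup>2 + (cmod (G z))\<^sup>2"
          using sum_squares_bound[of "cmod (F z)" "cmod (G z)"] mult_nonneg_nonneg[OF norm_ge_zero norm_ge_zero, of "F z" "G z"] by linarith
        from mult_right_mono[OF this w] show ?thesis using True w by (simp add: norm_mult distrib_right)
      qed simp
    qed
  qed
qed

end

section \<open>The norm\<close>

lemma Poisson_null: "Poisson (null_measure M) z = 0"
proof -
  have "AE x in null_measure M. indicator (sphere 0 1) x *\<^sub>R ((1 - (cmod z)\<^sup>2) / (cmod (z - x))\<^sup>2) = 0"
    by (rule AE_I'[of "space M"]) (auto simp: null_sets_def)
  then show ?thesis
    unfolding Poisson_def set_lebesgue_integral_def by (rule integral_eq_zero_AE)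
qed

text \<open>The zero measure has a clause of its own in \<open>Hmuj\<close>. As the integral then
  vanishes, finiteness of \<open>Dmu\<close> describes membership within \<open>H2\<close> in both
  cases.\<close>

lemma Dmu_null: "Dmu (null_measure M) j f = 0"
  by (simp add: Dmu_def Poisson_null)

lemma Dmu_L2w: "Dmu \<mu> j f = ennreal (1 / (fact j * fact (j - 1) * pi)) * L2w \<mu> (j - 1) ((deriv ^^ j) f)"
  by (simp add: Dmu_def L2w_def)

lemma Dmu_finite_iff: "Dmu \<mu> j f < \<infinity> \<longleftrightarrow> L2w \<mu> (j - 1) ((deriv ^^ j) f) < \<infinity>"
  by (auto simp: Dmu_L2w ennreal_mult_less_top)

lemma H2_iff: "f \<in> H2 \<longleftrightarrow> hol f \<and> (\<Sum>n. ennreal ((cmod (tcoeff f n))\<^sup>2)) < \<infinity>"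
proof -
  have "summable (\<lambda>n. (cmod (tcoeff f n))\<^sup>2)" if "(\<Sum>n. ennreal ((cmod (tcoeff f n))\<^sup>2)) < \<infinity>"
    by (rule summable_suminf_not_top, simp, metis that infinity_ennreal_def less_irrefl)
  moreover have "(\<Sum>n. ennreal ((cmod (tcoeff f n))\<^sup>2)) < \<infinity>" if "summable (\<lambda>n. (cmod (tcoeff f n))\<^sup>2)"
    using suminf_ennreal2[OF _ that] by (metis ennreal_less_top infinity_ennreal_def zero_le_power2)
  ultimately show ?thesis by (auto simp: H2_def)
qed

section \<open>The square norm as an extended quadratic functional\<close>

locale hmu =
  fixes m :: nat and \<mu>s :: "nat \<Rightarrow> complex measure"
  assumes meas: "\<And>j. j \<in> {1..m} \<Longrightarrow> circle_measure (\<mu>s j)"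
begin

lemma circle_meas: "j \<in> {1..m} \<Longrightarrow> circle_meas (\<mu>s j)"
  using meas by unfold_locales

text \<open>The square of the norm, defined for every function and allowed to be infinite, so that
  membership in the space becomes finiteness. \<open>ip_self\<close> identifies it on
  \<open>H\<close> with the given inner product.\<close>

definition Q :: "(complex \<Rightarrow> complex) \<Rightarrow> ennreal" where
  "Q f = (\<Sum>n. ennreal ((cmod (tcoeff f n))\<^sup>2)) + (\<Sum>j=1..m. Dmu (\<mu>s j) j f)"

abbreviation H :: "(complex \<Rightarrow> complex) set" where
  "H \<equiv> Hmu m \<mu>s"

lemma H_iff: "f \<in> H \<longleftrightarrow> hol f \<and> Q f < \<infinity>"
proof -
  have "f \<in> Hmuj (\<mu>s j) j \<longleftrightarrow> Dmu (\<mu>s j) j f < \<infinity>" if "f \<in> H2" for j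
    using that by (auto simp: Hmuj_def Dmu_null H2_def)
  then have "f \<in> H \<longleftrightarrow> f \<in> H2 \<and> (\<forall>j\<in>{1..m}. Dmu (\<mu>s j) j f < \<infinity>)"
    by (auto simp: Hmu_def)
  then show ?thesis by (auto simp: H2_iff Q_def)
qed

lemma H_iff': "f \<in> H \<longleftrightarrow> f \<in> H2 \<and> (\<forall>j\<in>{1..m}. L2w (\<mu>s j) (j - 1) ((deriv ^^ j) f) < \<infinity>)"
  unfolding H_iff H2_iff Q_def by (auto simp: Dmu_finite_iff[unfolded infinity_ennreal_def])

lemma H_hol [intro]: "f \<in> H \<Longrightarrow> hol f"
  by (simp add: H_iff)

lemma Q_cong:
  assumes "hol f" "\<And>z. cmod z < 1 \<Longrightarrow> f z = g z"
  shows "Q f = Q g"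
  unfolding Q_def Dmu_L2w using tcoeff_cong[OF assms] higher_deriv_hol_cong[OF assms]
  by (simp add: L2w_cong[of "(deriv ^^ n) f" "(deriv ^^ n) g" for n])

lemma Q_parallelogram:
  assumes f: "hol f" and g: "hol g"
  shows "Q (\<lambda>z. f z + g z) + Q (\<lambda>z. f z - g z) = 2 * Q f + 2 * Q g"
proof -
  have 1: "(\<Sum>n. ennreal ((cmod (tcoeff (\<lambda>z. f z + g z) n))\<^sup>2)) + (\<Sum>n. ennreal ((cmod (tcoeff (\<lambda>z. f z - g z) n))\<^sup>2))
    = 2 * (\<Sum>n. ennreal ((cmod (tcoeff f n))\<^sup>2)) + 2 * (\<Sum>n. ennreal ((cmod (tcoeff g n))\<^sup>2))"
  proof -
    have "ennreal ((cmod (tcoeff (\<lambda>z. f z + g z) n))\<^sup>2) + ennreal ((cmod (tcoeff (\<lambda>z. f z - g z) n))\<^sup>2)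
        = 2 * ennreal ((cmod (tcoeff f n))\<^sup>2) + 2 * ennreal ((cmod (tcoeff g n))\<^sup>2)" for n
    proof -
      have "ennreal ((cmod (tcoeff (\<lambda>z. f z + g z) n))\<^sup>2) + ennreal ((cmod (tcoeff (\<lambda>z. f z - g z) n))\<^sup>2)
        = ennreal (2 * (cmod (tcoeff f n))\<^sup>2 + 2 * (cmod (tcoeff g n))\<^sup>2)"
        unfolding parallelogram_complex[symmetric] tcoeff_add[OF f g] tcoeff_diff[OF f g] by (rule ennreal_plus[symmetric]) auto
      also have "\<dots> = 2 * ennreal ((cmod (tcoeff f n))\<^sup>2) + 2 * ennreal ((cmod (tcoeff g n))\<^sup>2)"
        by (subst ennreal_plus) (auto simp: ennreal_mult)
      finally show ?thesis .
    qed
    then have "(\<Sum>n. ennreal ((cmod (tcoeff (\<lambda>z. f z + g z) n))\<^sup>2)) + (\<Sum>n. ennreal ((cmod (tcoeff (\<lambda>z. f z - g z) n))\<^sup>2))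
      = (\<Sum>n. 2 * ennreal ((cmod (tcoeff f n))\<^sup>2) + 2 * ennreal ((cmod (tcoeff g n))\<^sup>2))"
      by (subst suminf_add[OF summableI summableI]) (simp del: suminf_ennreal)
    then show ?thesis
      by (simp add: suminf_add[OF summableI summableI, symmetric] ennreal_suminf_cmult del: suminf_ennreal)
  qed
  have 2: "(\<Sum>j=1..m. Dmu (\<mu>s j) j (\<lambda>z. f z + g z)) + (\<Sum>j=1..m. Dmu (\<mu>s j) j (\<lambda>z. f z - g z))
    = 2 * (\<Sum>j=1..m. Dmu (\<mu>s j) j f) + 2 * (\<Sum>j=1..m. Dmu (\<mu>s j) j g)"
    unfolding sum.distrib[symmetric] sum_distrib_left
  proof (rule sum.cong[OF refl])
    fix j assume j: "j \<in> {1..m}"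
    interpret circle_meas "\<mu>s j" by (rule circle_meas[OF j])
    have a: "L2w (\<mu>s j) (j - 1) ((deriv ^^ j) (\<lambda>z. f z + g z)) = L2w (\<mu>s j) (j - 1) (\<lambda>z. (deriv ^^ j) f z + (deriv ^^ j) g z)"
      by (rule L2w_cong) (simp add: higher_deriv_hol_add f g)
    have b: "L2w (\<mu>s j) (j - 1) ((deriv ^^ j) (\<lambda>z. f z - g z)) = L2w (\<mu>s j) (j - 1) (\<lambda>z. (deriv ^^ j) f z - (deriv ^^ j) g z)"
      by (rule L2w_cong) (simp add: higher_deriv_hol_diff f g)
    show "Dmu (\<mu>s j) j (\<lambda>z. f z + g z) + Dmu (\<mu>s j) j (\<lambda>z. f z - g z) = 2 * Dmu (\<mu>s j) j f + 2 * Dmu (\<mu>s j) j g"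
      unfolding Dmu_L2w a b distrib_left[symmetric]
        L2w_parallelogram[OF hol_higher_deriv[OF f] hol_higher_deriv[OF g]]
      by (simp only: distrib_left mult.left_commute)
  qed
  have "Q (\<lambda>z. f z + g z) + Q (\<lambda>z. f z - g z)
    = ((\<Sum>n. ennreal ((cmod (tcoeff (\<lambda>z. f z + g z) n))\<^sup>2)) + (\<Sum>n. ennreal ((cmod (tcoeff (\<lambda>z. f z - g z) n))\<^sup>2)))
     + ((\<Sum>j=1..m. Dmu (\<mu>s j) j (\<lambda>z. f z + g z)) + (\<Sum>j=1..m. Dmu (\<mu>s j) j (\<lambda>z. f z - g z)))"
    by (simp add: Q_def add_ac)
  also have "\<dots> = 2 * Q f + 2 * Q g"
    unfolding 1 2 by (simp add: Q_def algebra_simps)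
  finally show ?thesis .
qed

lemma Q_cmult:
  assumes f: "hol f"
  shows "Q (\<lambda>z. c * f z) = ennreal ((cmod c)\<^sup>2) * Q f"
proof -
  have 1: "(\<Sum>n. ennreal ((cmod (tcoeff (\<lambda>z. c * f z) n))\<^sup>2)) = ennreal ((cmod c)\<^sup>2) * (\<Sum>n. ennreal ((cmod (tcoeff f n))\<^sup>2))"
    by (simp add: tcoeff_cmult[OF f] norm_mult power_mult_distrib ennreal_mult ennreal_suminf_cmult del: suminf_ennreal)
  have 2: "(\<Sum>j=1..m. Dmu (\<mu>s j) j (\<lambda>z. c * f z)) = ennreal ((cmod c)\<^sup>2) * (\<Sum>j=1..m. Dmu (\<mu>s j) j f)"
    unfolding sum_distrib_left
  proof (rule sum.cong[OF refl])
    fix j assume j: "j \<in> {1..m}"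
    interpret circle_meas "\<mu>s j" by (rule circle_meas[OF j])
    have a: "L2w (\<mu>s j) (j - 1) ((deriv ^^ j) (\<lambda>z. c * f z)) = L2w (\<mu>s j) (j - 1) (\<lambda>z. c * (deriv ^^ j) f z)"
      by (rule L2w_cong) (simp add: higher_deriv_hol_cmult f)
    show "Dmu (\<mu>s j) j (\<lambda>z. c * f z) = ennreal ((cmod c)\<^sup>2) * Dmu (\<mu>s j) j f"
      unfolding Dmu_L2w a L2w_cmult[OF hol_higher_deriv[OF f]] by (simp add: mult_ac)
  qed
  show ?thesis unfolding Q_def 1 2 by (simp add: distrib_left)
qed

lemma tcoeff_le_Q: "ennreal ((cmod (tcoeff f n))\<^sup>2) \<le> Q f"
proof -
  have "ennreal ((cmod (tcoeff f n))\<^sup>2) \<le> (\<Sum>n. ennreal ((cmod (tcoeff f n))\<^sup>2))"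
    using sum_le_suminf[of "\<lambda>n. ennreal ((cmod (tcoeff f n))\<^sup>2)" "{n}"] by (simp del: suminf_ennreal)
  then show ?thesis unfolding Q_def by (rule add_increasing2[OF zero_le])
qed

text \<open>Fatou's lemma twice: for the counting measure on the coefficients, and for the area
  integrals, since bounded coefficientwise convergence gives pointwise convergence of all
  derivatives. It puts limits of bounded sequences into the space.\<close>

lemma Q_lsc:
  assumes F: "\<And>n. hol (F n)" and f: "hol f" and lim: "\<And>i. (\<lambda>n. tcoeff (F n) i) \<longlonglongrightarrow> tcoeff f i"
    and B: "\<And>n. Q (F n) \<le> ennreal B"
  shows "Q f \<le> ennreal B"
proof -
  \<comment> \<open>\<open>ennreal\<close> truncates negative numbers to 0, hence the
    maximum.\<close>
  have b: "cmod (tcoeff (F n) i) \<le> sqrt (max B 0)" for n i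
  proof -
    have "ennreal ((cmod (tcoeff (F n) i))\<^sup>2) \<le> ennreal (max B 0)"
      by (rule order_trans[OF order_trans[OF tcoeff_le_Q B] ennreal_leI]) simp
    then have "(cmod (tcoeff (F n) i))\<^sup>2 \<le> max B 0" by (subst (asm) ennreal_le_iff) auto
    then show ?thesis by (rule real_le_rsqrt)
  qed
  note dlim = hol_coeffwise_limit[OF F f lim b]
  have "(\<Sum>i. ennreal ((cmod (tcoeff f i))\<^sup>2)) = (\<integral>\<^sup>+i. liminf (\<lambda>n. ennreal ((cmod (tcoeff (F n) i))\<^sup>2)) \<partial>count_space UNIV)"
    unfolding nn_integral_count_space_nat
  proof (intro suminf_cong)
    fix i
    have "(\<lambda>n. ennreal ((cmod (tcoeff (F n) i))\<^sup>2)) \<longlonglongrightarrow> ennreal ((cmod (tcoeff f i))\<^sup>2)"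
      by (intro tendsto_ennrealI tendsto_intros lim)
    from lim_imp_Liminf[OF _ this] show "ennreal ((cmod (tcoeff f i))\<^sup>2) = liminf (\<lambda>n. ennreal ((cmod (tcoeff (F n) i))\<^sup>2))" by simp
  qed
  also have "\<dots> \<le> liminf (\<lambda>n. \<integral>\<^sup>+i. ennreal ((cmod (tcoeff (F n) i))\<^sup>2) \<partial>count_space UNIV)"
    by (rule nn_integral_liminf) simp
  finally have 1: "(\<Sum>i. ennreal ((cmod (tcoeff f i))\<^sup>2)) \<le> liminf (\<lambda>n. \<Sum>i. ennreal ((cmod (tcoeff (F n) i))\<^sup>2))"
    by (simp add: nn_integral_count_space_nat)
  have "(\<Sum>j=1..m. Dmu (\<mu>s j) j f) \<le> (\<Sum>j=1..m. liminf (\<lambda>n. Dmu (\<mu>s j) j (F n)))"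
  proof (rule sum_mono)
    fix j assume j: "j \<in> {1..m}"
    interpret circle_meas "\<mu>s j" by (rule circle_meas[OF j])
    have "Dmu (\<mu>s j) j f \<le> ennreal (1 / (fact j * fact (j - 1) * pi)) * liminf (\<lambda>n. L2w (\<mu>s j) (j - 1) ((deriv ^^ j) (F n)))"
      unfolding Dmu_L2w by (intro mult_left_mono L2w_fatou hol_higher_deriv F dlim) auto
    also have "\<dots> \<le> liminf (\<lambda>n. Dmu (\<mu>s j) j (F n))"
      unfolding Dmu_L2w by (rule ennreal_cmult_liminf) simp
    finally show "Dmu (\<mu>s j) j f \<le> liminf (\<lambda>n. Dmu (\<mu>s j) j (F n))" .
  qed
  also have "\<dots> \<le> liminf (\<lambda>n. \<Sum>j=1..m. Dmu (\<mu>s j) j (F n))"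
    by (rule ennreal_liminf_sum) simp
  finally have "Q f \<le> liminf (\<lambda>n. \<Sum>i. ennreal ((cmod (tcoeff (F n) i))\<^sup>2)) + liminf (\<lambda>n. \<Sum>j=1..m. Dmu (\<mu>s j) j (F n))"
    unfolding Q_def by (rule add_mono[OF 1])
  also have "\<dots> \<le> liminf (\<lambda>n. Q (F n))"
    unfolding Q_def by (rule ennreal_liminf_superadd)
  also have "\<dots> \<le> ennreal B"
    using Liminf_mono[OF always_eventually[OF allI[OF B]], of sequentially] by (simp add: Liminf_const)
  finally show ?thesis .
qed

text \<open>\<open>enn2real\<close> maps infinity to 0, so an upper bound on \<open>q\<close> is
  informative only for members of \<open>H\<close>.\<close>

definition q :: "(complex \<Rightarrow> complex) \<Rightarrow> real" where
  "q f = enn2real (Q f)"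

lemma q_nonneg [simp]: "0 \<le> q f"
  by (simp add: q_def)

lemma Q_eq_q: "f \<in> H \<Longrightarrow> Q f = ennreal (q f)"
  by (simp add: H_iff q_def less_top)

lemma H_add: "\<lbrakk>f \<in> H; g \<in> H\<rbrakk> \<Longrightarrow> (\<lambda>z. f z + g z) \<in> H"
  and H_diff: "\<lbrakk>f \<in> H; g \<in> H\<rbrakk> \<Longrightarrow> (\<lambda>z. f z - g z) \<in> H"
proof -
  assume fg: "f \<in> H" "g \<in> H"
  then have "Q (\<lambda>z. f z + g z) + Q (\<lambda>z. f z - g z) < \<infinity>"
    by (subst Q_parallelogram) (auto simp: H_iff ennreal_mult_less_top)
  with fg show "(\<lambda>z. f z + g z) \<in> H" "(\<lambda>z. f z - g z) \<in> H"
    by (auto simp: H_iff intro!: holomorphic_intros)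
qed

lemma H_cmult: "f \<in> H \<Longrightarrow> (\<lambda>z. c * f z) \<in> H"
  by (auto simp: H_iff Q_cmult ennreal_mult_less_top intro!: holomorphic_intros)

lemma H_cong:
  assumes "f \<in> H" "\<And>z. cmod z < 1 \<Longrightarrow> f z = g z"
  shows "g \<in> H" "q f = q g"
  using assms Q_cong[of f g] hol_cong[of f g] by (auto simp: H_iff q_def)

lemma q_parallelogram:
  assumes "f \<in> H" "g \<in> H"
  shows "q (\<lambda>z. f z + g z) + q (\<lambda>z. f z - g z) = 2 * q f + 2 * q g"
proof -
  have "ennreal (q (\<lambda>z. f z + g z) + q (\<lambda>z. f z - g z)) = ennreal (2 * q f + 2 * q g)"
    using Q_parallelogram[OF H_hol[OF assms(1)] H_hol[OF assms(2)]] assms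
    by (simp add: Q_eq_q H_add H_diff ennreal_mult)
  then show ?thesis by (subst (asm) ennreal_inj) auto
qed

lemma q_cmult: "f \<in> H \<Longrightarrow> q (\<lambda>z. c * f z) = (cmod c)\<^sup>2 * q f"
  by (simp add: q_def Q_cmult[OF H_hol] enn2real_mult)

lemma q_add_le: "\<lbrakk>f \<in> H; g \<in> H\<rbrakk> \<Longrightarrow> q (\<lambda>z. f z + g z) \<le> 2 * q f + 2 * q g"
  using q_parallelogram[of f g] q_nonneg[of "\<lambda>z. f z - g z"] by linarith

lemma q_minus_commute: "\<lbrakk>f \<in> H; g \<in> H\<rbrakk> \<Longrightarrow> q (\<lambda>z. f z - g z) = q (\<lambda>z. g z - f z)"
  using q_cmult[OF H_diff, of f g "-1"] by simp

lemma tcoeff_le_q: "f \<in> H \<Longrightarrow> (cmod (tcoeff f n))\<^sup>2 \<le> q f"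
  using tcoeff_le_Q[of f n] by (simp add: Q_eq_q)

lemma q_eq_0D: "\<lbrakk>f \<in> H; q f = 0; cmod z < 1\<rbrakk> \<Longrightarrow> f z = 0"
  using hol_eqI[of f "\<lambda>_. 0" z] tcoeff_le_q[of f] by (auto simp: tcoeff_def)

lemma q_lsc:
  assumes F: "\<And>n. F n \<in> H" and f: "hol f" and lim: "\<And>i. (\<lambda>n. tcoeff (F n) i) \<longlonglongrightarrow> tcoeff f i"
    and B: "\<And>n. q (F n) \<le> B"
  shows "f \<in> H" "q f \<le> B"
proof -
  have "0 \<le> B" using B[of 0] q_nonneg[of "F 0"] by linarith
  have "Q f \<le> ennreal B"
    by (rule Q_lsc[OF _ f lim]) (use F B in \<open>auto simp: Q_eq_q ennreal_leI\<close>)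
  then show "f \<in> H" using f by (auto simp: H_iff intro: order_le_less_trans)
  with \<open>Q f \<le> ennreal B\<close> \<open>0 \<le> B\<close> show "q f \<le> B" by (simp add: Q_eq_q)
qed

lemma zero_H: "(\<lambda>_. 0) \<in> H"
proof -
  have "Q (\<lambda>_. 0) = 0" using Q_cmult[of "\<lambda>_. 0" 0] by simp
  then show ?thesis by (simp add: H_iff)
qed

lemma tcoeff_tendsto:
  assumes "\<And>n. F n \<in> H" "f \<in> H" "(\<lambda>n. q (\<lambda>z. F n z - f z)) \<longlonglongrightarrow> 0"
  shows "(\<lambda>n. tcoeff (F n) i) \<longlonglongrightarrow> tcoeff f i"
proof -
  have "(\<lambda>n. cmod (tcoeff (F n) i - tcoeff f i)) \<longlonglongrightarrow> 0"
  proof (rule tendsto_sandwich[OF _ _ tendsto_const])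
    show "\<forall>\<^sub>F n in sequentially. cmod (tcoeff (F n) i - tcoeff f i) \<le> sqrt (q (\<lambda>z. F n z - f z))"
      using tcoeff_le_q[OF H_diff, OF assms(1,2)] assms(1,2)
      by (intro always_eventually allI real_le_rsqrt) (simp add: tcoeff_diff H_hol)
    show "(\<lambda>n. sqrt (q (\<lambda>z. F n z - f z))) \<longlonglongrightarrow> 0"
      using tendsto_real_sqrt[OF assms(3)] by simp
  qed simp
  then show ?thesis by (rule LIM_zero_cancel[OF tendsto_norm_zero_cancel])
qed

text \<open>The limit is assembled from the limits of the coefficients. Semicontinuity, applied to
  \<open>F n - F k\<close> as \<open>k\<close> grows, shows that the difference from the limit lies
  in \<open>H\<close> with square norm at most the Cauchy bound.\<close>

lemma complete:
  assumes F: "\<And>n. F n \<in> H"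
    and cauchy: "\<And>\<epsilon>. \<epsilon> > 0 \<Longrightarrow> \<exists>N. \<forall>n\<ge>N. \<forall>k\<ge>N. q (\<lambda>z. F n z - F k z) \<le> \<epsilon>"
  obtains f where "f \<in> H" "(\<lambda>n. q (\<lambda>z. F n z - f z)) \<longlonglongrightarrow> 0"
proof -
  have "Cauchy (\<lambda>n. tcoeff (F n) i)" for i
  proof (rule metric_CauchyI)
    fix \<epsilon> :: real assume "\<epsilon> > 0"
    then obtain N where N: "\<And>n k. n \<ge> N \<Longrightarrow> k \<ge> N \<Longrightarrow> q (\<lambda>z. F n z - F k z) \<le> (\<epsilon> / 2)\<^sup>2"
      using cauchy[of "(\<epsilon> / 2)\<^sup>2"] by auto
    have "dist (tcoeff (F n) i) (tcoeff (F k) i) < \<epsilon>" if "n \<ge> N" "k \<ge> N" for n k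
    proof -
      have "(cmod (tcoeff (F n) i - tcoeff (F k) i))\<^sup>2 \<le> (\<epsilon> / 2)\<^sup>2"
        using order_trans[OF tcoeff_le_q[OF H_diff[OF F F]] N[OF that], of i] by (simp add: tcoeff_diff H_hol F)
      then have "cmod (tcoeff (F n) i - tcoeff (F k) i) \<le> \<epsilon> / 2"
        using \<open>\<epsilon> > 0\<close> by (simp add: power2_le_iff_abs_le)
      then show ?thesis using \<open>\<epsilon> > 0\<close> by (simp add: dist_norm)
    qed
    then show "\<exists>M. \<forall>n\<ge>M. \<forall>k\<ge>M. dist (tcoeff (F n) i) (tcoeff (F k) i) < \<epsilon>" by blast
  qed
  then have "\<forall>i. \<exists>a. (\<lambda>n. tcoeff (F n) i) \<longlonglongrightarrow> a"
    using Cauchy_convergent convergent_def by blast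
  then obtain a where a: "\<And>i. (\<lambda>n. tcoeff (F n) i) \<longlonglongrightarrow> a i" by metis
  obtain N1 where N1: "\<And>n k. n \<ge> N1 \<Longrightarrow> k \<ge> N1 \<Longrightarrow> q (\<lambda>z. F n z - F k z) \<le> 1"
    using cauchy[of 1] by auto
  have bd: "q (F n) \<le> 2 + 2 * q (F N1)" if "n \<ge> N1" for n
    using q_add_le[OF H_diff[OF F F] F, of n N1 N1] N1[OF that order_refl] by simp
  have "cmod (a i) \<le> sqrt (2 + 2 * q (F N1))" for i
  proof (rule tendsto_upperbound[OF tendsto_norm[OF a]])
    show "\<forall>\<^sub>F n in sequentially. cmod (tcoeff (F n) i) \<le> sqrt (2 + 2 * q (F N1))"
      using eventually_ge_at_top[of N1]
      by eventually_elim (use order_trans[OF tcoeff_le_q[OF F] bd] in \<open>auto intro: real_le_rsqrt\<close>)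
  qed simp
  then obtain f where f: "hol f" "\<And>i. tcoeff f i = a i" "\<And>z. cmod z < 1 \<Longrightarrow> (\<lambda>n. a n * z ^ n) sums f z"
    by (rule hol_power_series[of a]) blast
  have main: "(\<lambda>z. F n z - f z) \<in> H \<and> q (\<lambda>z. F n z - f z) \<le> \<epsilon>"
    if N: "\<And>n k. n \<ge> N \<Longrightarrow> k \<ge> N \<Longrightarrow> q (\<lambda>z. F n z - F k z) \<le> \<epsilon>" and n: "n \<ge> N" for n N \<epsilon>
  proof -
    have "(\<lambda>z. F n z - F (k + N) z) \<in> H" for k by (intro H_diff F)
    moreover have "hol (\<lambda>z. F n z - f z)" by (intro holomorphic_intros f H_hol F)
    moreover have "(\<lambda>k. tcoeff (\<lambda>z. F n z - F (k + N) z) i) \<longlonglongrightarrow> tcoeff (\<lambda>z. F n z - f z) i" for i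
      using tendsto_diff[OF tendsto_const LIMSEQ_ignore_initial_segment[OF a[of i], of N], of "tcoeff (F n) i"]
      by (simp add: tcoeff_diff H_hol F f)
    moreover have "q (\<lambda>z. F n z - F (k + N) z) \<le> \<epsilon>" for k by (intro N n) simp
    ultimately show ?thesis using q_lsc[of "\<lambda>k z. F n z - F (k + N) z"] by blast
  qed
  have "(\<lambda>z. F N1 z - f z) \<in> H \<and> q (\<lambda>z. F N1 z - f z) \<le> 1"
    by (rule main[of N1]) (use N1 in auto)
  from H_diff[OF F[of N1] conjunct1[OF this]] have fH: "f \<in> H" by simp
  have "(\<lambda>n. q (\<lambda>z. F n z - f z)) \<longlonglongrightarrow> 0"
  proof (rule LIMSEQ_I)
    fix r :: real assume "0 < r"
    then obtain N where N: "\<And>n k. n \<ge> N \<Longrightarrow> k \<ge> N \<Longrightarrow> q (\<lambda>z. F n z - F k z) \<le> r / 2"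
      using cauchy[of "r / 2"] by auto
    show "\<exists>no. \<forall>n\<ge>no. norm (q (\<lambda>z. F n z - f z) - 0) < r"
    proof (intro exI[of _ N] allI impI)
      fix n assume "N \<le> n"
      with main[of N "r / 2" n] N have "q (\<lambda>z. F n z - f z) \<le> r / 2" by blast
      then show "norm (q (\<lambda>z. F n z - f z) - 0) < r" using \<open>0 < r\<close> by simp
    qed
  qed
  with fH show ?thesis by (rule that)
qed

lemma q_tendsto:
  assumes F: "\<And>n. F n \<in> H" and f: "f \<in> H" and lim: "(\<lambda>n. q (\<lambda>z. F n z - f z)) \<longlonglongrightarrow> 0"
    and le: "\<And>n. q (F n) \<le> b n" and b: "b \<longlonglongrightarrow> B"
  shows "q f \<le> B"
proof (rule field_le_epsilon)
  fix e :: real assume e: "e > 0"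
  have "\<forall>\<^sub>F n in sequentially. b n < B + e" using b e by (intro order_tendstoD) auto
  then obtain N where N: "\<And>n. n \<ge> N \<Longrightarrow> b n < B + e" by (auto simp: eventually_sequentially)
  show "q f \<le> B + e"
  proof (rule q_lsc(2)[of "\<lambda>n. F (n + N)"])
    show "(\<lambda>n. tcoeff (F (n + N)) i) \<longlonglongrightarrow> tcoeff f i" for i
      by (rule LIMSEQ_ignore_initial_segment[OF tcoeff_tendsto[OF F f lim]])
    show "q (F (n + N)) \<le> B + e" for n using le[of "n + N"] N[of "n + N"] by simp
  qed (use F f in auto)
qed

text \<open>Nested midpoint-convex sets: almost minimal elements form a Cauchy sequence by the parallelogram law.\<close>

lemma nested_minimizers:
  assumes C: "\<And>n. C n \<subseteq> H" and ne: "\<And>n. C n \<noteq> {}" and dec: "\<And>n. C (Suc n) \<subseteq> C n"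
    and mid: "\<And>n u v. u \<in> C n \<Longrightarrow> v \<in> C n \<Longrightarrow> (\<lambda>z. (1/2) * (u z + v z)) \<in> C n"
    and B: "\<And>n. \<exists>u\<in>C n. q u \<le> B"
  obtains u f where "\<And>n. u n \<in> C n" "f \<in> H" "(\<lambda>n. q (\<lambda>z. u n z - f z)) \<longlonglongrightarrow> 0"
    "\<And>n. q (u n) \<le> (INF v\<in>C n. q v) + 1 / real (Suc n)"
proof -
  define d where "d n = (INF v\<in>C n. q v)" for n
  have bdd: "bdd_below (q ` C n)" for n by (rule bdd_belowI[of _ 0]) auto
  have dle: "d n \<le> q v" if "v \<in> C n" for n v unfolding d_def by (rule cINF_lower[OF bdd that])
  have "\<exists>u. u \<in> C n \<and> q u < d n + 1 / real (Suc n)" for n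
  proof -
    have "d n < d n + 1 / real (Suc n)" by simp
    then show ?thesis unfolding d_def using cINF_less_iff[OF ne bdd] by blast
  qed
  then obtain u where u: "\<And>n. u n \<in> C n" "\<And>n. q (u n) < d n + 1 / real (Suc n)" by metis
  have Cmono: "C k \<subseteq> C n" if "n \<le> k" for n k using lift_Suc_antimono_le[of C, OF dec that] .
  have dmono: "incseq d"
  proof (rule incseq_SucI)
    show "d n \<le> d (Suc n)" for n
      unfolding d_def using ne[of "Suc n"] bdd dec by (intro cINF_superset_mono) auto
  qed
  have dB: "d n \<le> B" for n using B[of n] dle by (meson order_trans)
  \<comment> \<open>The sets shrink, so the infima increase; the common bound \<open>B\<close> makes
    them converge.\<close>
  obtain L where L: "d \<longlonglongrightarrow> L" using incseq_convergent[OF dmono, of B] dB by blast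
  have dL: "d n \<le> L" for n by (rule incseq_le[OF dmono L])
  have uH: "u n \<in> H" for n using u(1) C by blast
  \<comment> \<open>The parallelogram law gives
    \<open>q (u - v) = 2 q u + 2 q v - 4 q ((u + v) / 2)\<close>, and the midpoint of two elements
    of \<open>C N\<close> has square norm at least \<open>d N\<close>.\<close>
  have key: "q (\<lambda>z. u n z - u k z) \<le> 4 * (L - d N) + 4 / real (Suc N)" if nk: "n \<ge> N" "k \<ge> N" for n k N
  proof -
    have "(\<lambda>z. (1/2) * (u n z + u k z)) \<in> C N" by (rule mid) (use u(1) Cmono nk in blast)+
    then have "d N \<le> q (\<lambda>z. (1/2) * (u n z + u k z))" by (rule dle)
    also have "\<dots> = q (\<lambda>z. u n z + u k z) / 4" by (subst q_cmult) (auto intro!: H_add uH simp: power_divide)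
    finally have 1: "4 * d N \<le> q (\<lambda>z. u n z + u k z)" by simp
    have inv: "1 / real (Suc n) \<le> 1 / real (Suc N)" "1 / real (Suc k) \<le> 1 / real (Suc N)"
      using nk by (auto intro!: divide_left_mono)
    have "q (u n) \<le> L + 1 / real (Suc N)" "q (u k) \<le> L + 1 / real (Suc N)"
      using u(2)[of n] u(2)[of k] dL[of n] dL[of k] inv by linarith+
    then show ?thesis using q_parallelogram[OF uH uH, of n k] 1 by simp
  qed
  have "\<exists>N. \<forall>n\<ge>N. \<forall>k\<ge>N. q (\<lambda>z. u n z - u k z) \<le> \<epsilon>" if "\<epsilon> > 0" for \<epsilon>
  proof -
    have "(\<lambda>N. 4 * (L - d N) + 4 * (1 / real (Suc N))) \<longlonglongrightarrow> 4 * (L - L) + 4 * 0"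
      by (intro tendsto_intros L LIMSEQ_Suc[OF lim_1_over_n])
    then have "\<forall>\<^sub>F N in sequentially. 4 * (L - d N) + 4 * (1 / real (Suc N)) < \<epsilon>"
      using that by (intro order_tendstoD) auto
    then obtain N where "4 * (L - d N) + 4 / real (Suc N) < \<epsilon>"
      by (auto simp: eventually_sequentially)
    then show ?thesis using key[of N] by (meson less_imp_le order_trans)
  qed
  from complete[OF uH this] obtain f where "f \<in> H" "(\<lambda>n. q (\<lambda>z. u n z - f z)) \<longlonglongrightarrow> 0" by blast
  with u show ?thesis by (intro that[of u f]) (auto simp: d_def less_imp_le)
qed

end

section \<open>The inner product and bounded multiplication\<close>

context circle_meas
begin

lemma inner_D_wt: "inner_D \<mu> j f g = of_real (1 / (fact j * fact (j - 1) * pi)) *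
    (LINT z:ball 0 1|lborel. (deriv ^^ j) f z * cnj ((deriv ^^ j) g z) * of_real (wt (j - 1) z))"
  by (simp add: inner_D_def wt_def)

lemma inner_D_cong:
  assumes "hol f" "\<And>z. cmod z < 1 \<Longrightarrow> f z = f' z" "hol g" "\<And>z. cmod z < 1 \<Longrightarrow> g z = g' z"
  shows "inner_D \<mu> j f g = inner_D \<mu> j f' g'"
  unfolding inner_D_wt using higher_deriv_hol_cong[OF assms(1,2)] higher_deriv_hol_cong[OF assms(3,4)]
  by (intro arg_cong2[where f = "(*)"] refl set_lebesgue_integral_cong) auto

lemma inner_D_add_left:
  assumes "hol f" "hol g" "hol h" "Dmu \<mu> j f < \<infinity>" "Dmu \<mu> j g < \<infinity>" "Dmu \<mu> j h < \<infinity>"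
  shows "inner_D \<mu> j (\<lambda>z. f z + g z) h = inner_D \<mu> j f h + inner_D \<mu> j g h"
proof -
  have i: "set_integrable lborel (ball 0 1) (\<lambda>z. (deriv ^^ j) f z * cnj ((deriv ^^ j) h z) * of_real (wt (j - 1) z))"
      "set_integrable lborel (ball 0 1) (\<lambda>z. (deriv ^^ j) g z * cnj ((deriv ^^ j) h z) * of_real (wt (j - 1) z))"
    using assms by (auto intro!: L2w_inner_integrable hol_higher_deriv simp: Dmu_finite_iff[unfolded infinity_ennreal_def])
  have "(LINT z:ball 0 1|lborel. (deriv ^^ j) (\<lambda>z. f z + g z) z * cnj ((deriv ^^ j) h z) * of_real (wt (j - 1) z))
    = (LINT z:ball 0 1|lborel. (deriv ^^ j) f z * cnj ((deriv ^^ j) h z) * of_real (wt (j - 1) z) + (deriv ^^ j) g z * cnj ((deriv ^^ j) h z) * of_real (wt (j - 1) z))"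
    by (intro set_lebesgue_integral_cong) (auto simp: higher_deriv_hol_add assms algebra_simps)
  also have "\<dots> = (LINT z:ball 0 1|lborel. (deriv ^^ j) f z * cnj ((deriv ^^ j) h z) * of_real (wt (j - 1) z)) + (LINT z:ball 0 1|lborel. (deriv ^^ j) g z * cnj ((deriv ^^ j) h z) * of_real (wt (j - 1) z))"
    by (rule set_integral_add(2)[OF i])
  finally show ?thesis by (simp add: inner_D_wt distrib_left)
qed

lemma inner_D_cmult_left:
  assumes "hol f"
  shows "inner_D \<mu> j (\<lambda>z. c * f z) h = c * inner_D \<mu> j f h"
proof -
  have "(LINT z:ball 0 1|lborel. (deriv ^^ j) (\<lambda>z. c * f z) z * cnj ((deriv ^^ j) h z) * of_real (wt (j - 1) z))
    = (LINT z:ball 0 1|lborel. c * ((deriv ^^ j) f z * cnj ((deriv ^^ j) h z) * of_real (wt (j - 1) z)))"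
    by (intro set_lebesgue_integral_cong) (auto simp: higher_deriv_hol_cmult assms algebra_simps)
  then show ?thesis by (simp add: inner_D_wt)
qed

lemma inner_D_cnj: "inner_D \<mu> j g f = cnj (inner_D \<mu> j f g)"
proof -
  have "cnj (LINT z:ball 0 1|lborel. (deriv ^^ j) f z * cnj ((deriv ^^ j) g z) * of_real (wt (j - 1) z))
    = (LINT z|lborel. cnj (indicator (ball 0 1) z *\<^sub>R ((deriv ^^ j) f z * cnj ((deriv ^^ j) g z) * of_real (wt (j - 1) z))))"
    unfolding set_lebesgue_integral_def by (rule Bochner_Integration.integral_cnj[symmetric])
  also have "\<dots> = (LINT z:ball 0 1|lborel. (deriv ^^ j) g z * cnj ((deriv ^^ j) f z) * of_real (wt (j - 1) z))"
    unfolding set_lebesgue_integral_def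
    by (intro Bochner_Integration.integral_cong refl) (simp add: scaleR_conv_of_real mult_ac)
  finally show ?thesis by (simp add: inner_D_wt)
qed

lemma inner_D_self:
  assumes "hol f" "Dmu \<mu> j f < \<infinity>"
  shows "inner_D \<mu> j f f = of_real (enn2real (Dmu \<mu> j f))"
proof -
  have "(LINT z:ball 0 1|lborel. (deriv ^^ j) f z * cnj ((deriv ^^ j) f z) * of_real (wt (j - 1) z))
    = (LINT z|lborel. of_real (indicator (ball 0 1) z * ((cmod ((deriv ^^ j) f z))\<^sup>2 * wt (j - 1) z)))"
    unfolding set_lebesgue_integral_def
    by (intro Bochner_Integration.integral_cong refl)
       (simp add: complex_norm_square[symmetric] scaleR_conv_of_real del: of_real_power)
  also have "\<dots> = of_real (LINT z|lborel. indicator (ball 0 1) z * ((cmod ((deriv ^^ j) f z))\<^sup>2 * wt (j - 1) z))"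
    by (rule integral_of_real) (use assms in \<open>auto intro!: L2w_integrable(1) hol_higher_deriv simp: Dmu_finite_iff[unfolded infinity_ennreal_def]\<close>)
  also have "\<dots> = of_real (enn2real (L2w \<mu> (j - 1) ((deriv ^^ j) f)))"
    using assms by (subst L2w_integrable(2)) (auto intro!: hol_higher_deriv simp: Dmu_finite_iff[unfolded infinity_ennreal_def])
  finally show ?thesis by (simp add: inner_D_wt Dmu_L2w enn2real_mult)
qed

end

lemma H2_inner_summable:
  assumes "f \<in> H2" "g \<in> H2"
  shows "summable (\<lambda>n. tcoeff f n * cnj (tcoeff g n))"
proof (rule summable_comparison_test')
  show "summable (\<lambda>n. (cmod (tcoeff f n))\<^sup>2 + (cmod (tcoeff g n))\<^sup>2)"
    using assms by (intro summable_add) (auto simp: H2_def)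
  show "norm (tcoeff f n * cnj (tcoeff g n)) \<le> (cmod (tcoeff f n))\<^sup>2 + (cmod (tcoeff g n))\<^sup>2" for n
    using sum_squares_bound[of "cmod (tcoeff f n)" "cmod (tcoeff g n)"]
      mult_nonneg_nonneg[OF norm_ge_zero norm_ge_zero, of "tcoeff f n" "tcoeff g n"]
    unfolding norm_mult complex_mod_cnj by linarith
qed

section \<open>Hilbert space structure and bounded multiplication\<close>

context hmu
begin

abbreviation ip :: "(complex \<Rightarrow> complex) \<Rightarrow> (complex \<Rightarrow> complex) \<Rightarrow> complex" where
  "ip \<equiv> inner_mu m \<mu>s"

lemma H_H2: "f \<in> H \<Longrightarrow> f \<in> H2"
  by (simp add: H_iff')

lemma H_Dmu: "\<lbrakk>f \<in> H; j \<in> {1..m}\<rbrakk> \<Longrightarrow> Dmu (\<mu>s j) j f < \<infinity>"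
  by (simp add: H_iff' Dmu_finite_iff[unfolded infinity_ennreal_def])

lemma ip_cong:
  assumes "f \<in> H" "\<And>z. cmod z < 1 \<Longrightarrow> f z = f' z" "g \<in> H" "\<And>z. cmod z < 1 \<Longrightarrow> g z = g' z"
  shows "ip f g = ip f' g'"
proof -
  have "inner_D (\<mu>s j) j f g = inner_D (\<mu>s j) j f' g'" if "j \<in> {1..m}" for j
    using circle_meas.inner_D_cong[OF circle_meas[OF that] H_hol[OF assms(1)] assms(2) H_hol[OF assms(3)] assms(4)] .
  then show ?thesis
    using tcoeff_cong[OF H_hol[OF assms(1)] assms(2)] tcoeff_cong[OF H_hol[OF assms(3)] assms(4)]
    by (simp add: inner_mu_def inner_H2_def)
qed

lemma ip_add_left:
  assumes "f \<in> H" "g \<in> H" "h \<in> H"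
  shows "ip (\<lambda>z. f z + g z) h = ip f h + ip g h"
proof -
  have "inner_D (\<mu>s j) j (\<lambda>z. f z + g z) h = inner_D (\<mu>s j) j f h + inner_D (\<mu>s j) j g h" if "j \<in> {1..m}" for j
    using that by (intro circle_meas.inner_D_add_left circle_meas H_hol H_Dmu assms)
  moreover have "inner_H2 (\<lambda>z. f z + g z) h = inner_H2 f h + inner_H2 g h"
    unfolding inner_H2_def
    by (subst suminf_add) (simp_all add: H2_inner_summable H_H2 assms tcoeff_add H_hol distrib_right)
  ultimately show ?thesis by (simp add: inner_mu_def sum.distrib)
qed

lemma ip_cmult_left:
  assumes "f \<in> H" "h \<in> H"
  shows "ip (\<lambda>z. c * f z) h = c * ip f h"
proof -
  have "inner_D (\<mu>s j) j (\<lambda>z. c * f z) h = c * inner_D (\<mu>s j) j f h" if "j \<in> {1..m}" for j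
    using that by (intro circle_meas.inner_D_cmult_left circle_meas H_hol assms)
  moreover have "inner_H2 (\<lambda>z. c * f z) h = c * inner_H2 f h"
    unfolding inner_H2_def
    by (subst suminf_mult[symmetric]) (simp_all add: H2_inner_summable H_H2 assms tcoeff_cmult H_hol mult.assoc)
  ultimately show ?thesis by (simp add: inner_mu_def sum_distrib_left distrib_left)
qed

lemma ip_cnj:
  assumes "f \<in> H" "g \<in> H"
  shows "ip g f = cnj (ip f g)"
proof -
  have "inner_D (\<mu>s j) j g f = cnj (inner_D (\<mu>s j) j f g)" if "j \<in> {1..m}" for j
    using that by (intro circle_meas.inner_D_cnj circle_meas)
  moreover have "inner_H2 g f = cnj (inner_H2 f g)"
  proof -
    have "(\<lambda>n. tcoeff f n * cnj (tcoeff g n)) sums inner_H2 f g"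
      unfolding inner_H2_def by (intro summable_sums H2_inner_summable H_H2 assms)
    then have "(\<lambda>n. cnj (tcoeff f n * cnj (tcoeff g n))) sums cnj (inner_H2 f g)"
      by (simp only: sums_cnj)
    then show ?thesis by (simp add: inner_H2_def sums_iff mult.commute)
  qed
  ultimately show ?thesis by (simp add: inner_mu_def)
qed

text \<open>Links the extended square norm to the inner product, so that norm convergence and
  orthogonality can be handled through \<open>q\<close>.\<close>

lemma ip_self:
  assumes "f \<in> H"
  shows "ip f f = of_real (q f)"
proof -
  have 1: "inner_D (\<mu>s j) j f f = of_real (enn2real (Dmu (\<mu>s j) j f))" if "j \<in> {1..m}" for j
    using that by (intro circle_meas.inner_D_self circle_meas H_hol H_Dmu assms)
  have s: "summable (\<lambda>n. (cmod (tcoeff f n))\<^sup>2)" using H_H2[OF assms] by (simp add: H2_def)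
  have 2: "inner_H2 f f = of_real (\<Sum>n. (cmod (tcoeff f n))\<^sup>2)"
    unfolding inner_H2_def complex_norm_square[symmetric] by (rule suminf_of_real[OF s, symmetric])
  have "Q f = ennreal (\<Sum>n. (cmod (tcoeff f n))\<^sup>2) + (\<Sum>j=1..m. Dmu (\<mu>s j) j f)"
    unfolding Q_def by (subst suminf_ennreal2[OF _ s]) auto
  also have "(\<Sum>j=1..m. Dmu (\<mu>s j) j f) = (\<Sum>j=1..m. ennreal (enn2real (Dmu (\<mu>s j) j f)))"
    using H_Dmu[OF assms] by (intro sum.cong) auto
  also have "\<dots> = ennreal (\<Sum>j=1..m. enn2real (Dmu (\<mu>s j) j f))"
    by (rule sum_ennreal) simp
  finally have Qf: "Q f = ennreal ((\<Sum>n. (cmod (tcoeff f n))\<^sup>2) + (\<Sum>j=1..m. enn2real (Dmu (\<mu>s j) j f)))"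
    using suminf_nonneg[OF s] by (simp add: sum_nonneg)
  have "q f = (\<Sum>n. (cmod (tcoeff f n))\<^sup>2) + (\<Sum>j=1..m. enn2real (Dmu (\<mu>s j) j f))"
    unfolding q_def Qf by (rule enn2real_ennreal) (intro add_nonneg_nonneg sum_nonneg suminf_nonneg s; simp)
  then show ?thesis by (simp add: inner_mu_def 1 2)
qed

lemma norm_mu_q: "f \<in> H \<Longrightarrow> norm_mu m \<mu>s f = sqrt (q f)"
  by (simp add: norm_mu_def ip_self)

lemma q_add_ip:
  assumes "f \<in> H" "g \<in> H"
  shows "q (\<lambda>z. f z + g z) = q f + 2 * Re (ip f g) + q g"
proof -
  have fg: "(\<lambda>z. f z + g z) \<in> H" using assms by (rule H_add)
  have r: "ip h (\<lambda>z. f z + g z) = ip h f + ip h g" if "h \<in> H" for h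
    using ip_cnj[OF fg that] ip_cnj[OF assms(1) that] ip_cnj[OF assms(2) that] ip_add_left[OF assms that] by simp
  have "of_real (q (\<lambda>z. f z + g z)) = ip f f + ip f g + (ip g f + ip g g)"
    unfolding ip_self[OF fg, symmetric] ip_add_left[OF assms fg] using assms by (simp add: r)
  also have "\<dots> = of_real (q f + 2 * Re (ip f g) + q g)"
    using assms by (simp add: ip_self ip_cnj[of f g] complex_eq_iff)
  finally show ?thesis by (simp only: of_real_eq_iff)
qed

text \<open>First variation along \<open>c = - s * ip k x\<close>: the linear term
  \<open>- 2 s |ip k x|^2\<close> outweighs the quadratic one for small \<open>s\<close>.\<close>

lemma ip_eq_0_if_minimal:
  assumes k: "k \<in> H" and x: "x \<in> H" and min: "\<And>c. q k \<le> q (\<lambda>z. k z + c * x z)"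
  shows "ip k x = 0"
proof (rule ccontr)
  assume ne: "ip k x \<noteq> 0"
  define a where "a = ip k x"
  \<comment> \<open>The optimal step would be \<open>1 / q x\<close>; adding 1 covers
    \<open>q x = 0\<close> and gives \<open>s * q x < 1\<close>.\<close>
  define s where "s = 1 / (q x + 1)"
  have s: "s > 0" using q_nonneg[of x] by (simp add: s_def add_nonneg_pos)
  have "0 < q x + 1" using q_nonneg[of x] by (simp add: add_nonneg_pos)
  then have sq: "s * q x < 1" by (simp add: s_def)
  define c where "c = - of_real s * a"
  have cx: "(\<lambda>z. c * x z) \<in> H" by (rule H_cmult[OF x])
  have "ip k (\<lambda>z. c * x z) = cnj c * a"
    using ip_cnj[OF cx k] ip_cmult_left[OF x k, of c] ip_cnj[OF x k] by (simp add: a_def)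
  also have "\<dots> = of_real (- s * (cmod a)\<^sup>2)"
    using complex_norm_square[of a] by (simp add: c_def mult_ac)
  finally have "q (\<lambda>z. k z + c * x z) = q k - 2 * s * (cmod a)\<^sup>2 + (cmod c)\<^sup>2 * q x"
    using q_add_ip[OF k cx] q_cmult[OF x, of c] by simp
  with min[of c] have "2 * s * (cmod a)\<^sup>2 \<le> (cmod c)\<^sup>2 * q x" by simp
  also have "\<dots> = s * (cmod a)\<^sup>2 * (s * q x)"
    using s by (simp add: c_def norm_mult power_mult_distrib power2_eq_square mult_ac)
  also have "\<dots> \<le> s * (cmod a)\<^sup>2 * 1" using s sq by (intro mult_left_mono) auto
  finally show False using s ne by (simp add: a_def)
qed

lemma q_midpoint: "\<lbrakk>u \<in> H; v \<in> H; q u \<le> B; q v \<le> B\<rbrakk> \<Longrightarrow> q (\<lambda>z. (1/2) * (u z + v z)) \<le> B"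
proof -
  assume uv: "u \<in> H" "v \<in> H" and B: "q u \<le> B" "q v \<le> B"
  have "q (\<lambda>z. (1/2) * (u z + v z)) = q (\<lambda>z. u z + v z) / 4"
    using q_cmult[OF H_add[OF uv], of "1/2"] by (simp add: power_divide)
  then show "q (\<lambda>z. (1/2) * (u z + v z)) \<le> B"
    using q_parallelogram[OF uv] q_nonneg[of "\<lambda>z. u z - v z"] B by linarith
qed

text \<open>A Baire category argument for the sets where \<open>q (T b) > n\<close>. They are open
  because \<open>q (T b)\<close> is lower semicontinuous in \<open>b\<close>, each coefficient of a
  product being a finite sum of products of coefficients, and dense if \<open>T\<close> is
  unbounded. A nested sequence of balls then has a common point at which \<open>q (T f)\<close>
  exceeds every integer.\<close>

lemma multiplication_bounded:
  assumes alg: "\<And>f g. f \<in> H \<Longrightarrow> g \<in> H \<Longrightarrow> (\<lambda>z. f z * g z) \<in> H" and g: "g \<in> H"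
  obtains C where "0 \<le> C" "\<And>\<phi>. \<phi> \<in> H \<Longrightarrow> q (\<lambda>z. \<phi> z * g z) \<le> C * q \<phi>"
proof -
  define T where "T \<phi> = (\<lambda>z. \<phi> z * g z)" for \<phi>
  have TH: "T \<phi> \<in> H" if "\<phi> \<in> H" for \<phi> unfolding T_def by (rule alg[OF that g])
  have "\<exists>C. \<forall>\<phi>\<in>H. q (T \<phi>) \<le> C * q \<phi>"
  proof (rule ccontr)
    assume "\<not> ?thesis"
    then have unb: "\<exists>\<phi>\<in>H. q (T \<phi>) > C * q \<phi>" for C by (meson not_le)
    \<comment> \<open>Density: a multiple \<open>x\<close> of some \<open>\<phi>\<close> has
      \<open>q x = \<rho>\<close> and \<open>q (T x) > n\<close>; by the parallelogram law one of
      \<open>a + x\<close> and \<open>a - x\<close> has a large image, whatever \<open>T a\<close>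
      is.\<close>
    have far: "\<exists>b\<in>H. q (\<lambda>z. b z - a z) \<le> \<rho> \<and> q (T b) > real n" if a: "a \<in> H" and \<rho>: "\<rho> > 0" for a \<rho> n
    proof -
      obtain \<phi> where \<phi>: "\<phi> \<in> H" "q (T \<phi>) > real n / \<rho> * q \<phi>" using unb by blast
      have q\<phi>: "q \<phi> > 0"
      proof (rule ccontr)
        assume "\<not> q \<phi> > 0"
        then have 0: "q \<phi> = 0" using q_nonneg[of \<phi>] by linarith
        have "q (T \<phi>) = q (\<lambda>z. 0 * \<phi> z)"
          by (rule H_cong(2)[OF TH[OF \<phi>(1)]]) (use q_eq_0D[OF \<phi>(1) 0] in \<open>auto simp: T_def\<close>)
        then show False using \<phi>(2) 0 q_cmult[OF \<phi>(1), of 0] by simp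
      qed
      define c where "c = sqrt (\<rho> / q \<phi>)"
      have c2: "c\<^sup>2 = \<rho> / q \<phi>" using \<rho> q\<phi> by (simp add: c_def)
      define x where "x = (\<lambda>z. of_real c * \<phi> z)"
      have xH: "x \<in> H" unfolding x_def by (rule H_cmult[OF \<phi>(1)])
      have qx: "q x = \<rho>" unfolding x_def using q\<phi> by (simp add: q_cmult \<phi>(1) c2)
      have "T x = (\<lambda>z. of_real c * T \<phi> z)" by (simp add: T_def x_def mult.assoc)
      then have "q (T x) = \<rho> / q \<phi> * q (T \<phi>)" by (simp add: q_cmult TH \<phi>(1) c2)
      moreover have "\<rho> / q \<phi> * q (T \<phi>) > \<rho> / q \<phi> * (real n / \<rho> * q \<phi>)"
        using \<phi>(2) \<rho> q\<phi> by (intro mult_strict_left_mono) auto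
      ultimately have qTx: "q (T x) > real n" using \<rho> q\<phi> by simp
      have Tp: "(\<lambda>z. T a z + T x z) = T (\<lambda>z. a z + x z)" "(\<lambda>z. T a z - T x z) = T (\<lambda>z. a z - x z)"
        by (auto simp: T_def algebra_simps)
      have "q (T (\<lambda>z. a z + x z)) + q (T (\<lambda>z. a z - x z)) = 2 * q (T a) + 2 * q (T x)"
        using q_parallelogram[OF TH[OF a] TH[OF xH]] by (simp only: Tp)
      then have "q (T (\<lambda>z. a z + x z)) > real n \<or> q (T (\<lambda>z. a z - x z)) > real n"
        using qTx q_nonneg[of "T a"] by linarith
      moreover have "q (\<lambda>z. (a z + x z) - a z) \<le> \<rho>" using qx by simp
      moreover have "q (\<lambda>z. (a z - x z) - a z) \<le> \<rho>" using qx q_cmult[OF xH, of "-1"] by simp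
      ultimately show ?thesis
      proof (elim disjE, goal_cases)
        case 1
        then show ?case by (intro bexI[OF _ H_add[OF a xH]] conjI) auto
      next
        case 2
        then show ?case by (intro bexI[OF _ H_diff[OF a xH]] conjI) auto
      qed
    qed
    \<comment> \<open>Openness: a sequence violating it would converge to \<open>b\<close>, and
      semicontinuity would give \<open>q (T b) \<le> n\<close>.\<close>
    have opn: "\<exists>\<rho>>0. \<forall>y\<in>H. q (\<lambda>z. y z - b z) \<le> \<rho> \<longrightarrow> q (T y) > real n" if b: "b \<in> H" "q (T b) > real n" for b n
    proof (rule ccontr)
      assume "\<not> ?thesis"
      then have "\<exists>y\<in>H. q (\<lambda>z. y z - b z) \<le> 1 / real (Suc k) \<and> q (T y) \<le> real n" for k
        by (metis not_le of_nat_0_less_iff zero_less_Suc zero_less_divide_1_iff)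
      then obtain y where y: "\<And>k. y k \<in> H" "\<And>k. q (\<lambda>z. y k z - b z) \<le> 1 / real (Suc k)" "\<And>k. q (T (y k)) \<le> real n"
        by metis
      have "(\<lambda>k. q (\<lambda>z. y k z - b z)) \<longlonglongrightarrow> 0"
        by (rule tendsto_sandwich[OF _ _ tendsto_const LIMSEQ_Suc[OF lim_1_over_n]])
           (use y(2) in \<open>auto intro!: always_eventually\<close>)
      note lim = tendsto_mult[OF tcoeff_tendsto[OF y(1) b(1) this] tendsto_const]
      have "q (T b) \<le> real n"
      proof (rule q_lsc(2)[of "\<lambda>k. T (y k)"])
        show "(\<lambda>k. tcoeff (T (y k)) i) \<longlonglongrightarrow> tcoeff (T b) i" for i
          unfolding T_def using y(1) b(1) g by (simp add: tcoeff_mult H_hol) (intro tendsto_sum lim)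
      qed (use y TH b in auto)
      with b(2) show False by simp
    qed
    \<comment> \<open>The pair \<open>p\<close> is the centre and the squared radius of a ball
      contained in the \<open>k\<close>-th set.\<close>
    define P where "P k p \<longleftrightarrow> fst p \<in> H \<and> snd p > 0 \<and> (\<forall>y\<in>H. q (\<lambda>z. y z - fst p z) \<le> snd p \<longrightarrow> q (T y) > real k)"
      for k and p :: "(complex \<Rightarrow> complex) \<times> real"
    \<comment> \<open>Squared norms obey the triangle inequality only up to a factor 2. The ratio
      1/16 keeps all later centres within \<open>\<rho> k / 4\<close> of \<open>a k\<close>, so that
      the limit is within \<open>2 * \<rho> k / 4 + 2 * \<rho> k / 4 = \<rho> k\<close>.\<close>
    have ex: "\<exists>p'. P k p' \<and> q (\<lambda>z. fst p' z - fst p z) \<le> snd p / 16 \<and> snd p' \<le> snd p / 16"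
      if p: "fst p \<in> H" "snd p > 0" for k p
    proof -
      obtain b where b: "b \<in> H" "q (\<lambda>z. b z - fst p z) \<le> snd p / 16" "q (T b) > real k"
        using far[OF p(1), of "snd p / 16" k] p(2) by auto
      obtain \<rho> where \<rho>: "\<rho> > 0" "\<And>y. y \<in> H \<Longrightarrow> q (\<lambda>z. y z - b z) \<le> \<rho> \<Longrightarrow> q (T y) > real k"
        using opn[OF b(1,3)] by blast
      show ?thesis
        by (rule exI[of _ "(b, min \<rho> (snd p / 16))"]) (use b \<rho> p(2) in \<open>auto simp: P_def\<close>)
    qed
    have "\<exists>s. \<forall>k. P k (s k) \<and> (q (\<lambda>z. fst (s (Suc k)) z - fst (s k) z) \<le> snd (s k) / 16 \<and> snd (s (Suc k)) \<le> snd (s k) / 16)"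
    proof (rule dependent_nat_choice)
      show "\<exists>x. P 0 x" using ex[of "(\<lambda>_. 0, 1)" 0] zero_H by auto
      show "\<exists>y. P (Suc n) y \<and> (q (\<lambda>z. fst y z - fst x z) \<le> snd x / 16 \<and> snd y \<le> snd x / 16)" if "P n x" for x n
        using ex[of x "Suc n"] that by (auto simp: P_def)
    qed
    then obtain s where s: "\<And>k. P k (s k)" "\<And>k. q (\<lambda>z. fst (s (Suc k)) z - fst (s k) z) \<le> snd (s k) / 16"
        "\<And>k. snd (s (Suc k)) \<le> snd (s k) / 16" by blast
    define a \<rho> where "a k = fst (s k)" and "\<rho> k = snd (s k)" for k
    have aH: "a k \<in> H" and \<rho>0: "\<rho> k > 0" and big: "\<And>y. y \<in> H \<Longrightarrow> q (\<lambda>z. y z - a k z) \<le> \<rho> k \<Longrightarrow> q (T y) > real k" for k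
      using s(1)[of k] by (auto simp: P_def a_def \<rho>_def)
    have step: "q (\<lambda>z. a (Suc k) z - a k z) \<le> \<rho> k / 16" "\<rho> (Suc k) \<le> \<rho> k / 16" for k
      using s(2,3)[of k] by (auto simp: a_def \<rho>_def)
    have tri: "q (\<lambda>z. x z - w z) \<le> 2 * q (\<lambda>z. x z - y z) + 2 * q (\<lambda>z. y z - w z)" if "x \<in> H" "y \<in> H" "w \<in> H" for x y w
      using q_add_le[OF H_diff[OF that(1,2)] H_diff[OF that(2,3)]] by simp
    have near: "q (\<lambda>z. a (k + n) z - a k z) \<le> \<rho> k / 4" for n k
    proof (induction n arbitrary: k)
      case 0
      then show ?case using \<rho>0[of k] q_cmult[OF aH, of 0 k] by simp
    next
      case (Suc n)
      have "q (\<lambda>z. a (Suc k + n) z - a k z) \<le> 2 * q (\<lambda>z. a (Suc k + n) z - a (Suc k) z) + 2 * q (\<lambda>z. a (Suc k) z - a k z)"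
        by (rule tri) (rule aH)+
      then show ?case using Suc.IH[of "Suc k"] step[of k] \<rho>0[of k] by simp
    qed
    have \<rho>le: "\<rho> k \<le> \<rho> 0 * (1 / 16) ^ k" for k
    proof (induction k)
      case (Suc k)
      then show ?case using step(2)[of k] by simp
    qed simp
    have "(\<lambda>k. \<rho> 0 * (1 / 16) ^ k) \<longlonglongrightarrow> \<rho> 0 * 0" by (intro tendsto_intros LIMSEQ_power_zero) simp
    then have \<rho>lim: "(\<lambda>k. \<rho> 0 * (1 / 16) ^ k) \<longlonglongrightarrow> 0" by simp
    have cau: "\<exists>N. \<forall>n\<ge>N. \<forall>k\<ge>N. q (\<lambda>z. a n z - a k z) \<le> \<epsilon>" if "\<epsilon> > 0" for \<epsilon>
    proof -
      have "\<forall>\<^sub>F k in sequentially. \<rho> 0 * (1 / 16) ^ k < \<epsilon>" using order_tendstoD(2)[OF \<rho>lim that] .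
      then obtain N where N: "\<rho> 0 * (1 / 16) ^ N < \<epsilon>" by (auto simp: eventually_sequentially)
      have "q (\<lambda>z. a n z - a k z) \<le> \<epsilon>" if "n \<ge> N" "k \<ge> N" for n k
      proof -
        have "q (\<lambda>z. a n z - a k z) \<le> 2 * q (\<lambda>z. a n z - a N z) + 2 * q (\<lambda>z. a N z - a k z)"
          by (rule tri) (rule aH)+
        moreover have "q (\<lambda>z. a n z - a N z) \<le> \<rho> N / 4" using near[of N "n - N"] that by simp
        moreover have "q (\<lambda>z. a N z - a k z) \<le> \<rho> N / 4" using near[of N "k - N"] that q_minus_commute[OF aH[of N] aH[of k]] by simp
        ultimately show ?thesis using \<rho>le[of N] N by linarith
      qed
      then show ?thesis by blast
    qed
    obtain f where f: "f \<in> H" "(\<lambda>n. q (\<lambda>z. a n z - f z)) \<longlonglongrightarrow> 0"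
      using complete[of a, OF aH cau] by blast
    have "q (T f) > real k" for k
    proof (rule big[OF f(1)])
      have "\<forall>\<^sub>F n in sequentially. q (\<lambda>z. a n z - f z) < \<rho> k / 4" using order_tendstoD(2)[OF f(2), of "\<rho> k / 4"] \<rho>0[of k] by simp
      then obtain N where N: "\<And>n. n \<ge> N \<Longrightarrow> q (\<lambda>z. a n z - f z) < \<rho> k / 4" by (auto simp: eventually_sequentially)
      have "q (\<lambda>z. f z - a k z) \<le> 2 * q (\<lambda>z. f z - a (k + N) z) + 2 * q (\<lambda>z. a (k + N) z - a k z)"
        by (rule tri) (rule f aH)+
      then show "q (\<lambda>z. f z - a k z) \<le> \<rho> k"
        using N[of "k + N"] near[of k N] q_minus_commute[OF f(1) aH, of "k + N"] by simp
    qed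
    then show False using reals_Archimedean2 by (meson less_asym)
  qed
  then obtain C where C: "\<And>\<phi>. \<phi> \<in> H \<Longrightarrow> q (T \<phi>) \<le> C * q \<phi>" by blast
  show ?thesis
  proof (rule that[of "max C 0"])
    fix \<phi> assume "\<phi> \<in> H"
    from C[OF this] have "q (T \<phi>) \<le> C * q \<phi>" .
    also have "\<dots> \<le> max C 0 * q \<phi>" by (intro mult_right_mono) auto
    finally show "q (\<lambda>z. \<phi> z * g z) \<le> max C 0 * q \<phi>" by (simp add: T_def)
  qed simp
qed

end

section \<open>Invariant subspaces are ideals\<close>

lemma hol_dilate:
  assumes "hol F" "0 \<le> r" "r \<le> 1"
  shows "hol (\<lambda>z. F (of_real r * z))"
proof -
  have "(\<lambda>z. of_real r * z) ` ball 0 1 \<subseteq> ball (0::complex) 1"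
  proof (rule image_subsetI)
    fix z :: complex assume "z \<in> ball 0 1"
    moreover have "r * cmod z \<le> 1 * cmod z" using assms by (intro mult_right_mono) auto
    ultimately show "of_real r * z \<in> ball 0 1" using assms by (simp add: norm_mult)
  qed
  then show ?thesis
    using holomorphic_on_compose_gen[of "\<lambda>z. of_real r * z" "ball 0 1" F "ball 0 1"] assms
    by (auto simp: o_def intro!: holomorphic_intros)
qed

lemma higher_deriv_dilate:
  assumes "hol F" "0 \<le> r" "r \<le> 1" "cmod z < 1"
  shows "(deriv ^^ n) (\<lambda>z. F (of_real r * z)) z = of_real r ^ n * (deriv ^^ n) F (of_real r * z)"
proof (rule higher_deriv_compose_linear[of F "ball 0 1" "ball 0 1"])
  fix w :: complex assume "w \<in> ball 0 1"
  moreover have "r * cmod w \<le> 1 * cmod w" using assms by (intro mult_right_mono) auto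
  ultimately show "of_real r * w \<in> ball 0 1" using assms by (simp add: norm_mult)
qed (use assms in auto)

lemma tcoeff_dilate:
  assumes "hol F" "0 \<le> r" "r \<le> 1"
  shows "tcoeff (\<lambda>z. F (of_real r * z)) n = of_real r ^ n * tcoeff F n"
  using higher_deriv_dilate[OF assms, of 0 n] by (simp add: tcoeff_def)

lemma tcoeff_poly:
  fixes a :: "nat \<Rightarrow> complex"
  shows "tcoeff (\<lambda>z. \<Sum>i<n. a i * z ^ i) k = (if k < n then a k else 0)"
proof -
  have "(\<lambda>z. \<Sum>i<n. a i * z ^ i) has_fps_expansion Abs_fps (\<lambda>i. if i < n then a i else 0)"
  proof (rule has_fps_expansionI, rule always_eventually, rule allI)
    fix u
    have "(\<lambda>i. if i \<in> {..<n} then a i * u ^ i else 0) sums (\<Sum>i<n. a i * u ^ i)"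
      by (rule sums_If_finite_set) simp
    then show "(\<lambda>i. fps_nth (Abs_fps (\<lambda>i. if i < n then a i else 0)) i * u ^ i) sums (\<Sum>i<n. a i * u ^ i)"
      by (simp add: if_distrib[of "\<lambda>x. x * _"] cong: if_cong)
  qed
  from fps_nth_fps_expansion[OF this, of k] show ?thesis by (simp add: tcoeff_def)
qed

context hmu
begin

text \<open>Cauchy's estimates: radius \<open>1 + \<delta>\<close> at the origin for the
  coefficients, radius \<open>\<delta>\<close> at points of the unit disc for the derivatives. The
  bound is common to all such \<open>F\<close>, as needed for a whole sequence of Taylor
  polynomials.\<close>

lemma Q_le_of_bounded_on_larger_disc:
  assumes R: "R > 1"
  obtains K where "\<And>F. F holomorphic_on ball 0 R \<Longrightarrow> (\<And>z. z \<in> ball 0 R \<Longrightarrow> cmod (F z) \<le> B) \<Longrightarrow> Q F \<le> ennreal K"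
proof -
  define \<delta> where "\<delta> = (R - 1) / 2"
  have \<delta>: "\<delta> > 0" "1 + \<delta> < R" using R by (simp_all add: \<delta>_def field_simps)
  define x where "x = (1 / (1 + \<delta>))\<^sup>2"
  have x: "0 \<le> x" "x < 1" using \<delta> by (auto simp: x_def power_divide)
  define E where "E = ennreal (B\<^sup>2 / (1 - x)) + (\<Sum>j=1..m. ennreal (1 / (fact j * fact (j - 1) * pi)) *
     (ennreal ((fact j * B / \<delta> ^ j)\<^sup>2) * (\<integral>\<^sup>+v\<in>ball 0 1. ennreal (Poisson (\<mu>s j) v) \<partial>lborel)))"
  have Efin: "E < \<infinity>"
    using circle_meas.nn_integral_Poisson_finite[OF circle_meas]
    by (auto simp: E_def ennreal_mult_less_top)
  have main: "Q F \<le> E" if F: "F holomorphic_on ball 0 R" and B: "\<And>z. z \<in> ball 0 R \<Longrightarrow> cmod (F z) \<le> B" for F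
  proof -
    have bd: "cmod ((deriv ^^ n) F \<xi>) \<le> fact n * B / s ^ n" if s: "0 < s" "cmod \<xi> + s < R" for n \<xi> s
    proof (rule Cauchy_inequality)
      have sub: "cball \<xi> s \<subseteq> ball 0 R"
      proof
        fix w assume "w \<in> cball \<xi> s"
        then have "cmod (w - \<xi>) \<le> s" by (simp add: dist_norm norm_minus_commute)
        then show "w \<in> ball 0 R" using norm_triangle_sub[of w \<xi>] s by simp
      qed
      show "F holomorphic_on ball \<xi> s" using sub by (intro holomorphic_on_subset[OF F]) auto
      show "continuous_on (cball \<xi> s) F" using sub by (intro holomorphic_on_imp_continuous_on holomorphic_on_subset[OF F])
      fix w assume "cmod (\<xi> - w) = s"
      then have "w \<in> cball \<xi> s" by (simp add: dist_norm)
      then show "cmod (F w) \<le> B" using sub B by blast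
    qed (use s in auto)
    have "(\<Sum>n. ennreal ((cmod (tcoeff F n))\<^sup>2)) \<le> (\<Sum>n. ennreal (B\<^sup>2 * x ^ n))"
    proof (rule suminf_le[OF _ summableI summableI])
      fix n
      have "cmod ((deriv ^^ n) F 0) \<le> fact n * B / (1 + \<delta>) ^ n" using \<delta> by (intro bd) auto
      then have "cmod (tcoeff F n) \<le> B / (1 + \<delta>) ^ n"
        by (simp add: tcoeff_def norm_divide divide_le_eq mult.commute)
      then have "(cmod (tcoeff F n))\<^sup>2 \<le> (B / (1 + \<delta>) ^ n)\<^sup>2" by (intro power_mono) auto
      also have "\<dots> = B\<^sup>2 * x ^ n" by (simp add: x_def power_divide power_mult[symmetric] mult.commute)
      finally show "ennreal ((cmod (tcoeff F n))\<^sup>2) \<le> ennreal (B\<^sup>2 * x ^ n)" by (rule ennreal_leI)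
    qed
    also have "\<dots> = ennreal (B\<^sup>2 / (1 - x))"
    proof (rule suminf_ennreal_eq)
      show "(\<lambda>n. B\<^sup>2 * x ^ n) sums (B\<^sup>2 / (1 - x))"
        using sums_mult[OF geometric_sums[of x], of "B\<^sup>2"] x by simp
    qed (use x in auto)
    finally have 1: "(\<Sum>n. ennreal ((cmod (tcoeff F n))\<^sup>2)) \<le> ennreal (B\<^sup>2 / (1 - x))" .
    have "(\<Sum>j=1..m. Dmu (\<mu>s j) j F) \<le> (\<Sum>j=1..m. ennreal (1 / (fact j * fact (j - 1) * pi)) *
       (ennreal ((fact j * B / \<delta> ^ j)\<^sup>2) * (\<integral>\<^sup>+v\<in>ball 0 1. ennreal (Poisson (\<mu>s j) v) \<partial>lborel)))"
      unfolding Dmu_L2w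
    proof (intro sum_mono mult_left_mono)
      fix j assume j: "j \<in> {1..m}"
      show "L2w (\<mu>s j) (j - 1) ((deriv ^^ j) F) \<le> ennreal ((fact j * B / \<delta> ^ j)\<^sup>2) * (\<integral>\<^sup>+v\<in>ball 0 1. ennreal (Poisson (\<mu>s j) v) \<partial>lborel)"
        using \<delta> by (intro circle_meas.L2w_bounded circle_meas j bd) auto
    qed simp
    then show ?thesis unfolding Q_def E_def by (rule add_mono[OF 1])
  qed
  have "Q F \<le> ennreal (enn2real E)" if "F holomorphic_on ball 0 R" "\<And>z. z \<in> ball 0 R \<Longrightarrow> cmod (F z) \<le> B" for F
    using main[OF that] Efin by simp
  then show ?thesis using that by blast
qed

lemma Q_dilate:
  assumes F: "hol F" and r: "0 \<le> r" "r \<le> 1"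
  shows "Q (\<lambda>z. F (of_real r * z)) \<le> ennreal (25920 * 4 ^ m) * Q F"
proof -
  have "25920 * 4 ^ m \<ge> (1 :: real)" by (metis mult_mono' one_le_numeral one_le_power mult_1 zero_le_one)
  then have one: "1 \<le> ennreal (25920 * 4 ^ m)" by (simp add: ennreal_leI flip: ennreal_1)
  have "(\<Sum>n. ennreal ((cmod (tcoeff (\<lambda>z. F (of_real r * z)) n))\<^sup>2)) \<le> (\<Sum>n. ennreal ((cmod (tcoeff F n))\<^sup>2))"
  proof (rule suminf_le[OF _ summableI summableI])
    fix n
    have "cmod (tcoeff (\<lambda>z. F (of_real r * z)) n) \<le> cmod (tcoeff F n)"
      using r by (simp add: tcoeff_dilate[OF F r] norm_mult norm_power mult_left_le_one_le power_le_one)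
    then show "ennreal ((cmod (tcoeff (\<lambda>z. F (of_real r * z)) n))\<^sup>2) \<le> ennreal ((cmod (tcoeff F n))\<^sup>2)"
      by (intro ennreal_leI power_mono) auto
  qed
  also have "\<dots> \<le> ennreal (25920 * 4 ^ m) * (\<Sum>n. ennreal ((cmod (tcoeff F n))\<^sup>2))"
    using mult_right_mono[OF one, of "\<Sum>n. ennreal ((cmod (tcoeff F n))\<^sup>2)"] by (simp del: suminf_ennreal)
  finally have 1: "(\<Sum>n. ennreal ((cmod (tcoeff (\<lambda>z. F (of_real r * z)) n))\<^sup>2)) \<le> ennreal (25920 * 4 ^ m) * (\<Sum>n. ennreal ((cmod (tcoeff F n))\<^sup>2))" .
  have 2: "(\<Sum>j=1..m. Dmu (\<mu>s j) j (\<lambda>z. F (of_real r * z))) \<le> ennreal (25920 * 4 ^ m) * (\<Sum>j=1..m. Dmu (\<mu>s j) j F)"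
    unfolding sum_distrib_left
  proof (rule sum_mono)
    fix j assume j: "j \<in> {1..m}"
    interpret circle_meas "\<mu>s j" by (rule circle_meas[OF j])
    let ?G = "\<lambda>z. (deriv ^^ j) F (of_real r * z)"
    have "L2w (\<mu>s j) (j - 1) ((deriv ^^ j) (\<lambda>z. F (of_real r * z))) = L2w (\<mu>s j) (j - 1) (\<lambda>z. of_real r ^ j * ?G z)"
      by (rule L2w_cong) (rule higher_deriv_dilate[OF F r])
    also have "\<dots> = ennreal ((cmod (of_real r ^ j))\<^sup>2) * L2w (\<mu>s j) (j - 1) ?G"
      by (rule L2w_cmult) (intro hol_dilate hol_higher_deriv F r)
    also have "\<dots> \<le> 1 * L2w (\<mu>s j) (j - 1) ?G"
      using r by (intro mult_right_mono) (auto simp: norm_power power_le_one simp flip: ennreal_1 intro!: ennreal_leI)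
    also have "\<dots> \<le> ennreal (25920 * 4 ^ (j - 1)) * L2w (\<mu>s j) (j - 1) ((deriv ^^ j) F)"
      using L2w_dilate[OF hol_higher_deriv[OF F] r] by simp
    also have "\<dots> \<le> ennreal (25920 * 4 ^ m) * L2w (\<mu>s j) (j - 1) ((deriv ^^ j) F)"
      using j by (intro mult_right_mono ennreal_leI) (auto intro!: power_increasing)
    finally have "ennreal (1 / (fact j * fact (j - 1) * pi)) * L2w (\<mu>s j) (j - 1) ((deriv ^^ j) (\<lambda>z. F (of_real r * z)))
      \<le> ennreal (1 / (fact j * fact (j - 1) * pi)) * (ennreal (25920 * 4 ^ m) * L2w (\<mu>s j) (j - 1) ((deriv ^^ j) F))"
      by (rule mult_left_mono) simp
    then show "Dmu (\<mu>s j) j (\<lambda>z. F (of_real r * z)) \<le> ennreal (25920 * 4 ^ m) * Dmu (\<mu>s j) j F"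
      unfolding Dmu_L2w by (simp only: mult.left_commute)
  qed
  show ?thesis unfolding Q_def distrib_left by (rule add_mono[OF 1 2])
qed

lemma q_dilate:
  assumes F: "F \<in> H" and r: "0 \<le> r" "r \<le> 1"
  shows "(\<lambda>z. F (of_real r * z)) \<in> H" "q (\<lambda>z. F (of_real r * z)) \<le> 25920 * 4 ^ m * q F"
proof -
  have le: "Q (\<lambda>z. F (of_real r * z)) \<le> ennreal (25920 * 4 ^ m * q F)"
    using Q_dilate[OF H_hol[OF F] r] F by (simp add: Q_eq_q ennreal_mult)
  then show FH: "(\<lambda>z. F (of_real r * z)) \<in> H"
    using hol_dilate[OF H_hol[OF F] r] by (auto simp: H_iff intro: order_le_less_trans)
  show "q (\<lambda>z. F (of_real r * z)) \<le> 25920 * 4 ^ m * q F"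
    using le by (subst (asm) Q_eq_q[OF FH]) (simp add: ennreal_le_iff)
qed

end

section \<open>Closed invariant subspaces\<close>

locale hmu_invariant = hmu +
  fixes M :: "(complex \<Rightarrow> complex) set"
  assumes closed_inv: "closed_z_invariant m \<mu>s M"
begin

lemma M_H: "f \<in> M \<Longrightarrow> f \<in> H"
  using closed_inv by (auto simp: closed_z_invariant_def)

lemma M_hol: "f \<in> M \<Longrightarrow> hol f"
  by (intro H_hol M_H)

lemma M_add: "\<lbrakk>f \<in> M; g \<in> M\<rbrakk> \<Longrightarrow> (\<lambda>z. f z + g z) \<in> M"
  and M_cmult: "f \<in> M \<Longrightarrow> (\<lambda>z. c * f z) \<in> M"
  and M_z: "f \<in> M \<Longrightarrow> (\<lambda>z. z * f z) \<in> M"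
  and M_zero: "(\<lambda>_. 0) \<in> M"
  using closed_inv by (auto simp: closed_z_invariant_def)

lemma M_diff: "\<lbrakk>f \<in> M; g \<in> M\<rbrakk> \<Longrightarrow> (\<lambda>z. f z - g z) \<in> M"
  using M_add[of f "\<lambda>z. (-1) * g z"] M_cmult[of g "-1"] by simp

lemma M_closed:
  assumes "\<And>n. F n \<in> M" "f \<in> H" "(\<lambda>n. q (\<lambda>z. F n z - f z)) \<longlonglongrightarrow> 0"
  shows "f \<in> M"
proof -
  have "(\<lambda>n. norm_mu m \<mu>s (\<lambda>z. F n z - f z)) \<longlonglongrightarrow> 0"
    using tendsto_real_sqrt[OF assms(3)] by (simp add: norm_mu_q H_diff M_H assms)
  moreover have "\<forall>F f. (\<forall>n. F n \<in> M) \<longrightarrow> f \<in> H \<longrightarrow> (\<lambda>n. norm_mu m \<mu>s (\<lambda>z. F n z - f z)) \<longlonglongrightarrow> 0 \<longrightarrow> f \<in> M"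
    using closed_inv unfolding closed_z_invariant_def by (elim conjE)
  ultimately show ?thesis using assms(1,2) by blast
qed

text \<open>Elements are functions on the whole plane, but only their values on the disc enter the
  norm. The constant sequence \<open>f\<close> converges to \<open>g\<close>, so closedness yields
  \<open>g\<close>.\<close>

lemma M_cong:
  assumes "f \<in> M" "\<And>z. cmod z < 1 \<Longrightarrow> f z = g z"
  shows "g \<in> M"
proof (rule M_closed[of "\<lambda>_. f"])
  show gH: "g \<in> H" by (rule H_cong(1)[OF M_H[OF assms(1)] assms(2)])
  have "q (\<lambda>z. f z - g z) = q (\<lambda>z. 0 * f z)"
    by (rule H_cong(2)) (use assms gH M_H in \<open>auto intro: H_diff\<close>)
  then show "(\<lambda>_. q (\<lambda>z. f z - g z)) \<longlonglongrightarrow> 0"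
    using q_cmult[OF M_H[OF assms(1)], of 0] by simp
qed (rule assms)

text \<open>Bounded coefficientwise convergence is weak convergence, and \<open>M\<close> is weakly closed; Mazur's argument is
  carried out with the convex sets of bounded elements of \<open>M\<close> whose first \<open>n\<close> coefficients are close to
  those of \<open>h\<close>.\<close>

lemma M_weakly_closed:
  assumes K: "\<And>n. K n \<in> M" and B: "\<And>n. q (K n) \<le> B"
    and lim: "\<And>i. (\<lambda>n. tcoeff (K n) i) \<longlonglongrightarrow> tcoeff h i" and h: "hol h"
  shows "h \<in> M"
proof -
  \<comment> \<open>All conditions survive midpoints. The number of controlled coefficients grows
    while the tolerance shrinks, which makes the sets nested.\<close>
  define C where "C n = {u \<in> M. q u \<le> B \<and> (\<forall>i\<le>n. cmod (tcoeff u i - tcoeff h i) \<le> 1 / real (Suc n))}" for n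
  have ne: "\<exists>u. u \<in> C n" for n
  proof -
    have "\<forall>\<^sub>F k in sequentially. dist (tcoeff (K k) i) (tcoeff h i) < 1 / real (Suc n)" for i
      by (rule tendstoD[OF lim]) simp
    then have "\<forall>\<^sub>F k in sequentially. \<forall>i\<in>{..n}. dist (tcoeff (K k) i) (tcoeff h i) < 1 / real (Suc n)"
      by (intro eventually_ball_finite) auto
    then obtain k where "\<forall>i\<in>{..n}. dist (tcoeff (K k) i) (tcoeff h i) < 1 / real (Suc n)"
      by (auto simp: eventually_sequentially)
    then have "K k \<in> C n" using K B by (auto simp: C_def dist_norm less_imp_le)
    then show ?thesis by blast
  qed
  obtain u f where u: "\<And>n. u n \<in> C n" and f: "f \<in> H" "(\<lambda>n. q (\<lambda>z. u n z - f z)) \<longlonglongrightarrow> 0"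
  proof (rule nested_minimizers[of C B])
    show "C n \<subseteq> H" for n using M_H by (auto simp: C_def)
    show "C n \<noteq> {}" for n using ne by auto
    show "C (Suc n) \<subseteq> C n" for n
    proof -
      have "1 / real (Suc (Suc n)) \<le> 1 / real (Suc n)" by (simp add: field_simps)
      then show ?thesis unfolding C_def by (blast intro: le_SucI order_trans)
    qed
    show "\<exists>u\<in>C n. q u \<le> B" for n using ne by (auto simp: C_def)
    fix n u v assume uv: "u \<in> C n" "v \<in> C n"
    then have M: "u \<in> M" "v \<in> M" by (auto simp: C_def)
    have "cmod (tcoeff (\<lambda>z. 1/2 * (u z + v z)) i - tcoeff h i) \<le> 1 / real (Suc n)" if "i \<le> n" for i
    proof -
      have "tcoeff (\<lambda>z. 1/2 * (u z + v z)) i = 1/2 * (tcoeff u i + tcoeff v i)"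
        using M by (simp only: tcoeff_cmult[OF M_hol[OF M_add]] tcoeff_add M_hol)
      then have "tcoeff (\<lambda>z. 1/2 * (u z + v z)) i - tcoeff h i = ((tcoeff u i - tcoeff h i) + (tcoeff v i - tcoeff h i)) / 2"
        by (simp add: field_simps)
      then have "cmod (tcoeff (\<lambda>z. 1/2 * (u z + v z)) i - tcoeff h i) = cmod ((tcoeff u i - tcoeff h i) + (tcoeff v i - tcoeff h i)) / 2"
        by (simp only: norm_divide norm_numeral)
      also have "\<dots> \<le> (cmod (tcoeff u i - tcoeff h i) + cmod (tcoeff v i - tcoeff h i)) / 2"
        by (intro divide_right_mono norm_triangle_ineq) simp
      also have "\<dots> \<le> (1 / real (Suc n) + 1 / real (Suc n)) / 2"
        using uv that by (intro divide_right_mono add_mono) (auto simp: C_def)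
      also have "\<dots> = 1 / real (Suc n)" by (simp add: field_simps)
      finally show ?thesis .
    qed
    moreover have "(\<lambda>z. 1/2 * (u z + v z)) \<in> M" by (intro M_cmult M_add M)
    moreover have "q (\<lambda>z. 1/2 * (u z + v z)) \<le> B"
      by (rule q_midpoint) (use uv in \<open>auto simp: C_def M_H\<close>)
    ultimately show "(\<lambda>z. 1/2 * (u z + v z)) \<in> C n"
      unfolding C_def by blast
  next
    fix u f
    assume "\<And>n. u n \<in> C n" "f \<in> H" "(\<lambda>n. q (\<lambda>z. u n z - f z)) \<longlonglongrightarrow> 0"
    then show thesis by (rule that)
  qed
  have uM: "u n \<in> M" for n using u by (auto simp: C_def)
  \<comment> \<open>The almost minimal elements converge in norm, so closedness in norm is
    enough.\<close>
  have fM: "f \<in> M" by (rule M_closed[OF uM f])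
  have "tcoeff f i = tcoeff h i" for i
  proof (rule LIMSEQ_unique[OF tcoeff_tendsto[OF M_H[OF uM] f]])
    have "(\<lambda>n. cmod (tcoeff (u n) i - tcoeff h i)) \<longlonglongrightarrow> 0"
    proof (rule tendsto_sandwich[OF _ _ tendsto_const LIMSEQ_Suc[OF lim_1_over_n]])
      show "\<forall>\<^sub>F n in sequentially. cmod (tcoeff (u n) i - tcoeff h i) \<le> 1 / of_nat (Suc n)"
        using eventually_ge_at_top[of i] by eventually_elim (use u in \<open>auto simp: C_def\<close>)
    qed simp
    then show "(\<lambda>n. tcoeff (u n) i) \<longlonglongrightarrow> tcoeff h i"
      by (rule LIM_zero_cancel[OF tendsto_norm_zero_cancel])
  qed
  then have "f z = h z" if "cmod z < 1" for z using hol_eqI[OF H_hol[OF f(1)] h _ that] by blast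
  then show ?thesis by (rule M_cong[OF fM])
qed

lemma M_sum: "(\<And>i. i \<in> I \<Longrightarrow> F i \<in> M) \<Longrightarrow> finite I \<Longrightarrow> (\<lambda>z. \<Sum>i\<in>I. F i z) \<in> M"
proof (induction I rule: infinite_finite_induct)
  case (insert i I)
  then show ?case using M_add[of "F i" "\<lambda>z. \<Sum>i\<in>I. F i z"] by simp
qed (auto simp: M_zero)

lemma M_power: "f \<in> M \<Longrightarrow> (\<lambda>z. z ^ n * f z) \<in> M"
proof (induction n)
  case (Suc n)
  then show ?case using M_z[of "\<lambda>z. z ^ n * f z"] by (simp add: mult.assoc)
qed simp

lemma M_poly: "f \<in> M \<Longrightarrow> (\<lambda>z. (\<Sum>i<n. a i * z ^ i) * f z) \<in> M"
  using M_sum[of "{..<n}" "\<lambda>i z. a i * (z ^ i * f z)"] by (simp add: M_cmult M_power sum_distrib_right mult.assoc)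

text \<open>Taylor polynomials of \<open>\<phi>\<close> itself carry no evident bound in
  \<open>H\<close>, which forces two limits: polynomials at a fixed \<open>r < 1\<close>, and then
  \<open>r\<close> tending to 1. Boundedness of multiplication by \<open>g\<close> transfers each
  bound to the products.\<close>

lemma M_ideal:
  assumes alg: "\<And>f g. f \<in> H \<Longrightarrow> g \<in> H \<Longrightarrow> (\<lambda>z. f z * g z) \<in> H"
    and \<phi>: "\<phi> \<in> H" and g: "g \<in> M"
  shows "(\<lambda>z. \<phi> z * g z) \<in> M"
proof -
  obtain C where C: "0 \<le> C" "\<And>\<phi>. \<phi> \<in> H \<Longrightarrow> q (\<lambda>z. \<phi> z * g z) \<le> C * q \<phi>"
    using multiplication_bounded[OF alg M_H[OF g]] by blast
  have limit: "(\<lambda>z. \<psi> z * g z) \<in> M"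
    if p: "\<And>n. p n \<in> H" "\<And>n. (\<lambda>z. p n z * g z) \<in> M" "\<And>n. q (p n) \<le> B"
      and lim: "\<And>i. (\<lambda>n. tcoeff (p n) i) \<longlonglongrightarrow> tcoeff \<psi> i" and \<psi>: "hol \<psi>" for p B \<psi>
  proof (rule M_weakly_closed[of "\<lambda>n z. p n z * g z" "C * B"])
    show "q (\<lambda>z. p n z * g z) \<le> C * B" for n
      using order_trans[OF C(2)[OF p(1)] mult_left_mono[OF p(3) C(1)]] .
    show "(\<lambda>n. tcoeff (\<lambda>z. p n z * g z) i) \<longlonglongrightarrow> tcoeff (\<lambda>z. \<psi> z * g z) i" for i
      using p(1) g \<psi> by (simp add: tcoeff_mult H_hol M_hol) (intro tendsto_intros lim)
  qed (use p \<psi> g M_hol in \<open>auto intro!: holomorphic_intros\<close>)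
  have dil: "(\<lambda>z. \<phi> (of_real r * z) * g z) \<in> M" if r: "0 < r" "r < 1" for r
  proof -
    define p where "p n z = (\<Sum>i<n. (of_real r ^ i * tcoeff \<phi> i) * z ^ i)" for n z
    \<comment> \<open>Chosen so that \<open>R > 1\<close> and \<open>r * R = sqrt r < 1\<close>: the
      Taylor series of the dilation is dominated by a geometric series on a disc larger than the
      unit disc.\<close>
    define R where "R = 1 / sqrt r"
    have R: "R > 1" using r by (simp add: R_def)
    have rR: "0 \<le> r * R" "r * R < 1" using r by (auto simp: R_def real_div_sqrt)
    define S where "S = sqrt (q \<phi>)"
    have co: "cmod (tcoeff \<phi> i) \<le> S" for i
      unfolding S_def by (rule real_le_rsqrt) (rule tcoeff_le_q[OF \<phi>])
    have pb: "cmod (p n z) \<le> S / (1 - r * R)" if z: "z \<in> ball 0 R" for n z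
    proof -
      have "cmod (p n z) \<le> (\<Sum>i<n. S * (r * R) ^ i)"
        unfolding p_def
      proof (rule sum_norm_le)
        fix i
        have "cmod z ^ i \<le> R ^ i" using z by (intro power_mono) auto
        then have "(r ^ i * cmod (tcoeff \<phi> i)) * cmod z ^ i \<le> (r ^ i * S) * R ^ i"
          using r co[of i] order_trans[OF norm_ge_zero co[of i]] by (intro mult_mono mult_left_mono) auto
        then show "cmod ((of_real r ^ i * tcoeff \<phi> i) * z ^ i) \<le> S * (r * R) ^ i"
          using r by (simp add: norm_mult norm_power power_mult_distrib mult_ac)
      qed
      also have "\<dots> \<le> (\<Sum>i. S * (r * R) ^ i)"
        using rR by (intro sum_le_suminf summable_mult summable_geometric) (auto simp: S_def)
      also have "\<dots> = S / (1 - r * R)"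
        using rR by (subst suminf_mult) (auto simp: suminf_geometric)
      finally show ?thesis .
    qed
    obtain K where K: "\<And>F. F holomorphic_on ball 0 R \<Longrightarrow> (\<And>z. z \<in> ball 0 R \<Longrightarrow> cmod (F z) \<le> S / (1 - r * R)) \<Longrightarrow> Q F \<le> ennreal K"
      using Q_le_of_bounded_on_larger_disc[OF R, of "S / (1 - r * R)"] by blast
    have hp: "p n holomorphic_on A" for n A unfolding p_def by (intro holomorphic_intros)
    have Qp: "Q (p n) \<le> ennreal (max K 0)" for n
      using K[OF hp pb, of n] by (rule order_trans) (auto intro: ennreal_leI)
    have pH: "p n \<in> H" for n using Qp[of n] hp by (auto simp: H_iff intro: order_le_less_trans)
    have qp: "q (p n) \<le> max K 0" for n
      using Qp[of n] by (subst (asm) Q_eq_q[OF pH]) (simp add: ennreal_le_iff)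
    have tp: "tcoeff (p n) i = (if i < n then of_real r ^ i * tcoeff \<phi> i else 0)" for n i
      unfolding p_def by (rule tcoeff_poly)
    show ?thesis
    proof (rule limit[of p])
      show "(\<lambda>z. p n z * g z) \<in> M" for n unfolding p_def by (rule M_poly[OF g])
      show "(\<lambda>n. tcoeff (p n) i) \<longlonglongrightarrow> tcoeff (\<lambda>z. \<phi> (of_real r * z)) i" for i
      proof (rule tendsto_eventually)
        show "\<forall>\<^sub>F n in sequentially. tcoeff (p n) i = tcoeff (\<lambda>z. \<phi> (of_real r * z)) i"
          using eventually_gt_at_top[of i]
          by eventually_elim (use r \<phi> in \<open>simp add: tp tcoeff_dilate H_hol\<close>)
      qed
      show "hol (\<lambda>z. \<phi> (of_real r * z))" using r \<phi> by (intro hol_dilate H_hol) auto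
    qed (use pH qp in auto)
  qed
  define r where "r n = 1 - 1 / real (n + 2)" for n
  have r: "0 < r n" "r n < 1" for n by (auto simp: r_def field_simps)
  have rlim: "r \<longlonglongrightarrow> 1"
    using tendsto_diff[OF tendsto_const LIMSEQ_ignore_initial_segment[OF lim_1_over_n, of 2], of "1::real"]
    by (simp add: r_def[abs_def])
  show ?thesis
  proof (rule limit[of "\<lambda>n z. \<phi> (of_real (r n) * z)"])
    show "(\<lambda>z. \<phi> (of_real (r n) * z)) \<in> H" for n using q_dilate(1)[OF \<phi>, of "r n"] r[of n] by simp
    show "q (\<lambda>z. \<phi> (of_real (r n) * z)) \<le> 25920 * 4 ^ m * q \<phi>" for n using q_dilate(2)[OF \<phi>, of "r n"] r[of n] by simp
    show "(\<lambda>n. tcoeff (\<lambda>z. \<phi> (of_real (r n) * z)) i) \<longlonglongrightarrow> tcoeff \<phi> i" for i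
    proof -
      have "(\<lambda>n. of_real (r n) ^ i * tcoeff \<phi> i) \<longlonglongrightarrow> of_real 1 ^ i * tcoeff \<phi> i"
        by (intro tendsto_intros rlim)
      then show ?thesis using r \<phi> by (simp add: tcoeff_dilate H_hol less_imp_le)
    qed
  qed (use dil r \<phi> in auto)
qed

end

section \<open>Division by the coordinate function\<close>

lemma higher_deriv_z_mult:
  assumes "hol h" "cmod z < 1"
  shows "(deriv ^^ Suc l) (\<lambda>w. w * h w) z = z * (deriv ^^ Suc l) h z + of_nat (Suc l) * (deriv ^^ l) h z"
proof -
  have "(deriv ^^ Suc l) (\<lambda>w. w * h w) z = (\<Sum>i=0..Suc l. of_nat (Suc l choose i) * (deriv ^^ i) (\<lambda>w. w) z * (deriv ^^ (Suc l - i)) h z)"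
    by (rule higher_deriv_mult[of _ "ball 0 1"]) (use assms in \<open>auto intro: holomorphic_intros\<close>)
  also have "\<dots> = (\<Sum>i\<in>{0, 1}. of_nat (Suc l choose i) * (deriv ^^ i) (\<lambda>w. w) z * (deriv ^^ (Suc l - i)) h z)"
    by (rule sum.mono_neutral_right) (auto simp del: funpow.simps)
  finally show ?thesis by (simp del: funpow.simps add: funpow_0)
qed

lemma tcoeff_z_mult:
  assumes "hol h"
  shows "tcoeff (\<lambda>w. w * h w) 0 = 0" "tcoeff (\<lambda>w. w * h w) (Suc n) = tcoeff h n"
proof -
  show "tcoeff (\<lambda>w. w * h w) 0 = 0" by (simp add: tcoeff_def)
  have "(deriv ^^ Suc n) (\<lambda>w. w * h w) 0 = of_nat (Suc n) * (deriv ^^ n) h 0"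
    using higher_deriv_z_mult[OF assms, of 0 n] by (simp del: funpow.simps)
  then have "tcoeff (\<lambda>w. w * h w) (Suc n) = (of_nat (Suc n) * (deriv ^^ n) h 0) / (of_nat (Suc n) * of_nat (fact n))"
    unfolding tcoeff_def fact_Suc of_nat_mult of_nat_id by (simp only:)
  also have "\<dots> = tcoeff h n"
    unfolding tcoeff_def by (rule mult_divide_mult_cancel_left) (rule of_nat_neq_0)
  finally show "tcoeff (\<lambda>w. w * h w) (Suc n) = tcoeff h n" .
qed

context circle_meas
begin

lemma L2w_z_mult_le: "hol F \<Longrightarrow> L2w \<mu> a (\<lambda>z. z * F z) \<le> L2w \<mu> a F"
  unfolding L2w_wt
proof (rule nn_integral_mono)
  fix z
  show "ennreal ((cmod (z * F z))\<^sup>2 * wt a z) * indicator (ball 0 1) z \<le> ennreal ((cmod (F z))\<^sup>2 * wt a z) * indicator (ball 0 1) z"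
  proof (cases "cmod z < 1")
    case True
    then have "(cmod (z * F z))\<^sup>2 \<le> (cmod (F z))\<^sup>2"
      by (intro power_mono) (auto simp: norm_mult mult_left_le_one_le)
    then show ?thesis using wt_nonneg[OF True, of a] by (intro mult_right_mono ennreal_leI) auto
  qed simp
qed

text \<open>Only a neighbourhood of the origin matters: for \<open>|z| > 1/2\<close> one has
  \<open>|F| \<le> 2 |z F|\<close>, hence the 4, and for \<open>|z| \<le> 1/2\<close> the function
  is bounded and the Poisson integral is integrable.\<close>

lemma L2w_z_div:
  assumes F: "hol F" and fin: "L2w \<mu> a (\<lambda>z. z * F z) < \<infinity>"
  shows "L2w \<mu> a F < \<infinity>"
proof -
  have zF: "continuous_on (ball 0 1) (\<lambda>z. z * F z)"
    by (intro continuous_intros holomorphic_on_imp_continuous_on[OF F])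
  obtain B where B: "\<And>z. z \<in> cball 0 (1/2) \<Longrightarrow> cmod (F z) \<le> B"
    using bounded_on_smaller_disc[OF holomorphic_on_imp_continuous_on[OF F], of "1/2"] by force
  note L2w_measurable[OF zF, of a, measurable]
  have "L2w \<mu> a F \<le> (\<integral>\<^sup>+z. 4 * (ennreal ((cmod (z * F z))\<^sup>2 * wt a z) * indicator (ball 0 1) z) + ennreal (B\<^sup>2) * (ennreal (Poisson \<mu> z) * indicator (ball 0 1) z) \<partial>lborel)"
    unfolding L2w_wt
  proof (rule nn_integral_mono)
    fix z
    show "ennreal ((cmod (F z))\<^sup>2 * wt a z) * indicator (ball 0 1) z \<le> 4 * (ennreal ((cmod (z * F z))\<^sup>2 * wt a z) * indicator (ball 0 1) z) + ennreal (B\<^sup>2) * (ennreal (Poisson \<mu> z) * indicator (ball 0 1) z)"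
    proof (cases "cmod z < 1")
      case True
      note w = wt_nonneg[OF True, of a] wt_le_Poisson[OF True, of a]
      have "(cmod (F z))\<^sup>2 * wt a z \<le> 4 * ((cmod (z * F z))\<^sup>2 * wt a z) + B\<^sup>2 * Poisson \<mu> z"
      proof (cases "cmod z \<le> 1/2")
        case True
        then have "(cmod (F z))\<^sup>2 \<le> B\<^sup>2" using B[of z] by (intro power_mono) auto
        then have "(cmod (F z))\<^sup>2 * wt a z \<le> B\<^sup>2 * Poisson \<mu> z" using w by (intro mult_mono) auto
        then show ?thesis using w by (simp add: add_increasing)
      next
        case False
        then have "1 * cmod (F z) \<le> (2 * cmod z) * cmod (F z)" by (intro mult_right_mono) auto
        then have "(cmod (F z))\<^sup>2 \<le> (2 * cmod (z * F z))\<^sup>2" by (intro power_mono) (auto simp: norm_mult)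
        then have "(cmod (F z))\<^sup>2 * wt a z \<le> (4 * (cmod (z * F z))\<^sup>2) * wt a z"
          using w by (intro mult_right_mono) (auto simp: power_mult_distrib)
        then show ?thesis using w by (simp add: add_increasing2)
      qed
      then have "ennreal ((cmod (F z))\<^sup>2 * wt a z) \<le> ennreal (4 * ((cmod (z * F z))\<^sup>2 * wt a z) + B\<^sup>2 * Poisson \<mu> z)"
        by (rule ennreal_leI)
      also have "\<dots> = ennreal (4 * ((cmod (z * F z))\<^sup>2 * wt a z)) + ennreal (B\<^sup>2 * Poisson \<mu> z)"
        using w by (intro ennreal_plus) auto
      also have "\<dots> = 4 * ennreal ((cmod (z * F z))\<^sup>2 * wt a z) + ennreal (B\<^sup>2) * ennreal (Poisson \<mu> z)"
        using w by (intro arg_cong2[where f = "(+)"]) (simp_all add: ennreal_mult)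
      finally show ?thesis using True by simp
    qed simp
  qed
  also have "\<dots> = 4 * L2w \<mu> a (\<lambda>z. z * F z) + ennreal (B\<^sup>2) * (\<integral>\<^sup>+z\<in>ball 0 1. ennreal (Poisson \<mu> z) \<partial>lborel)"
    unfolding L2w_wt by (subst nn_integral_add) (auto simp: nn_integral_cmult)
  also have "\<dots> < \<infinity>" using fin nn_integral_Poisson_finite by (simp add: ennreal_mult_less_top)
  finally show ?thesis .
qed

text \<open>The derivative of order \<open>l + 1\<close> of \<open>z h\<close> is \<open>z\<close>
  times that of \<open>h\<close> plus \<open>l + 1\<close> times the derivative of order
  \<open>l\<close>. The derivatives of \<open>h\<close> are recovered in increasing order, so those
  of \<open>f\<close> must be finite in the same weight at every order up to
  \<open>j\<close>.\<close>

lemma L2w_division: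
  assumes f: "hol f" and h: "hol h" and fh: "\<And>z. cmod z < 1 \<Longrightarrow> f z = z * h z"
    and fin: "\<And>l. l \<le> j \<Longrightarrow> L2w \<mu> a ((deriv ^^ l) f) < \<infinity>" and l: "l \<le> j"
  shows "L2w \<mu> a ((deriv ^^ l) h) < \<infinity>"
  using l
proof (induction l)
  case 0
  have "L2w \<mu> a (\<lambda>z. z * h z) = L2w \<mu> a f" by (rule L2w_cong) (simp add: fh)
  then show ?case using fin[of 0] L2w_z_div[OF h, of a] by simp
next
  case (Suc l)
  have fin': "L2w \<mu> a ((deriv ^^ Suc l) f) < \<infinity>" using fin[OF Suc.prems] .
  have hl: "hol ((deriv ^^ l) h)" "hol ((deriv ^^ Suc l) h)" "hol ((deriv ^^ Suc l) f)"
    using f h by (auto intro: hol_higher_deriv simp del: funpow.simps)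
  have "L2w \<mu> a ((deriv ^^ l) h) < \<infinity>" using Suc by simp
  then have "L2w \<mu> a (\<lambda>z. of_nat (Suc l) * (deriv ^^ l) h z) < \<infinity>"
    using L2w_cmult[OF hl(1)] by (simp add: ennreal_mult_less_top)
  then have "L2w \<mu> a (\<lambda>z. (deriv ^^ Suc l) f z - of_nat (Suc l) * (deriv ^^ l) h z) < \<infinity>"
    by (intro L2w_add_finite(2) fin' hl holomorphic_intros)
  also have "L2w \<mu> a (\<lambda>z. (deriv ^^ Suc l) f z - of_nat (Suc l) * (deriv ^^ l) h z) = L2w \<mu> a (\<lambda>z. z * (deriv ^^ Suc l) h z)"
  proof (rule L2w_cong)
    fix z :: complex assume z: "cmod z < 1"
    have "(deriv ^^ Suc l) f z = (deriv ^^ Suc l) (\<lambda>w. w * h w) z"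
      by (rule higher_deriv_hol_cong[OF f fh z])
    then show "(deriv ^^ Suc l) f z - of_nat (Suc l) * (deriv ^^ l) h z = z * (deriv ^^ Suc l) h z"
      using higher_deriv_z_mult[OF h z, of l] by simp
  qed
  finally show ?case by (rule L2w_z_div[OF hl(2)])
qed

text \<open>Descending induction by Hardy's inequality; its gain of two powers of
  \<open>1 - |z|^2\<close> is given away, since the integral decreases in the exponent.\<close>

lemma L2w_lower_derivs:
  assumes f: "hol f" and fin: "L2w \<mu> a ((deriv ^^ j) f) < \<infinity>" and a: "1 \<le> a" and l: "l \<le> j"
  shows "L2w \<mu> a ((deriv ^^ l) f) < \<infinity>"
  using l
proof (induction rule: inc_induct)
  case base
  then show ?case by (rule fin)
next
  case (step n)
  have "L2w \<mu> (a + 2) (deriv ((deriv ^^ n) f)) \<le> L2w \<mu> a (deriv ((deriv ^^ n) f))" by (rule L2w_antimono) simp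
  also have "\<dots> < \<infinity>" using step.IH by simp
  finally show ?case by (rule L2w_hardy[OF hol_higher_deriv[OF f] a])
qed

end

context hmu
begin

text \<open>Nonnegativity of \<open>q (c f - g / c)\<close> with \<open>c^2 = s\<close>. For small
  \<open>s\<close> the coefficient of \<open>q f\<close> is close to 1, so a vanishing perturbation
  \<open>g\<close> does not disturb comparisons with an infimum; this serves in place of the
  triangle inequality for the norm.\<close>

lemma q_add_le_weighted:
  assumes f: "f \<in> H" and g: "g \<in> H" and s: "0 < s"
  shows "q (\<lambda>z. f z + g z) \<le> (1 + s) * q f + (1 + 1 / s) * q g"
proof -
  define c :: complex where "c = of_real (sqrt s)"
  have c: "c \<noteq> 0" "(cmod c)\<^sup>2 = s" "cnj c = c" using s by (auto simp: c_def)
  have f': "(\<lambda>z. c * f z) \<in> H" and g': "(\<lambda>z. (- 1 / c) * g z) \<in> H" by (intro H_cmult f g)+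
  have "ip f (\<lambda>z. (- 1 / c) * g z) = (- 1 / c) * ip f g"
    using ip_cnj[OF g' f] ip_cmult_left[OF g f, of "- 1 / c"] ip_cnj[OF g f] c by simp
  then have "ip (\<lambda>z. c * f z) (\<lambda>z. (- 1 / c) * g z) = - ip f g"
    using ip_cmult_left[OF f g', of c] c by simp
  then have "q (\<lambda>z. c * f z + (- 1 / c) * g z) = s * q f - 2 * Re (ip f g) + 1 / s * q g"
    using q_add_ip[OF f' g'] q_cmult[OF f, of c] q_cmult[OF g, of "- 1 / c"] c
    by (simp add: norm_divide power_divide)
  then have "2 * Re (ip f g) \<le> s * q f + 1 / s * q g"
    using q_nonneg[of "\<lambda>z. c * f z + (- 1 / c) * g z"] by linarith
  then show ?thesis using q_add_ip[OF f g] by (simp add: algebra_simps)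
qed

lemma const_H: "(\<lambda>_. c) \<in> H" and ident_H: "(\<lambda>z. z) \<in> H"
proof -
  have *: "f \<in> H" if "f holomorphic_on ball 0 2" "\<And>z. z \<in> ball 0 2 \<Longrightarrow> cmod (f z) \<le> B" for f B
  proof -
    obtain K where K: "\<And>F. F holomorphic_on ball 0 2 \<Longrightarrow> (\<And>z. z \<in> ball 0 2 \<Longrightarrow> cmod (F z) \<le> B) \<Longrightarrow> Q F \<le> ennreal K"
      using Q_le_of_bounded_on_larger_disc[of 2 B] by force
    from K[OF that] show ?thesis using holomorphic_on_subset[OF that(1) subset_ball[of 1 2]]
      by (auto simp: H_iff intro: order_le_less_trans)
  qed
  show "(\<lambda>_. c) \<in> H" by (rule *[of _ "cmod c"]) auto
  show "(\<lambda>z. z) \<in> H" by (rule *[of _ 2]) (auto intro: holomorphic_intros)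
qed

text \<open>For \<open>j \<ge> 2\<close> the weight exponent is at least 1 and Hardy's inequality
  applies. For \<open>j = 1\<close> it is 0, and stability of \<open>H\<close> under multiplication
  by \<open>z\<close> is used: \<open>(z f)'\<close> and \<open>z f'\<close> both have finite
  integral, and their difference is \<open>f\<close>.\<close>

lemma H_lower_derivs:
  assumes z: "\<And>f. f \<in> H \<Longrightarrow> (\<lambda>z. z * f z) \<in> H" and f: "f \<in> H" and j: "j \<in> {1..m}" and l: "l \<le> j"
  shows "L2w (\<mu>s j) (j - 1) ((deriv ^^ l) f) < \<infinity>"
proof -
  interpret circle_meas "\<mu>s j" by (rule circle_meas[OF j])
  have fj: "L2w (\<mu>s j) (j - 1) ((deriv ^^ j) f) < \<infinity>" using f j by (simp add: H_iff')
  show ?thesis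
  proof (cases "j = 1")
    case False
    then have "1 \<le> j - 1" using j by auto
    then show ?thesis by (rule L2w_lower_derivs[OF H_hol[OF f] fj _ l])
  next
    case True
    have hf: "hol f" "hol (deriv f)" using f hol_higher_deriv[of f 1] by (auto simp: H_hol)
    have f1: "L2w (\<mu>s j) 0 (deriv f) < \<infinity>" using fj True by simp
    have "L2w (\<mu>s j) 0 (deriv (\<lambda>z. z * f z)) < \<infinity>" using z[OF f] j True unfolding H_iff' by force
    moreover have "L2w (\<mu>s j) 0 (\<lambda>z. z * deriv f z) < \<infinity>"
      using L2w_z_mult_le[OF hf(2)] f1 by (rule order_le_less_trans)
    ultimately have "L2w (\<mu>s j) 0 (\<lambda>z. deriv (\<lambda>z. z * f z) z - z * deriv f z) < \<infinity>"
      by (intro L2w_add_finite(2) holomorphic_intros hf holomorphic_deriv) auto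
    also have "L2w (\<mu>s j) 0 (\<lambda>z. deriv (\<lambda>z. z * f z) z - z * deriv f z) = L2w (\<mu>s j) 0 f"
      by (rule L2w_cong) (use higher_deriv_z_mult[OF hf(1), of _ 0] in simp)
    finally have f0: "L2w (\<mu>s j) 0 f < \<infinity>" .
    have "l = 0 \<or> l = 1" using l True by auto
    then show ?thesis using f0 f1 True by auto
  qed
qed

text \<open>The quotient is the backward shift of the coefficient sequence; finiteness of its
  weighted integrals rests on the lower derivatives of \<open>f\<close>.\<close>

lemma H_division:
  assumes z: "\<And>f. f \<in> H \<Longrightarrow> (\<lambda>z. z * f z) \<in> H" and f: "f \<in> H" and f0: "tcoeff f 0 = 0"
  obtains h where "h \<in> H" "\<And>z. cmod z < 1 \<Longrightarrow> f z = z * h z"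
proof -
  have "cmod (tcoeff f (Suc n)) \<le> sqrt (q f)" for n by (intro real_le_rsqrt tcoeff_le_q f)
  then obtain h where h: "hol h" "\<And>n. tcoeff h n = tcoeff f (Suc n)" "\<And>z. cmod z < 1 \<Longrightarrow> (\<lambda>n. tcoeff f (Suc n) * z ^ n) sums h z"
    by (rule hol_power_series[of "\<lambda>n. tcoeff f (Suc n)"]) blast
  have fh: "f z = z * h z" if "cmod z < 1" for z
  proof (rule hol_eqI[OF H_hol[OF f] _ _ that])
    show "hol (\<lambda>z. z * h z)" by (intro holomorphic_intros h)
    show "tcoeff f n = tcoeff (\<lambda>z. z * h z) n" for n
      by (cases n) (simp_all add: f0 tcoeff_z_mult h)
  qed
  have "h \<in> H2"
    using H_H2[OF f] h(1) by (simp add: H2_def h(2) summable_Suc_iff[of "\<lambda>n. (cmod (tcoeff f n))\<^sup>2"])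
  moreover have "L2w (\<mu>s j) (j - 1) ((deriv ^^ j) h) < \<infinity>" if j: "j \<in> {1..m}" for j
    by (rule circle_meas.L2w_division[OF circle_meas[OF j] H_hol[OF f] h(1) fh H_lower_derivs[OF z f j] order_refl])
  ultimately have "h \<in> H" by (simp add: H_iff')
  with fh show ?thesis using that by blast
qed

lemma H_division_power:
  assumes z: "\<And>f. f \<in> H \<Longrightarrow> (\<lambda>z. z * f z) \<in> H" and f: "f \<in> H" "\<And>i. i < N \<Longrightarrow> tcoeff f i = 0"
  shows "\<exists>h\<in>H. (\<forall>z. cmod z < 1 \<longrightarrow> f z = z ^ N * h z) \<and> tcoeff h 0 = tcoeff f N"
  using f
proof (induction N arbitrary: f)
  case 0
  then show ?case by auto
next
  case (Suc N)
  obtain h where h: "h \<in> H" "\<And>z. cmod z < 1 \<Longrightarrow> f z = z * h z"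
    using H_division[OF z Suc.prems(1)] Suc.prems(2)[of 0] by blast
  have t: "tcoeff f (Suc i) = tcoeff h i" for i
    using tcoeff_cong[OF H_hol[OF Suc.prems(1)] h(2)] tcoeff_z_mult(2)[OF H_hol[OF h(1)]] by simp
  have "tcoeff h i = 0" if "i < N" for i using Suc.prems(2)[of "Suc i"] that t by simp
  from Suc.IH[OF h(1) this] obtain k where k: "k \<in> H" "\<And>z. cmod z < 1 \<Longrightarrow> h z = z ^ N * k z" "tcoeff k 0 = tcoeff h N"
    by blast
  then show ?case using h(2) t by (intro bexI[of _ k]) (auto simp: mult_ac)
qed

end

section \<open>One-dimensionality of the wandering subspace\<close>

context hmu_invariant
begin

lemma dim_one_wandering:
  assumes alg: "\<And>f g. f \<in> H \<Longrightarrow> g \<in> H \<Longrightarrow> (\<lambda>z. f z * g z) \<in> H" and nz: "nonzero_space M"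
  shows "dim_one (wandering m \<mu>s M)"
proof -
  have zH: "(\<lambda>z. z * f z) \<in> H" if "f \<in> H" for f using alg[OF ident_H that] .
  define P where "P n \<longleftrightarrow> (\<exists>f\<in>M. tcoeff f n \<noteq> 0)" for n
  have "\<exists>n. P n"
  proof (rule ccontr)
    assume "\<not> ?thesis"
    then have "f z = 0" if "f \<in> M" "cmod z < 1" for f z
      using hol_eqI[OF M_hol[OF that(1)] _ _ that(2), of "\<lambda>_. 0"] that by (auto simp: P_def tcoeff_def)
    with nz show False by (auto simp: nonzero_space_def)
  qed
  define N where "N = (LEAST n. P n)"
  have "P N" unfolding N_def using \<open>\<exists>n. P n\<close> by (rule LeastI_ex)
  then obtain g0 where g0: "g0 \<in> M" "tcoeff g0 N \<noteq> 0" by (auto simp: P_def)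
  have low: "tcoeff f i = 0" if "f \<in> M" "i < N" for f i
    using not_less_Least[of i P] that by (auto simp: N_def P_def)
  define g where "g = (\<lambda>z. (1 / tcoeff g0 N) * g0 z)"
  have g: "g \<in> M" unfolding g_def by (rule M_cmult[OF g0(1)])
  have gN: "tcoeff g N = 1" unfolding g_def using g0 by (subst tcoeff_cmult) (auto intro: M_hol)
  have zN: "tcoeff (\<lambda>z. z * h z) N = 0" if "h \<in> M" for h
    using low[OF that] tcoeff_z_mult[OF M_hol[OF that]] by (cases N) auto
  \<comment> \<open>This is \<open>g + zM\<close>. Its closedness is not established, so
    \<open>k\<close> below is only a limit of almost minimal elements: it belongs to
    \<open>M\<close>, though perhaps not to \<open>C\<close>.\<close>
  define C where "C = {(\<lambda>z. g z - z * h z) |h. h \<in> M}"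
  have CM: "C \<subseteq> M" unfolding C_def using M_diff[OF g M_z] by auto
  have gC: "(\<lambda>z. g z - z * 0) \<in> C" unfolding C_def by (intro CollectI exI[of _ "\<lambda>_. 0"] conjI refl M_zero)
  obtain u k where u: "\<And>n. u n \<in> C" and k: "k \<in> H" "(\<lambda>n. q (\<lambda>z. u n z - k z)) \<longlonglongrightarrow> 0"
    and um: "\<And>n. q (u n) \<le> (INF v\<in>C. q v) + 1 / real (Suc n)"
  proof (rule nested_minimizers[of "\<lambda>_. C" "q (\<lambda>z. g z - z * 0)"])
    show "C \<subseteq> H" using CM M_H by blast
    show "C \<noteq> {}" "\<exists>u\<in>C. q u \<le> q (\<lambda>z. g z - z * 0)" using gC by blast+
    fix u v assume "u \<in> C" "v \<in> C"
    then obtain h h' where h: "h \<in> M" "h' \<in> M" "u = (\<lambda>z. g z - z * h z)" "v = (\<lambda>z. g z - z * h' z)"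
      by (auto simp: C_def)
    have "(\<lambda>z. (1/2) * (h z + h' z)) \<in> M" using h by (intro M_cmult M_add)
    moreover have "(\<lambda>z. (1/2) * (u z + v z)) = (\<lambda>z. g z - z * ((1/2) * (h z + h' z)))"
      by (auto simp: h field_simps)
    ultimately show "(\<lambda>z. (1/2) * (u z + v z)) \<in> C"
      unfolding C_def by (intro CollectI exI[of _ "\<lambda>z. (1/2) * (h z + h' z)"] conjI)
  next
    fix u f
    assume "\<And>n. u n \<in> C" "f \<in> H" "(\<lambda>n. q (\<lambda>z. u n z - f z)) \<longlonglongrightarrow> 0"
      "\<And>n. q (u n) \<le> (INF v\<in>C. q v) + 1 / real (Suc n)"
    then show thesis by (rule that)
  qed auto
  have uM: "u n \<in> M" for n using u CM by blast
  have kM: "k \<in> M" by (rule M_closed[OF uM k])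
  \<comment> \<open>Coefficients are continuous, and every element of \<open>C\<close> has
    \<open>N\<close>-th coefficient 1 because the coefficients of elements of \<open>zM\<close>
    vanish up to order \<open>N\<close>. This keeps \<open>k\<close> away from 0.\<close>
  have kN: "tcoeff k N = 1"
  proof (rule LIMSEQ_unique[OF tcoeff_tendsto[OF M_H[OF uM] k]])
    have "tcoeff (u n) N = 1" for n
    proof -
      obtain h where h: "h \<in> M" "u n = (\<lambda>z. g z - z * h z)" using u[of n] by (auto simp: C_def)
      then show ?thesis using gN zN[OF h(1)] by (simp add: tcoeff_diff M_hol g M_z)
    qed
    then show "(\<lambda>n. tcoeff (u n) N) \<longlonglongrightarrow> 1" by simp
  qed
  have kmin: "q k \<le> (INF v\<in>C. q v)"
  proof (rule q_tendsto[OF M_H[OF uM] k um])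
    show "(\<lambda>n. (INF v\<in>C. q v) + 1 / real (Suc n)) \<longlonglongrightarrow> (INF v\<in>C. q v)"
      using tendsto_add[OF tendsto_const LIMSEQ_Suc[OF lim_1_over_n]] by fastforce
  qed
  \<comment> \<open>The competitor \<open>k + c z h\<close> need not lie in \<open>C\<close>, but
    \<open>u n + c z h\<close> does and differs from it by a function tending to 0 in norm; the
    weighted inequality carries the infimum over.\<close>
  have orth: "ip k (\<lambda>z. z * h z) = 0" if h: "h \<in> M" for h
  proof (rule ip_eq_0_if_minimal[OF k(1) M_H[OF M_z[OF h]]])
    fix c
    have shift: "(\<lambda>z. u n z + c * (z * h z)) \<in> C" for n
    proof -
      obtain h' where h': "h' \<in> M" "u n = (\<lambda>z. g z - z * h' z)" using u[of n] by (auto simp: C_def)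
      have "(\<lambda>z. h' z - c * h z) \<in> M" by (intro M_diff M_cmult h h')
      moreover have "(\<lambda>z. u n z + c * (z * h z)) = (\<lambda>z. g z - z * (h' z - c * h z))"
        by (auto simp: h' algebra_simps)
      ultimately show ?thesis unfolding C_def by (intro CollectI exI[of _ "\<lambda>z. h' z - c * h z"] conjI)
    qed
    have kc: "(\<lambda>z. k z + c * (z * h z)) \<in> H" by (intro M_H M_add M_cmult M_z kM h)
    define A where "A = q (\<lambda>z. k z + c * (z * h z))"
    define x where "x n = (\<lambda>z. u n z - k z)" for n
    have xH: "x n \<in> H" for n unfolding x_def by (intro H_diff M_H uM k)
    have weighted: "(INF v\<in>C. q v) \<le> (1 + s) * A" if s: "0 < s" for s
    proof (rule tendsto_lowerbound)
      show "(\<lambda>n. (1 + s) * A + (1 + 1 / s) * q (x n)) \<longlonglongrightarrow> (1 + s) * A"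
        using tendsto_add[OF tendsto_const tendsto_mult[OF tendsto_const k(2)], of "(1 + s) * A" "1 + 1 / s"]
        by (simp add: x_def)
      show "\<forall>\<^sub>F n in sequentially. (INF v\<in>C. q v) \<le> (1 + s) * A + (1 + 1 / s) * q (x n)"
      proof (intro always_eventually allI)
        fix n
        have "(INF v\<in>C. q v) \<le> q (\<lambda>z. u n z + c * (z * h z))"
          by (rule cINF_lower[OF bdd_belowI[of _ 0] shift]) auto
        also have "(\<lambda>z. u n z + c * (z * h z)) = (\<lambda>z. (k z + c * (z * h z)) + x n z)" by (auto simp: x_def)
        also have "q (\<lambda>z. (k z + c * (z * h z)) + x n z) \<le> (1 + s) * A + (1 + 1 / s) * q (x n)"
          unfolding A_def by (rule q_add_le_weighted[OF kc xH s])
        finally show "(INF v\<in>C. q v) \<le> (1 + s) * A + (1 + 1 / s) * q (x n)" .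
      qed
    qed simp
    have "(INF v\<in>C. q v) \<le> A"
    proof (rule field_le_epsilon)
      fix e :: real assume e: "e > 0"
      have A: "0 \<le> A" by (simp add: A_def)
      \<comment> \<open>The denominator \<open>A + 1\<close> gives \<open>s * A \<le> e\<close> also
        when \<open>A = 0\<close>.\<close>
      have "(INF v\<in>C. q v) \<le> (1 + e / (A + 1)) * A" using A e by (intro weighted) auto
      also have "\<dots> = A + e * (A / (A + 1))" by (simp add: algebra_simps)
      also have "\<dots> \<le> A + e * 1" using A e by (intro add_left_mono mult_left_mono) auto
      finally show "(INF v\<in>C. q v) \<le> A + e" by simp
    qed
    then show "q k \<le> q (\<lambda>z. k z + c * (z * h z))" using kmin by (simp add: A_def)
  qed
  obtain g1 where g1: "g1 \<in> H" "\<And>z. cmod z < 1 \<Longrightarrow> g z = z ^ N * g1 z" "tcoeff g1 0 = 1"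
    using H_division_power[OF zH M_H[OF g], of N] low[OF g] gN by auto
  obtain G where G: "G \<in> H" "\<And>z. cmod z < 1 \<Longrightarrow> g1 z - 1 = z * G z"
  proof (rule H_division[OF zH H_diff[OF g1(1) const_H[of 1]]])
    show "tcoeff (\<lambda>z. g1 z - 1) 0 = 0"
      using g1 by (subst tcoeff_diff) (auto simp: H_hol tcoeff_def)
  next
    fix G assume "G \<in> H" "\<And>z. cmod z < 1 \<Longrightarrow> g1 z - 1 = z * G z"
    then show thesis by (rule that)
  qed
  have spanned: "f z = tcoeff f N * k z" if f: "f \<in> wandering m \<mu>s M" and z: "cmod z < 1" for f z
  proof -
    have fM: "f \<in> M" and fo: "\<And>h. h \<in> M \<Longrightarrow> ip f (\<lambda>z. z * h z) = 0" using f by (auto simp: wandering_def)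
    define d where "d = (\<lambda>z. f z - tcoeff f N * k z)"
    have dM: "d \<in> M" unfolding d_def by (intro M_diff M_cmult fM kM)
    have d0: "tcoeff d i = 0" if "i < Suc N" for i
    proof (cases "i = N")
      case True
      then show ?thesis unfolding d_def using kN
        by (simp add: tcoeff_diff tcoeff_cmult M_hol fM kM M_cmult)
    next
      case False
      then show ?thesis using low[OF dM] that by simp
    qed
    obtain h0 where h0: "h0 \<in> H" "\<And>z. cmod z < 1 \<Longrightarrow> d z = z ^ Suc N * h0 z"
      using H_division_power[OF zH M_H[OF dM] d0] by blast
    define h where "h = (\<lambda>z. h0 z * g z - G z * d z)"
    have hM: "h \<in> M" unfolding h_def by (intro M_diff M_ideal[OF alg] h0 G g dM)
    have dh: "d w = w * h w" if w: "cmod w < 1" for w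
    proof -
      have "g w = w ^ N * (1 + w * G w)" using g1(2)[OF w] G(2)[OF w] by (simp add: algebra_simps)
      then show ?thesis unfolding h_def h0(2)[OF w] by (simp add: algebra_simps)
    qed
    have dH: "d \<in> H" and zhH: "(\<lambda>z. z * h z) \<in> H" using dM hM by (auto intro: M_H M_z)
    \<comment> \<open>\<open>d\<close> is orthogonal to \<open>zM\<close> and agrees on the disc
      with the element \<open>z h\<close> of \<open>zM\<close>, hence it has norm 0.\<close>
    have "ip d (\<lambda>z. z * h z) = ip f (\<lambda>z. z * h z) + (- tcoeff f N) * ip k (\<lambda>z. z * h z)"
    proof -
      have "ip d (\<lambda>z. z * h z) = ip (\<lambda>z. f z + (- tcoeff f N) * k z) (\<lambda>z. z * h z)" by (simp add: d_def)
      also have "\<dots> = ip f (\<lambda>z. z * h z) + ip (\<lambda>z. (- tcoeff f N) * k z) (\<lambda>z. z * h z)"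
        by (intro ip_add_left M_H fM zhH M_cmult kM)
      finally show ?thesis unfolding ip_cmult_left[OF k(1) zhH] .
    qed
    then have "ip d (\<lambda>z. z * h z) = 0" using fo[OF hM] orth[OF hM] by simp
    moreover have "ip d d = ip d (\<lambda>z. z * h z)" by (rule ip_cong[OF dH refl dH dh])
    ultimately have "q d = 0" using ip_self[OF dH] by simp
    from q_eq_0D[OF dH this z] show ?thesis by (simp add: d_def)
  qed
  have "k \<in> wandering m \<mu>s M" using kM orth by (auto simp: wandering_def)
  moreover have "\<exists>z\<in>ball 0 1. k z \<noteq> 0"
  proof (rule ccontr)
    assume "\<not> ?thesis"
    then have "tcoeff k N = tcoeff (\<lambda>_. 0) N" by (intro tcoeff_cong M_hol[OF kM]) auto
    then show False using kN by (simp add: tcoeff_def)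
  qed
  ultimately show ?thesis
    unfolding dim_one_def
    by (intro bexI[of _ k] conjI ballI exI[of _ "tcoeff f N" for f]) (auto intro: spanned)
qed

end

section \<open>The algebra property\<close>

text \<open>On the circle of radius \<open>r\<close> the conjugate power equals
  \<open>r^(2n) / e^n\<close>, so this is Cauchy's formula for the \<open>n\<close>-th derivative,
  in a form suited to products with conjugates of polynomials.\<close>

lemma circle_coefficient:
  assumes F: "hol F" and r: "0 < r" "r < 1"
  defines "e \<equiv> \<lambda>t::real. of_real r * exp (2 * of_real pi * \<i> * of_real t)"
  shows "((\<lambda>t. F (e t) * cnj (e t) ^ n) has_integral (tcoeff F n * of_real (r ^ (2 * n)))) {0..1}"
proof -
  have sub: "cball 0 r \<subseteq> ball (0::complex) 1" using r by auto
  have "((\<lambda>u. F u / (u - 0) ^ Suc n) has_contour_integral ((2 * pi * \<i>) / (fact n) * (deriv ^^ n) F 0)) (circlepath 0 r)"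
    using r sub ball_subset_cball
    by (intro Cauchy_has_contour_integral_higher_derivative_circlepath holomorphic_on_imp_continuous_on holomorphic_on_subset[OF F]) auto
  then have "((\<lambda>t. F (e t) / e t ^ n * (2 * of_real pi * \<i>)) has_integral ((2 * pi * \<i>) / (fact n) * (deriv ^^ n) F 0)) {0..1}"
    unfolding has_contour_integral_def
  proof (rule has_integral_eq[rotated], goal_cases)
    case (1 t)
    have "e t \<noteq> 0" using r by (simp add: e_def)
    moreover have "vector_derivative (circlepath 0 r) (at t within {0..1}) = 2 * of_real pi * \<i> * e t"
      using 1 by (subst vector_derivative_circlepath01) (auto simp: e_def)
    moreover have "circlepath 0 r t = e t" by (simp add: circlepath e_def)
    ultimately show ?case by simp
  qed
  from has_integral_mult_left[OF this, of "of_real (r ^ (2 * n)) / (2 * of_real pi * \<i>)"]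
  have "((\<lambda>t. F (e t) / e t ^ n * of_real (r ^ (2 * n))) has_integral (tcoeff F n * of_real (r ^ (2 * n)))) {0..1}"
    by (simp add: tcoeff_def field_simps)
  moreover have "F (e t) / e t ^ n * of_real (r ^ (2 * n)) = F (e t) * cnj (e t) ^ n" for t
  proof -
    have "e t \<noteq> 0" using r by (simp add: e_def)
    moreover have "e t * cnj (e t) = of_real (r\<^sup>2)"
      using complex_norm_square[of "e t"] r by (simp add: e_def norm_mult)
    then have "of_real (r ^ (2 * n)) = e t ^ n * cnj (e t) ^ n"
      by (simp add: power_mult power_mult_distrib[symmetric])
    ultimately show ?thesis by simp
  qed
  ultimately show ?thesis by simp
qed

text \<open>Bessel's inequality: for a Taylor polynomial \<open>S\<close>,
  \<open>2 Re (F * cnj S) - |S|^2 \<le> |F|^2 \<le> B^2\<close> on each circle, and the left side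
  has mean equal to a partial sum of \<open>|tcoeff F n|^2 * r^(2n)\<close>. Then \<open>r\<close>
  tends to 1.\<close>

lemma bounded_hol_in_H2:
  assumes F: "hol F" and B: "\<And>z. cmod z < 1 \<Longrightarrow> cmod (F z) \<le> B"
  shows "F \<in> H2"
proof -
  have part: "(\<Sum>n<N. (cmod (tcoeff F n))\<^sup>2 * r ^ (2 * n)) \<le> B\<^sup>2" if r: "0 < r" "r < 1" for N r
  proof -
    define e where "e = (\<lambda>t::real. of_real r * exp (2 * of_real pi * \<i> * of_real t))"
    define S where "S = (\<lambda>z. \<Sum>n<N. tcoeff F n * z ^ n)"
    define A where "A = (\<Sum>n<N. (cmod (tcoeff F n))\<^sup>2 * r ^ (2 * n))"
    have S: "hol S" unfolding S_def by (intro holomorphic_intros)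
    \<comment> \<open>To be applied to \<open>F\<close> and to \<open>S\<close>, which share the
      first \<open>N\<close> coefficients, so both means equal \<open>A\<close>.\<close>
    have int: "((\<lambda>t. G (e t) * cnj (S (e t))) has_integral of_real A) {0..1}"
      if G: "hol G" "\<And>n. n < N \<Longrightarrow> tcoeff G n = tcoeff F n" for G
    proof -
      have "((\<lambda>t. \<Sum>n<N. (G (e t) * cnj (e t) ^ n) * cnj (tcoeff F n)) has_integral
          (\<Sum>n<N. (tcoeff G n * of_real (r ^ (2 * n))) * cnj (tcoeff F n))) {0..1}"
        unfolding e_def by (intro has_integral_sum has_integral_mult_left circle_coefficient G r) auto
      moreover have "(\<Sum>n<N. (tcoeff G n * of_real (r ^ (2 * n))) * cnj (tcoeff F n)) = of_real A"
        unfolding A_def of_real_sum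
      proof (intro sum.cong refl)
        fix n assume "n \<in> {..<N}"
        then show "tcoeff G n * of_real (r ^ (2 * n)) * cnj (tcoeff F n) = of_real ((cmod (tcoeff F n))\<^sup>2 * r ^ (2 * n))"
          using complex_norm_square[of "tcoeff F n"] G(2)[of n] by (simp add: mult_ac)
      qed
      moreover have "(\<Sum>n<N. (G (e t) * cnj (e t) ^ n) * cnj (tcoeff F n)) = G (e t) * cnj (S (e t))" for t
        by (simp add: S_def sum_distrib_left mult_ac)
      ultimately show ?thesis by simp
    qed
    have i: "((\<lambda>t. Re (2 * (F (e t) * cnj (S (e t))) - S (e t) * cnj (S (e t)))) has_integral Re (2 * of_real A - of_real A)) {0..1}"
      by (intro has_integral_Re has_integral_diff has_integral_mult_right int[OF F refl] int[OF S])
         (simp add: S_def tcoeff_poly)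
    have "Re (2 * of_real A - of_real A) \<le> B\<^sup>2 * (1 - 0)"
    proof (rule has_integral_le[OF i])
      show "((\<lambda>t. B\<^sup>2) has_integral B\<^sup>2 * (1 - 0)) {0..1::real}"
        using has_integral_const_real[of "B\<^sup>2" 0 1] by simp
      fix t :: real assume "t \<in> {0..1}"
      have "cmod (e t) < 1" using r by (simp add: e_def norm_mult)
      then have "(cmod (F (e t)))\<^sup>2 \<le> B\<^sup>2" using B by (intro power_mono) auto
      moreover have "0 \<le> (cmod (F (e t) - S (e t)))\<^sup>2" by simp
      then have "Re (2 * (F (e t) * cnj (S (e t))) - S (e t) * cnj (S (e t))) \<le> (cmod (F (e t)))\<^sup>2"
        unfolding cmod_power2 by (simp add: power2_eq_square algebra_simps)
      ultimately show "Re (2 * (F (e t) * cnj (S (e t))) - S (e t) * cnj (S (e t))) \<le> B\<^sup>2" by linarith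
    qed
    then show ?thesis by (simp add: A_def)
  qed
  have "(\<Sum>n<N. (cmod (tcoeff F n))\<^sup>2) \<le> B\<^sup>2" for N
  proof (rule tendsto_upperbound)
    define r where "r k = 1 - 1 / real (k + 2)" for k
    have rlim: "r \<longlonglongrightarrow> 1"
      using tendsto_diff[OF tendsto_const LIMSEQ_ignore_initial_segment[OF lim_1_over_n, of 2], of "1::real"]
      by (simp add: r_def[abs_def])
    have "(\<lambda>k. \<Sum>n<N. (cmod (tcoeff F n))\<^sup>2 * r k ^ (2 * n)) \<longlonglongrightarrow> (\<Sum>n<N. (cmod (tcoeff F n))\<^sup>2 * 1 ^ (2 * n))"
      by (intro tendsto_intros rlim)
    then show "(\<lambda>k. \<Sum>n<N. (cmod (tcoeff F n))\<^sup>2 * r k ^ (2 * n)) \<longlonglongrightarrow> (\<Sum>n<N. (cmod (tcoeff F n))\<^sup>2)" by simp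
    show "\<forall>\<^sub>F k in sequentially. (\<Sum>n<N. (cmod (tcoeff F n))\<^sup>2 * r k ^ (2 * n)) \<le> B\<^sup>2"
      by (intro always_eventually allI part) (auto simp: r_def field_simps)
  qed simp
  then have "summable (\<lambda>n. (cmod (tcoeff F n))\<^sup>2)"
    by (intro summableI_nonneg_bounded) auto
  with F show ?thesis by (simp add: H2_def)
qed

text \<open>The derivative bound is integrated along the radius. The sign of \<open>p\<close> is
  left open: a positive \<open>p\<close> lowers the growth exponent by one, while
  \<open>p = - 1/2\<close> yields boundedness.\<close>

lemma radial_growth:
  assumes G: "hol G" and p: "p \<noteq> 0"
    and K: "\<And>z. cmod z < 1 \<Longrightarrow> cmod (deriv G z) \<le> K * (1 - cmod z) powr (- (p + 1))"
    and z: "cmod z < 1"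
  shows "cmod (G z) \<le> cmod (G 0) + K / p * ((1 - cmod z) powr (- p) - 1)"
proof -
  define r where "r = cmod z"
  have sz: "cmod (of_real s * z) = s * r" "s * r < 1" if "0 \<le> s" "s \<le> 1" for s :: real
    using that z mult_left_le_one_le[of r s] by (auto simp: r_def norm_mult)
  have "norm (G (of_real 1 * z) - G (of_real 0 * z)) \<le> K / p * (1 - 1 * r) powr (- p) - K / p * (1 - 0 * r) powr (- p)"
  proof (rule differentiable_bound_general[where f' = "\<lambda>s. z * deriv G (of_real s * z)" and \<phi>' = "\<lambda>s. K * r * (1 - s * r) powr (- p - 1)"])
    show "continuous_on {0..1} (\<lambda>s. G (of_real s * z))"
      by (intro continuous_on_compose2[OF holomorphic_on_imp_continuous_on[OF G]] continuous_intros) (use sz in auto)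
    show "continuous_on {0..1} (\<lambda>s. K / p * (1 - s * r) powr (- p))"
      using sz(2) by (intro continuous_intros) (force simp: less_le)
    fix s :: real assume s: "0 < s" "s < 1"
    have szb: "of_real s * z \<in> ball 0 1" using sz[of s] s by simp
    have "(G has_field_derivative deriv G (of_real s * z)) (at (of_real s * z))"
      using holomorphic_derivI[OF G _ szb] by simp
    then have "((\<lambda>u. G (u * z)) has_field_derivative deriv G (of_real s * z) * z) (at (of_real s))"
      by (rule DERIV_chain2[where f = G and g = "\<lambda>u. u * z"]) (auto intro!: derivative_eq_intros)
    from has_vector_derivative_real_field[OF this]
    show "((\<lambda>s. G (of_real s * z)) has_vector_derivative z * deriv G (of_real s * z)) (at s)"
      by (simp add: o_def mult.commute)
    have "((\<lambda>s. (1 - s * r) powr (- p)) has_real_derivative (- p) * (1 - s * r) powr (- p - 1) * (- r)) (at s)"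
      using sz(2)[of s] s by (auto intro!: derivative_eq_intros)
    from DERIV_cmult[OF this, of "K / p"]
    show "((\<lambda>s. K / p * (1 - s * r) powr (- p)) has_vector_derivative K * r * (1 - s * r) powr (- p - 1)) (at s)"
      using p by (simp add: has_real_derivative_iff_has_vector_derivative[symmetric] mult_ac)
    have "cmod (deriv G (of_real s * z)) \<le> K * (1 - s * r) powr (- (p + 1))"
      using K[of "of_real s * z"] sz[of s] s by simp
    then have "r * cmod (deriv G (of_real s * z)) \<le> r * (K * (1 - s * r) powr (- (p + 1)))"
      by (intro mult_left_mono) (auto simp: r_def)
    then show "norm (z * deriv G (of_real s * z)) \<le> K * r * (1 - s * r) powr (- p - 1)"
      by (simp add: norm_mult r_def mult_ac)
  qed simp
  then have "cmod (G z - G 0) \<le> K / p * ((1 - cmod z) powr (- p) - 1)"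
    by (simp add: r_def algebra_simps)
  then show ?thesis using norm_triangle_sub[of "G z" "G 0"] by linarith
qed

section \<open>Pointwise growth and mixed terms in the weighted integrals\<close>

context circle_meas
begin

lemma total_mass_pos:
  assumes "\<mu> \<noteq> null_measure borel"
  shows "measure \<mu> (space \<mu>) > 0"
proof (rule ccontr)
  assume "\<not> ?thesis"
  then have "measure \<mu> (space \<mu>) = 0" using measure_nonneg[of \<mu> "space \<mu>"] by linarith
  then have 0: "emeasure \<mu> (space \<mu>) = 0" by (simp add: emeasure_eq_measure)
  have "\<mu> = null_measure borel"
  proof (rule measure_eqI)
    fix A assume "A \<in> sets \<mu>"
    then have "emeasure \<mu> A \<le> 0" using emeasure_mono[OF sets.sets_into_space sets.top] 0 by metis
    then show "emeasure \<mu> A = emeasure (null_measure borel) A" by simp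
  qed (simp add: sets_mu)
  with assms show False by simp
qed

text \<open>Since \<open>P\<^sub>\<mu>\<close> dominates a multiple of \<open>1 - \<bar>z\<bar>\<^sup>2\<close>, finiteness of the weighted norm gives pointwise growth
  through the area mean value inequality.\<close>

lemma L2w_pointwise:
  assumes nz: "\<mu> \<noteq> null_measure borel" and F: "hol F" and fin: "L2w \<mu> a F < \<infinity>"
  obtains K where "\<And>z. cmod z < 1 \<Longrightarrow> (cmod (F z))\<^sup>2 \<le> K * (1 / (1 - cmod z)) ^ (a + 3)"
proof -
  define c where "c = measure \<mu> (space \<mu>) / 4"
  have c: "c > 0" using total_mass_pos[OF nz] by (simp add: c_def)
  define L where "L = enn2real (L2w \<mu> a F)"
  have L: "L2w \<mu> a F = ennreal L" "0 \<le> L" using fin by (simp_all add: L_def less_top)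
  show ?thesis
  proof (rule that)
    fix z assume z: "cmod z < 1"
    \<comment> \<open>On the disc of this radius about \<open>z\<close> the weight is at least
      \<open>c * \<rho>^(a+1)\<close>, and the area contributes \<open>\<rho>^2\<close>; together
      they give the exponent \<open>a + 3\<close>.\<close>
    define \<rho> where "\<rho> = (1 - cmod z) / 2"
    have \<rho>: "\<rho> > 0" using z by (simp add: \<rho>_def)
    have near: "cmod x < 1 \<and> \<rho> \<le> 1 - cmod x" if "x \<in> ball z \<rho>" for x
      using that norm_triangle_sub[of x z] \<rho> by (simp add: dist_norm norm_minus_commute \<rho>_def)
    have sub: "ball z \<rho> \<subseteq> ball 0 1" using near by auto
    have "ennreal (c * \<rho> ^ (a + 1)) * (ennreal (pi * \<rho>\<^sup>2) * ennreal ((cmod (F z))\<^sup>2))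
      \<le> ennreal (c * \<rho> ^ (a + 1)) * (\<integral>\<^sup>+x\<in>ball z \<rho>. ennreal ((cmod (F x))\<^sup>2) \<partial>lborel)"
      by (intro mult_left_mono holomorphic_area_mean_le holomorphic_on_subset[OF F sub] \<rho>) simp
    also have "\<dots> = (\<integral>\<^sup>+x. ennreal (c * \<rho> ^ (a + 1)) * (ennreal ((cmod (F x))\<^sup>2) * indicator (ball z \<rho>) x) \<partial>lborel)"
    proof (rule nn_integral_cmult[symmetric])
      note measurable_indicator_continuous[OF holomorphic_on_imp_continuous_on[OF F], measurable]
      have "(\<lambda>x. ennreal ((cmod (indicator (ball 0 1) x *\<^sub>R F x))\<^sup>2) * indicator (ball z \<rho>) x) \<in> borel_measurable lborel"
        by measurable
      also have "(\<lambda>x. ennreal ((cmod (indicator (ball 0 1) x *\<^sub>R F x))\<^sup>2) * indicator (ball z \<rho>) x) = (\<lambda>x. ennreal ((cmod (F x))\<^sup>2) * indicator (ball z \<rho>) x)"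
        using sub by (auto simp: fun_eq_iff indicator_def)
      finally show "(\<lambda>x. ennreal ((cmod (F x))\<^sup>2) * indicator (ball z \<rho>) x) \<in> borel_measurable lborel" .
    qed
    also have "\<dots> \<le> L2w \<mu> a F"
      unfolding L2w_wt
    proof (rule nn_integral_mono)
      fix x
      show "ennreal (c * \<rho> ^ (a + 1)) * (ennreal ((cmod (F x))\<^sup>2) * indicator (ball z \<rho>) x) \<le> ennreal ((cmod (F x))\<^sup>2 * wt a x) * indicator (ball 0 1) x"
      proof (cases "x \<in> ball z \<rho>")
        case True
        note x = near[OF True]
        have t: "\<rho> \<le> 1 - (cmod x)\<^sup>2" using one_minus_norm_sq_bounds(1)[of x] x by simp
        have "c * \<rho> ^ (a + 1) \<le> c * (1 - (cmod x)\<^sup>2) ^ (a + 1)"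
          using t \<rho> c by (intro mult_left_mono power_mono) auto
        also have "\<dots> = (c * (1 - (cmod x)\<^sup>2)) * (1 - (cmod x)\<^sup>2) ^ a" by simp
        also have "\<dots> \<le> wt a x"
          unfolding wt_def c_def using Poisson_lower[of x] x t \<rho> by (intro mult_right_mono) auto
        finally have "(cmod (F x))\<^sup>2 * (c * \<rho> ^ (a + 1)) \<le> (cmod (F x))\<^sup>2 * wt a x" by (intro mult_left_mono) auto
        then show ?thesis using True x \<rho> c by (simp add: ennreal_mult[symmetric] ennreal_leI mult_ac)
      qed simp
    qed
    finally have "ennreal (c * \<rho> ^ (a + 1) * (pi * \<rho>\<^sup>2 * (cmod (F z))\<^sup>2)) \<le> ennreal L"
      using c \<rho> by (simp add: L ennreal_mult[symmetric])
    then have "c * \<rho> ^ (a + 1) * (pi * \<rho>\<^sup>2 * (cmod (F z))\<^sup>2) \<le> L" using L(2) by (simp add: ennreal_le_iff)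
    then have "(c * pi * \<rho> ^ (a + 3)) * (cmod (F z))\<^sup>2 \<le> L"
      by (simp add: power_add power2_eq_square numeral_3_eq_3 mult_ac)
    then have "(cmod (F z))\<^sup>2 \<le> L / (c * pi * \<rho> ^ (a + 3))"
      using c \<rho> by (simp add: pos_le_divide_eq mult.commute)
    also have "\<dots> = (L / (c * pi) * 2 ^ (a + 3)) * (1 / (1 - cmod z)) ^ (a + 3)"
      by (simp add: \<rho>_def power_divide)
    finally show "(cmod (F z))\<^sup>2 \<le> (L / (c * pi) * 2 ^ (a + 3)) * (1 / (1 - cmod z)) ^ (a + 3)" .
  qed
qed

lemma L2w_mult_bounded:
  assumes F: "hol F" and fin: "L2w \<mu> a F < \<infinity>"
    and G: "\<And>z. cmod z < 1 \<Longrightarrow> (cmod (G z))\<^sup>2 * (1 - (cmod z)\<^sup>2) ^ b \<le> C"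
  shows "L2w \<mu> (a + b) (\<lambda>z. F z * G z) < \<infinity>"
proof -
  have "L2w \<mu> (a + b) (\<lambda>z. F z * G z) \<le> (\<integral>\<^sup>+z. ennreal C * (ennreal ((cmod (F z))\<^sup>2 * wt a z) * indicator (ball 0 1) z) \<partial>lborel)"
    unfolding L2w_wt
  proof (rule nn_integral_mono)
    fix z
    show "ennreal ((cmod (F z * G z))\<^sup>2 * wt (a + b) z) * indicator (ball 0 1) z \<le> ennreal C * (ennreal ((cmod (F z))\<^sup>2 * wt a z) * indicator (ball 0 1) z)"
    proof (cases "cmod z < 1")
      case True
      note w = wt_nonneg[OF True, of a]
      have C0: "0 \<le> C" by (rule order_trans[OF _ G[OF True]]) (use True in \<open>simp add: power_le_one\<close>)
      have "(cmod (F z * G z))\<^sup>2 * wt (a + b) z = ((cmod (G z))\<^sup>2 * (1 - (cmod z)\<^sup>2) ^ b) * ((cmod (F z))\<^sup>2 * wt a z)"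
        by (simp add: wt_Suc norm_mult power_mult_distrib)
      also have "\<dots> \<le> C * ((cmod (F z))\<^sup>2 * wt a z)" using w by (intro mult_right_mono G True) auto
      finally show ?thesis using True w C0 by (simp add: ennreal_mult[symmetric] ennreal_leI)
    qed simp
  qed
  also have "\<dots> = ennreal C * L2w \<mu> a F"
    unfolding L2w_wt using L2w_measurable[OF holomorphic_on_imp_continuous_on[OF F], of a] by (intro nn_integral_cmult) simp
  also have "\<dots> < \<infinity>" using fin by (simp add: ennreal_mult_less_top)
  finally show ?thesis .
qed

lemma L2w_sum_finite:
  assumes "finite I" "\<And>i. i \<in> I \<Longrightarrow> hol (F i)" "\<And>i. i \<in> I \<Longrightarrow> L2w \<mu> a (F i) < \<infinity>"
  shows "L2w \<mu> a (\<lambda>z. \<Sum>i\<in>I. F i z) < \<infinity>"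
  using assms
proof (induction I)
  case empty
  show ?case by (simp add: L2w_wt)
next
  case (insert i I)
  then have "L2w \<mu> a (\<lambda>z. F i z + (\<Sum>i\<in>I. F i z)) < \<infinity>"
    by (intro L2w_add_finite(1)) (auto intro!: holomorphic_intros)
  then show ?case using insert by simp
qed

text \<open>Hardy's inequality raises the order of one factor at a time, until one of the derivatives has order \<open>j\<close>
  and the other factor can be estimated pointwise.\<close>

lemma L2w_mixed:
  assumes f: "hol f" and g: "hol g"
    and fin: "L2w \<mu> (j - 1) ((deriv ^^ j) f) < \<infinity>" "L2w \<mu> (j - 1) ((deriv ^^ j) g) < \<infinity>"
    and bf: "\<And>l z. 1 \<le> l \<Longrightarrow> l \<le> j \<Longrightarrow> cmod z < 1 \<Longrightarrow> (cmod ((deriv ^^ l) f z))\<^sup>2 * (1 - (cmod z)\<^sup>2) ^ (2 * l - 1) \<le> C"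
    and bg: "\<And>l z. 1 \<le> l \<Longrightarrow> l \<le> j \<Longrightarrow> cmod z < 1 \<Longrightarrow> (cmod ((deriv ^^ l) g z))\<^sup>2 * (1 - (cmod z)\<^sup>2) ^ (2 * l - 1) \<le> C"
    and kl: "1 \<le> k" "1 \<le> l" "k \<le> j" "l \<le> j" "j + 2 \<le> 2 * (k + l)"
  shows "L2w \<mu> (2 * (k + l) - j - 1) (\<lambda>z. (deriv ^^ k) f z * (deriv ^^ l) g z) < \<infinity>"
  using kl
\<comment> \<open>Differentiating either factor raises \<open>k + l\<close> by 1 and the weight
  exponent by 2, exactly the exchange rate of Hardy's inequality. The induction measure counts the
  derivatives missing from the orders \<open>(j, j)\<close>.\<close>
proof (induction "2 * j - (k + l)" arbitrary: k l rule: less_induct)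
  case less
  consider "k = j" | "l = j" | "k < j" "l < j" using less.prems by linarith
  then show ?case
  proof cases
    case 1
    \<comment> \<open>The pointwise bound for the second factor uses the exponent
      \<open>2 * l - 1\<close>, one better than required; the surplus is dropped in the next
      step.\<close>
    have "L2w \<mu> ((j - 1) + (2 * l - 1)) (\<lambda>z. (deriv ^^ j) f z * (deriv ^^ l) g z) < \<infinity>"
      by (rule L2w_mult_bounded[OF hol_higher_deriv[OF f] fin(1)]) (rule bg[OF less.prems(2,4)])
    then have "L2w \<mu> ((j - 1) + 2 * l) (\<lambda>z. (deriv ^^ j) f z * (deriv ^^ l) g z) < \<infinity>"
      by (rule order_le_less_trans[OF L2w_antimono, rotated]) simp
    moreover have "2 * (k + l) - j - 1 = (j - 1) + 2 * l" using 1 less.prems by simp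
    ultimately show ?thesis using 1 by simp
  next
    case 2
    have "L2w \<mu> ((j - 1) + (2 * k - 1)) (\<lambda>z. (deriv ^^ j) g z * (deriv ^^ k) f z) < \<infinity>"
      by (rule L2w_mult_bounded[OF hol_higher_deriv[OF g] fin(2)]) (rule bf[OF less.prems(1,3)])
    then have "L2w \<mu> ((j - 1) + 2 * k) (\<lambda>z. (deriv ^^ j) g z * (deriv ^^ k) f z) < \<infinity>"
      by (rule order_le_less_trans[OF L2w_antimono, rotated]) simp
    moreover have "2 * (k + l) - j - 1 = (j - 1) + 2 * k" using 2 less.prems by simp
    ultimately show ?thesis using 2 by (simp add: mult.commute)
  next
    case 3
    let ?a = "2 * (k + l) - j - 1"
    let ?h = "\<lambda>z. (deriv ^^ k) f z * (deriv ^^ l) g z"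
    have hf: "hol ((deriv ^^ i) f)" and hg: "hol ((deriv ^^ i) g)" for i
      by (rule hol_higher_deriv, rule f) (rule hol_higher_deriv, rule g)
    have e: "2 * (Suc k + l) - j - 1 = ?a + 2" "2 * (k + Suc l) - j - 1 = ?a + 2" using less.prems by simp_all
    have "L2w \<mu> (?a + 2) (\<lambda>z. (deriv ^^ Suc k) f z * (deriv ^^ l) g z) < \<infinity>"
      using less.hyps[of "Suc k" l] less.prems 3 unfolding e by simp
    moreover have "L2w \<mu> (?a + 2) (\<lambda>z. (deriv ^^ k) f z * (deriv ^^ Suc l) g z) < \<infinity>"
      using less.hyps[of k "Suc l"] less.prems 3 unfolding e by simp
    ultimately have "L2w \<mu> (?a + 2) (\<lambda>z. (deriv ^^ Suc k) f z * (deriv ^^ l) g z + (deriv ^^ k) f z * (deriv ^^ Suc l) g z) < \<infinity>"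
      by (rule L2w_add_finite(1)[OF holomorphic_on_mult[OF hf hg] holomorphic_on_mult[OF hf hg]])
    also have "L2w \<mu> (?a + 2) (\<lambda>z. (deriv ^^ Suc k) f z * (deriv ^^ l) g z + (deriv ^^ k) f z * (deriv ^^ Suc l) g z) = L2w \<mu> (?a + 2) (deriv ?h)"
    proof (rule L2w_cong)
      fix z :: complex assume z: "cmod z < 1"
      have "((deriv ^^ k) f has_field_derivative (deriv ^^ Suc k) f z) (at z)"
        "((deriv ^^ l) g has_field_derivative (deriv ^^ Suc l) g z) (at z)"
        using holomorphic_derivI[OF hf[of k], of z] holomorphic_derivI[OF hg[of l], of z] z by simp_all
      from DERIV_imp_deriv[OF DERIV_mult[OF this]]
      show "(deriv ^^ Suc k) f z * (deriv ^^ l) g z + (deriv ^^ k) f z * (deriv ^^ Suc l) g z = deriv ?h z"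
        by (simp add: mult.commute)
    qed
    \<comment> \<open>\<open>j + 2 \<le> 2 * (k + l)\<close> says that the exponent is at least 1,
      as Hardy's inequality demands.\<close>
    finally show ?thesis
      using less.prems by (intro L2w_hardy[OF holomorphic_on_mult[OF hf hg]]) auto
  qed
qed

text \<open>In the Leibniz formula the extreme terms are controlled by boundedness of
  \<open>f\<close> and \<open>g\<close>. The others have orders with sum \<open>j\<close>, for which
  the mixed-term exponent \<open>2 * j - j - 1\<close> is exactly \<open>j - 1\<close>; they occur
  only for \<open>j \<ge> 2\<close>, where \<open>j + 2 \<le> 2 * j\<close>.\<close>

lemma L2w_product:
  assumes f: "hol f" and g: "hol g"
    and fin: "L2w \<mu> (j - 1) ((deriv ^^ j) f) < \<infinity>" "L2w \<mu> (j - 1) ((deriv ^^ j) g) < \<infinity>"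
    and bf: "\<And>l z. 1 \<le> l \<Longrightarrow> l \<le> j \<Longrightarrow> cmod z < 1 \<Longrightarrow> (cmod ((deriv ^^ l) f z))\<^sup>2 * (1 - (cmod z)\<^sup>2) ^ (2 * l - 1) \<le> C"
    and bg: "\<And>l z. 1 \<le> l \<Longrightarrow> l \<le> j \<Longrightarrow> cmod z < 1 \<Longrightarrow> (cmod ((deriv ^^ l) g z))\<^sup>2 * (1 - (cmod z)\<^sup>2) ^ (2 * l - 1) \<le> C"
    and b0: "\<And>z. cmod z < 1 \<Longrightarrow> cmod (f z) \<le> B" "\<And>z. cmod z < 1 \<Longrightarrow> cmod (g z) \<le> B"
  shows "L2w \<mu> (j - 1) ((deriv ^^ j) (\<lambda>z. f z * g z)) < \<infinity>"
proof -
  have hf: "hol ((deriv ^^ i) f)" and hg: "hol ((deriv ^^ i) g)" for i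
    by (rule hol_higher_deriv, rule f) (rule hol_higher_deriv, rule g)
  have eq: "L2w \<mu> (j - 1) ((deriv ^^ j) (\<lambda>z. f z * g z))
    = L2w \<mu> (j - 1) (\<lambda>z. \<Sum>i=0..j. of_nat (j choose i) * ((deriv ^^ i) f z * (deriv ^^ (j - i)) g z))"
  proof (rule L2w_cong)
    fix z :: complex assume "cmod z < 1"
    then have "(deriv ^^ j) (\<lambda>z. f z * g z) z = (\<Sum>i=0..j. of_nat (j choose i) * (deriv ^^ i) f z * (deriv ^^ (j - i)) g z)"
      by (intro higher_deriv_mult[of _ "ball 0 1"] f g) auto
    then show "(deriv ^^ j) (\<lambda>z. f z * g z) z = (\<Sum>i=0..j. of_nat (j choose i) * ((deriv ^^ i) f z * (deriv ^^ (j - i)) g z))"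
      by (simp add: mult.assoc)
  qed
  have summand: "L2w \<mu> (j - 1) (\<lambda>z. (deriv ^^ i) f z * (deriv ^^ (j - i)) g z) < \<infinity>" if i: "i \<le> j" for i
  proof -
    have sq: "(cmod (u z))\<^sup>2 * (1 - (cmod z)\<^sup>2) ^ 0 \<le> B\<^sup>2" if "cmod z < 1" "\<And>z. cmod z < 1 \<Longrightarrow> cmod (u z) \<le> B" for u z
      using that by (simp add: power_mono)
    consider "i = 0" | "i = j" | "1 \<le> i" "1 \<le> j - i" using i by linarith
    then show ?thesis
    proof cases
      case 1
      have "L2w \<mu> ((j - 1) + 0) (\<lambda>z. (deriv ^^ j) g z * f z) < \<infinity>"
        by (rule L2w_mult_bounded[OF hg fin(2)]) (rule sq[OF _ b0(1)])
      then show ?thesis using 1 by (simp add: mult.commute)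
    next
      case 2
      have "L2w \<mu> ((j - 1) + 0) (\<lambda>z. (deriv ^^ j) f z * g z) < \<infinity>"
        by (rule L2w_mult_bounded[OF hf fin(1)]) (rule sq[OF _ b0(2)])
      then show ?thesis using 2 by simp
    next
      case 3
      then have "i \<le> j" "j - i \<le> j" "j + 2 \<le> 2 * (i + (j - i))" by auto
      from L2w_mixed[OF f g fin bf bg 3 this] have "L2w \<mu> (2 * (i + (j - i)) - j - 1) (\<lambda>z. (deriv ^^ i) f z * (deriv ^^ (j - i)) g z) < \<infinity>" .
      moreover have "2 * (i + (j - i)) - j - 1 = j - 1" using 3 by simp
      ultimately show ?thesis by simp
    qed
  qed
  show ?thesis
    unfolding eq
  proof (rule L2w_sum_finite)
    fix i assume i: "i \<in> {0..j}"
    show "hol (\<lambda>z. of_nat (j choose i) * ((deriv ^^ i) f z * (deriv ^^ (j - i)) g z))"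
      by (rule holomorphic_on_mult[OF holomorphic_on_const holomorphic_on_mult[OF hf hg]])
    have "L2w \<mu> (j - 1) (\<lambda>z. of_nat (j choose i) * ((deriv ^^ i) f z * (deriv ^^ (j - i)) g z))
      = ennreal ((cmod (of_nat (j choose i)))\<^sup>2) * L2w \<mu> (j - 1) (\<lambda>z. (deriv ^^ i) f z * (deriv ^^ (j - i)) g z)"
      by (rule L2w_cmult[OF holomorphic_on_mult[OF hf hg]])
    then show "L2w \<mu> (j - 1) (\<lambda>z. of_nat (j choose i) * ((deriv ^^ i) f z * (deriv ^^ (j - i)) g z)) < \<infinity>"
      using summand[of i] i by (simp add: ennreal_mult_less_top)
  qed simp
qed

end

section \<open>Growth of elements of the space and closure under products\<close>

context hmu
begin

text \<open>The area-mean exponent \<open>m - 1 + 3\<close> for the \<open>m\<close>-th derivative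
  is relaxed to \<open>2 * m - 1\<close>. Integration along radii then lowers the order one step at
  a time, the square of the \<open>l\<close>-th derivative keeping the exponent
  \<open>2 * l - 1\<close>.\<close>

lemma H_growth:
  assumes m3: "3 \<le> m" and nz: "\<mu>s m \<noteq> null_measure borel" and f: "f \<in> H"
  obtains C where "\<And>z. cmod z < 1 \<Longrightarrow> cmod (f z) \<le> C"
    "\<And>l z. 1 \<le> l \<Longrightarrow> l \<le> m \<Longrightarrow> cmod z < 1 \<Longrightarrow> (cmod ((deriv ^^ l) f z))\<^sup>2 * (1 - (cmod z)\<^sup>2) ^ (2 * l - 1) \<le> C"
proof -
  interpret circle_meas "\<mu>s m" by (rule circle_meas) (use m3 in auto)
  have hf: "hol ((deriv ^^ i) f)" for i by (rule hol_higher_deriv[OF H_hol[OF f]])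
  have "L2w (\<mu>s m) (m - 1) ((deriv ^^ m) f) < \<infinity>" using f m3 by (simp add: H_iff')
  from L2w_pointwise[OF nz hf this] obtain K0
    where K0: "\<And>z. cmod z < 1 \<Longrightarrow> (cmod ((deriv ^^ m) f z))\<^sup>2 \<le> K0 * (1 / (1 - cmod z)) ^ (m - 1 + 3)" by blast
  have K0pos: "0 \<le> K0" using K0[of 0] by (auto intro: order_trans[OF zero_le_power2])
  have top: "cmod ((deriv ^^ m) f z) \<le> sqrt K0 * (1 - cmod z) powr (- (real m - 1 / 2))" if z: "cmod z < 1" for z
  proof -
    have t: "0 < 1 - cmod z" "1 \<le> 1 / (1 - cmod z)" using z by auto
    have "(cmod ((deriv ^^ m) f z))\<^sup>2 \<le> K0 * (1 / (1 - cmod z)) ^ (2 * m - 1)"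
      using K0[OF z] by (rule order_trans) (intro mult_left_mono power_increasing t K0pos, use m3 in auto)
    also have "(1 / (1 - cmod z)) ^ (2 * m - 1) = (1 - cmod z) powr (- (real (2 * m - 1)))"
      using t by (simp add: powr_minus powr_realpow power_one_over inverse_eq_divide)
    also have "\<dots> = ((1 - cmod z) powr (- (real m - 1 / 2)))\<^sup>2"
      using t m3 by (subst powr_power) (auto simp: of_nat_diff)
    finally have "(cmod ((deriv ^^ m) f z))\<^sup>2 \<le> (sqrt K0 * (1 - cmod z) powr (- (real m - 1 / 2)))\<^sup>2"
      using K0pos by (simp add: power_mult_distrib)
    then show ?thesis by (rule power2_le_imp_le) (use K0pos in simp)
  qed
  have all: "\<exists>K. \<forall>z. cmod z < 1 \<longrightarrow> cmod ((deriv ^^ l) f z) \<le> K * (1 - cmod z) powr (- (real l - 1 / 2))"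
    if l: "1 \<le> l" "l \<le> m" for l
    using l(2)
  proof (induction rule: inc_induct)
    case base
    then show ?case using top by blast
  next
    case (step n)
    have n1: "1 \<le> n" using step.hyps l by simp
    define p where "p = real n - 1 / 2"
    have p: "p > 0" using n1 by (simp add: p_def)
    from step.IH obtain K where K: "\<And>z. cmod z < 1 \<Longrightarrow> cmod ((deriv ^^ Suc n) f z) \<le> K * (1 - cmod z) powr (- (real (Suc n) - 1 / 2))" by blast
    have K0: "0 \<le> K" using order_trans[OF norm_ge_zero K[of 0]] by simp
    have "cmod ((deriv ^^ n) f z) \<le> (cmod ((deriv ^^ n) f 0) + K / p) * (1 - cmod z) powr (- p)" if z: "cmod z < 1" for z
    proof -
      have one: "1 \<le> (1 - cmod z) powr (- p)"
        using p z powr_mono'[of "- p" 0 "1 - cmod z"] by simp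
      have "cmod ((deriv ^^ n) f z) \<le> cmod ((deriv ^^ n) f 0) + K / p * ((1 - cmod z) powr (- p) - 1)"
      proof (rule radial_growth[OF hf _ _ z])
        show "cmod (deriv ((deriv ^^ n) f) w) \<le> K * (1 - cmod w) powr (- (p + 1))" if "cmod w < 1" for w
          using K[OF that] by (simp add: p_def)
      qed (use p in simp)
      also have "\<dots> \<le> cmod ((deriv ^^ n) f 0) * (1 - cmod z) powr (- p) + K / p * (1 - cmod z) powr (- p)"
        using one K0 p by (intro add_mono mult_left_mono mult_left_le) (auto simp: mult_le_cancel_left1)
      finally show ?thesis by (simp add: distrib_right)
    qed
    then show ?case unfolding p_def by blast
  qed
  then obtain K where K: "\<And>l z. 1 \<le> l \<Longrightarrow> l \<le> m \<Longrightarrow> cmod z < 1 \<Longrightarrow> cmod ((deriv ^^ l) f z) \<le> K l * (1 - cmod z) powr (- (real l - 1 / 2))"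
    by metis
  have Kpos: "0 \<le> K l" if "1 \<le> l" "l \<le> m" for l using order_trans[OF norm_ge_zero K[OF that, of 0]] by simp
  define C1 where "C1 = cmod (f 0) + 2 * K 1"
  have f0: "cmod (f z) \<le> C1" if z: "cmod z < 1" for z
  proof -
    \<comment> \<open>Here \<open>p = - 1/2\<close>: the first derivative grows at most like
      \<open>(1 - |w|)^(-1/2)\<close>, which is integrable along radii.\<close>
    have "cmod (f z) \<le> cmod (f 0) + K 1 / (- (1 / 2)) * ((1 - cmod z) powr (- (- (1 / 2))) - 1)"
    proof (rule radial_growth[OF H_hol[OF f] _ _ z])
      show "cmod (deriv f w) \<le> K 1 * (1 - cmod w) powr (- (- (1 / 2) + 1))" if "cmod w < 1" for w
        using K[of 1 w] that m3 by simp
    qed simp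
    also have "\<dots> = cmod (f 0) + 2 * K 1 * (1 - (1 - cmod z) powr (1 / 2))" by (simp add: algebra_simps)
    also have "\<dots> \<le> C1" unfolding C1_def using Kpos[of 1] m3 by (intro add_left_mono mult_left_le) auto
    finally show ?thesis .
  qed
  \<comment> \<open>The sum dominates each of its nonnegative terms and so gives one constant for
    all orders.\<close>
  define C2 where "C2 = (\<Sum>l=1..m. (K l)\<^sup>2 * 2 ^ (2 * l - 1))"
  have fl: "(cmod ((deriv ^^ l) f z))\<^sup>2 * (1 - (cmod z)\<^sup>2) ^ (2 * l - 1) \<le> C2" if l: "1 \<le> l" "l \<le> m" and z: "cmod z < 1" for l z
  proof -
    have t: "0 < 1 - cmod z" using z by simp
    have "(cmod ((deriv ^^ l) f z))\<^sup>2 \<le> (K l * (1 - cmod z) powr (- (real l - 1 / 2)))\<^sup>2"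
      by (intro power_mono K l z) simp
    also have "\<dots> = (K l)\<^sup>2 * (1 - cmod z) powr (- real (2 * l - 1))"
    proof -
      have "((1 - cmod z) powr (- (real l - 1 / 2)))\<^sup>2 = (1 - cmod z) powr (- real (2 * l - 1))"
        using t l by (subst powr_power) (auto simp: of_nat_diff)
      then show ?thesis by (simp add: power_mult_distrib)
    qed
    finally have 1: "(cmod ((deriv ^^ l) f z))\<^sup>2 \<le> (K l)\<^sup>2 * (1 - cmod z) powr (- real (2 * l - 1))" .
    have 2: "(1 - (cmod z)\<^sup>2) ^ (2 * l - 1) \<le> (2 * (1 - cmod z)) ^ (2 * l - 1)"
      using one_minus_norm_sq_bounds(2)[of z] z by (intro power_mono) (auto simp: power_le_one)
    have "(cmod ((deriv ^^ l) f z))\<^sup>2 * (1 - (cmod z)\<^sup>2) ^ (2 * l - 1)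
      \<le> ((K l)\<^sup>2 * (1 - cmod z) powr (- real (2 * l - 1))) * (2 * (1 - cmod z)) ^ (2 * l - 1)"
      using z by (intro mult_mono 1 2) (auto simp: power_le_one)
    also have "\<dots> = (K l)\<^sup>2 * 2 ^ (2 * l - 1)"
    proof -
      have "(1 - cmod z) powr (- real (2 * l - 1)) * (1 - cmod z) ^ (2 * l - 1) = 1"
        using t by (simp add: powr_minus powr_realpow)
      then show ?thesis unfolding power_mult_distrib by (simp only: mult.assoc mult.left_commute mult_1_right) (rule mult.commute)
    qed
    also have "\<dots> \<le> C2"
      unfolding C2_def by (rule member_le_sum) (use l in auto)
    finally show ?thesis .
  qed
  show ?thesis
  proof (rule that[of "max C1 C2"])
    show "cmod (f z) \<le> max C1 C2" if "cmod z < 1" for z using f0[OF that] by simp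
    show "(cmod ((deriv ^^ l) f z))\<^sup>2 * (1 - (cmod z)\<^sup>2) ^ (2 * l - 1) \<le> max C1 C2"
      if "1 \<le> l" "l \<le> m" "cmod z < 1" for l z using fl[OF that] by simp
  qed
qed

text \<open>The growth bounds, obtained from \<open>\<mu>s m\<close>, serve every order
  \<open>j \<le> m\<close>, while the finite integrals of the factors come from membership in
  \<open>H\<close>. Being bounded, the product lies in \<open>H2\<close>.\<close>

lemma H_algebra:
  assumes m3: "3 \<le> m" and nz: "\<mu>s m \<noteq> null_measure borel" and f: "f \<in> H" and g: "g \<in> H"
  shows "(\<lambda>z. f z * g z) \<in> H"
proof -
  obtain C1 where f0: "\<And>z. cmod z < 1 \<Longrightarrow> cmod (f z) \<le> C1"
    and fl: "\<And>l z. 1 \<le> l \<Longrightarrow> l \<le> m \<Longrightarrow> cmod z < 1 \<Longrightarrow> (cmod ((deriv ^^ l) f z))\<^sup>2 * (1 - (cmod z)\<^sup>2) ^ (2 * l - 1) \<le> C1"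
    using H_growth[OF m3 nz f] by metis
  obtain C2 where g0: "\<And>z. cmod z < 1 \<Longrightarrow> cmod (g z) \<le> C2"
    and gl: "\<And>l z. 1 \<le> l \<Longrightarrow> l \<le> m \<Longrightarrow> cmod z < 1 \<Longrightarrow> (cmod ((deriv ^^ l) g z))\<^sup>2 * (1 - (cmod z)\<^sup>2) ^ (2 * l - 1) \<le> C2"
    using H_growth[OF m3 nz g] by metis
  define C where "C = max C1 C2"
  have C: "C1 \<le> C" "C2 \<le> C" by (auto simp: C_def)
  have "(\<lambda>z. f z * g z) \<in> H2"
  proof (rule bounded_hol_in_H2)
    show "hol (\<lambda>z. f z * g z)" by (intro holomorphic_intros H_hol f g)
    show "cmod (f z * g z) \<le> C1 * C2" if "cmod z < 1" for z
      unfolding norm_mult using f0[OF that] g0[OF that] order_trans[OF norm_ge_zero f0[OF that]] by (intro mult_mono) auto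
  qed
  moreover have "L2w (\<mu>s j) (j - 1) ((deriv ^^ j) (\<lambda>z. f z * g z)) < \<infinity>" if j: "j \<in> {1..m}" for j
  proof (rule circle_meas.L2w_product[OF circle_meas[OF j] H_hol[OF f] H_hol[OF g]])
    show "L2w (\<mu>s j) (j - 1) ((deriv ^^ j) f) < \<infinity>" "L2w (\<mu>s j) (j - 1) ((deriv ^^ j) g) < \<infinity>"
      using f g j by (auto simp: H_iff')
    show "(cmod ((deriv ^^ l) f z))\<^sup>2 * (1 - (cmod z)\<^sup>2) ^ (2 * l - 1) \<le> C" if "1 \<le> l" "l \<le> j" "cmod z < 1" for l z
      using order_trans[OF fl C(1)] that j by simp
    show "(cmod ((deriv ^^ l) g z))\<^sup>2 * (1 - (cmod z)\<^sup>2) ^ (2 * l - 1) \<le> C" if "1 \<le> l" "l \<le> j" "cmod z < 1" for l z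
      using order_trans[OF gl C(2)] that j by simp
    show "cmod (f z) \<le> C" "cmod (g z) \<le> C" if "cmod z < 1" for z
      using order_trans[OF f0 C(1)] order_trans[OF g0 C(2)] that by auto
  qed
  ultimately show ?thesis by (simp add: H_iff')
qed

end

theorem theorem4p1:
  fixes m :: nat and \<mu>s :: "nat \<Rightarrow> complex measure"
  assumes meas: "\<And>j. j \<in> {1..m} \<Longrightarrow> circle_measure (\<mu>s j)"
  shows "((\<forall>f\<in>Hmu m \<mu>s. \<forall>g\<in>Hmu m \<mu>s. (\<lambda>z. f z * g z) \<in> Hmu m \<mu>s) \<longrightarrow>
            (\<forall>M. closed_z_invariant m \<mu>s M \<and> nonzero_space M \<longrightarrow>
                 dim_one (wandering m \<mu>s M)))
       \<and> ((m \<ge> 3 \<and> \<mu>s m \<noteq> null_measure borel) \<longrightarrow>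
            (\<forall>M. closed_z_invariant m \<mu>s M \<and> nonzero_space M \<longrightarrow>
                 dim_one (wandering m \<mu>s M)))"
proof -
  interpret hmu m \<mu>s using meas by unfold_locales
  have part1: "dim_one (wandering m \<mu>s M)"
    if alg: "\<And>f g. f \<in> H \<Longrightarrow> g \<in> H \<Longrightarrow> (\<lambda>z. f z * g z) \<in> H"
      and M: "closed_z_invariant m \<mu>s M" "nonzero_space M" for M
  proof -
    interpret hmu_invariant m \<mu>s M using M by unfold_locales
    show ?thesis by (rule dim_one_wandering[OF alg M(2)])
  qed
  show ?thesis
    using part1 part1[OF H_algebra] by blast
qed

end
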